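(* Let $|v(x)|\lesssim\langle x\rangle^{-3-}$. Assume that the function $\psi=c+\Lambda_1+\Lambda_2+\Lambda_3$ on $\mathbb R^4$, with $c$ a constant, $\Lambda_1\in L^{p_1}$ for some $4<p_1<\infty$, $\Lambda_2\in L^{p_2}$ for some $2<p_2\le4$, and $\Lambda_3\in L^2$, solves $H\psi=0$ in the sense of distributions. Then $\phi=Uv\psi\in S_1L^2$, and $$\psi=c-G_1v\phi,\qquad c=\frac1{\|V\|_{L^1}}\langle v,T\phi\rangle=\frac1{\|V\|_{L^1}}\int_{\mathbb R^4}v(x)(T\phi)(x)\,dx.$$ In particular, $\psi-c\in L^p(\mathbb R^4)$ for any $p>4$.
   Context: $V:\mathbb R^4\to\mathbb R$ is a real-valued potential, not a.e. zero, and $H=(-\Delta)^2+V$. $U(x)=1$ if $V(x)\ge0$ and $U(x)=-1$ if $V(x)<0$; $v=|V|^{1/2}$. $\langle x\rangle=(1+|x|^2)^{1/2}$, and $|v(x)|\lesssim\langle x\rangle^{-a-}$ means $|v(x)|\le C\langle x\rangle^{-a-\epsilon}$ for some $C,\epsilon>0$. $P$ is the orthogonal projection in $L^2(\mathbb R^4)$ onto the span of $v$, $Q=1-P$. $G_1f(x)=-\frac1{8\pi^2}\int_{\mathbb R^4}\log|x-y|\,f(y)\,dy$. $T=U+vG_1v$. $S_1$ is the orthogonal projection onto the kernel of $QTQ$ on $QL^2$. *)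

theory Defs
  imports "HOL-Analysis.Analysis"
begin

type_synonym R4 = "real ^ 4"

text \<open>Measurability, null sets and integrals refer to Lebesgue measure. Elements of
  \<open>L\<^sup>p\<close> are represented by functions, and equality in \<open>L\<^sup>p\<close> is equality almost everywhere.
  Function spaces are complex-valued; the potential is real-valued.\<close>

definition mem_Lp :: "ennreal \<Rightarrow> (R4 \<Rightarrow> complex) \<Rightarrow> bool" where
  "mem_Lp p f \<longleftrightarrow> f \<in> borel_measurable lebesgue \<and>
     (if p = \<infinity> then (\<exists>C. AE x in lebesgue. norm (f x) \<le> C)
      else integrable lebesgue (\<lambda>x. norm (f x) powr enn2real p))"

definition L2 :: "(R4 \<Rightarrow> complex) set" where
  "L2 = {f. mem_Lp 2 f}"

definition L2_inner :: "(R4 \<Rightarrow> complex) \<Rightarrow> (R4 \<Rightarrow> complex) \<Rightarrow> complex" where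
  "L2_inner f g = (LINT x|lebesgue. cnj (f x) * g x)"

definition L1_norm :: "(R4 \<Rightarrow> real) \<Rightarrow> real" where
  "L1_norm V = (LINT x|lebesgue. \<bar>V x\<bar>)"

text \<open>For a closed subspace \<open>M\<close> of \<open>L\<^sup>2\<close> and \<open>f \<in> L\<^sup>2\<close>, the choice below determines
  \<open>orth_proj M f\<close> up to equality almost everywhere.\<close>

definition orth_proj :: "(R4 \<Rightarrow> complex) set \<Rightarrow> (R4 \<Rightarrow> complex) \<Rightarrow> (R4 \<Rightarrow> complex)" where
  "orth_proj M f = (SOME g. g \<in> M \<and> (\<forall>h\<in>M. L2_inner h (\<lambda>x. f x - g x) = 0))"

definition jbracket :: "R4 \<Rightarrow> real" where
  "jbracket x = sqrt (1 + (norm x)\<^sup>2)"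

text \<open>\<open>decays_faster a w\<close> is the relation \<open>|w(x)| \<lesssim> \<langle>x\<rangle>\<close> to the power \<open>-a-\<close>.\<close>

definition decays_faster :: "real \<Rightarrow> (R4 \<Rightarrow> real) \<Rightarrow> bool" where
  "decays_faster a w \<longleftrightarrow>
     (\<exists>C>0. \<exists>\<epsilon>>0. \<forall>x. \<bar>w x\<bar> \<le> C * jbracket x powr (- a - \<epsilon>))"

definition pd :: "4 \<Rightarrow> (R4 \<Rightarrow> complex) \<Rightarrow> R4 \<Rightarrow> complex" where
  "pd i f x = frechet_derivative f (at x) (axis i 1)"

fun Ck :: "nat \<Rightarrow> (R4 \<Rightarrow> complex) \<Rightarrow> bool" where
  "Ck 0 f \<longleftrightarrow> continuous_on UNIV f"
| "Ck (Suc k) f \<longleftrightarrow> f differentiable_on UNIV \<and> (\<forall>i. Ck k (pd i f))"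

definition test_function :: "(R4 \<Rightarrow> complex) \<Rightarrow> bool" where
  "test_function \<eta> \<longleftrightarrow> (\<forall>k. Ck k \<eta>) \<and> compact (closure {x. \<eta> x \<noteq> 0})"

definition laplacian :: "(R4 \<Rightarrow> complex) \<Rightarrow> R4 \<Rightarrow> complex" where
  "laplacian f x = (\<Sum>i\<in>UNIV. pd i (pd i f) x)"

definition locally_integrable :: "(R4 \<Rightarrow> complex) \<Rightarrow> bool" where
  "locally_integrable f \<longleftrightarrow> (\<forall>K. compact K \<longrightarrow> set_integrable lebesgue K f)"

text \<open>The distributional equation \<open>((-\<Delta>)\<^sup>2 + V) \<psi> = 0\<close>. Local integrability is what makes
  \<open>\<psi>\<close> and \<open>V \<psi>\<close> distributions; it is automatic for bounded measurable \<open>V\<close> and \<open>\<psi>\<close> a sum of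
  \<open>L\<^sup>p\<close> functions with \<open>p \<ge> 1\<close>. The operator \<open>(-\<Delta>)\<^sup>2\<close> is formally self-adjoint and real, so it
  passes to the test function unchanged.\<close>

definition H_distr_zero :: "(R4 \<Rightarrow> real) \<Rightarrow> (R4 \<Rightarrow> complex) \<Rightarrow> bool" where
  "H_distr_zero V \<psi> \<longleftrightarrow>
     locally_integrable \<psi> \<and> locally_integrable (\<lambda>x. of_real (V x) * \<psi> x) \<and>
     (\<forall>\<eta>. test_function \<eta> \<longrightarrow>
        (LINT x|lebesgue. \<psi> x * laplacian (laplacian \<eta>) x)
        + (LINT x|lebesgue. of_real (V x) * \<psi> x * \<eta> x) = 0)"

definition U_of :: "(R4 \<Rightarrow> real) \<Rightarrow> R4 \<Rightarrow> real" where
  "U_of V x = (if V x \<ge> 0 then 1 else - 1)"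

definition v_of :: "(R4 \<Rightarrow> real) \<Rightarrow> R4 \<Rightarrow> real" where
  "v_of V x = sqrt \<bar>V x\<bar>"

definition G1 :: "(R4 \<Rightarrow> complex) \<Rightarrow> R4 \<Rightarrow> complex" where
  "G1 f x = - (1 / (8 * of_real pi ^ 2)) * (LINT y|lebesgue. of_real (ln (norm (x - y))) * f y)"

definition T_op :: "(R4 \<Rightarrow> real) \<Rightarrow> (R4 \<Rightarrow> complex) \<Rightarrow> R4 \<Rightarrow> complex" where
  "T_op V f x = of_real (U_of V x) * f x
      + of_real (v_of V x) * G1 (\<lambda>y. of_real (v_of V y) * f y) x"

definition P_op :: "(R4 \<Rightarrow> real) \<Rightarrow> (R4 \<Rightarrow> complex) \<Rightarrow> (R4 \<Rightarrow> complex)" where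
  "P_op V = orth_proj (range (\<lambda>(a::complex) x. a * of_real (v_of V x)))"

definition Q_op :: "(R4 \<Rightarrow> real) \<Rightarrow> (R4 \<Rightarrow> complex) \<Rightarrow> (R4 \<Rightarrow> complex)" where
  "Q_op V f = (\<lambda>x. f x - P_op V f x)"

definition ker_QTQ :: "(R4 \<Rightarrow> real) \<Rightarrow> (R4 \<Rightarrow> complex) set" where
  "ker_QTQ V = {f \<in> Q_op V ` L2. AE x in lebesgue. Q_op V (T_op V (Q_op V f)) x = 0}"

definition S1 :: "(R4 \<Rightarrow> real) \<Rightarrow> (R4 \<Rightarrow> complex) \<Rightarrow> (R4 \<Rightarrow> complex)" where
  "S1 V = orth_proj (ker_QTQ V)"

definition S1_L2 :: "(R4 \<Rightarrow> real) \<Rightarrow> (R4 \<Rightarrow> complex) set" where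
  "S1_L2 V = {f \<in> L2. \<exists>g\<in>L2. AE x in lebesgue. f x = S1 V g x}"

end

theory Submission
  imports Defs
begin

text \<open>The function \<open>- log |x| / (8 \<pi>\<^sup>2)\<close> is the fundamental solution of \<open>\<Delta>\<^sup>2\<close> on \<open>\<real>\<^sup>4\<close>, so a solution of
  \<open>\<Delta>\<^sup>2\<psi> = - V\<psi>\<close> ought to be a constant minus \<open>G\<^sub>1(V\<psi>)\<close>. Rather than subtracting the potential and
  appealing to regularity and a Liouville theorem for biharmonic functions, the proof tests the
  equation against one explicit family.

  Let \<open>h\<close> be smooth on the real line with \<open>h(s) = (ln s) / 2\<close> for \<open>s \<ge> 1\<close>, and put
  \<open>g\<^sub>e(x) = ln e + h(|x - a|\<^sup>2 / e\<^sup>2)\<close>. This equals \<open>ln |x - a|\<close> off the ball of radius \<open>e\<close>, so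
  \<open>g\<^sub>e - g\<^sub>R\<close> is a test function for \<open>e < R\<close>, and \<open>\<Delta>\<^sup>2g\<^sub>e\<close> is an approximate identity
  \<open>W(|x - a|\<^sup>2 / e\<^sup>2) / e\<^sup>4\<close> of total mass \<open>- 8 \<pi>\<^sup>2\<close>, supported in the ball of radius \<open>e\<close>
  (\<open>test_function_log_difference\<close>, \<open>integral_bilap_log\<close>). The equation therefore says that
  \<open>\<integral> \<psi> \<Delta>\<^sup>2g\<^sub>e + \<integral> V\<psi> g\<^sub>e\<close> is the same number for every \<open>e\<close> (\<open>balance_eq\<close>).

  As \<open>e\<close> tends to infinity the first term tends to \<open>- 8 \<pi>\<^sup>2 c\<close>, because averages of an \<open>L\<^sup>p\<close>
  function with finite \<open>p\<close> over large balls vanish in the limit, while the second contains the term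
  \<open>ln e \<integral> V\<psi>\<close>. Hence \<open>\<integral> V\<psi> = 0\<close> (\<open>source_neutral\<close>) and the common value is \<open>- 8 \<pi>\<^sup>2 c\<close>. As \<open>e\<close>
  tends to zero the two terms tend to \<open>- 8 \<pi>\<^sup>2 \<psi>(a)\<close> and \<open>\<integral> V\<psi>(x) ln |x - a| dx\<close>. Equating the two
  limits gives \<open>\<psi> = c - G\<^sub>1(V\<psi>)\<close> almost everywhere (\<open>representation\<close>), and \<open>V\<psi> = v\<phi>\<close>.

  The other claims are read off from this. Multiplying by \<open>v\<close> gives \<open>T\<phi> = c v\<close>; together with
  \<open>\<langle>v, \<phi>\<rangle> = \<integral> V\<psi> = 0\<close> this places \<open>\<phi>\<close> in the kernel of \<open>QTQ\<close>, which \<open>S\<^sub>1\<close> fixes, and pairing \<open>T\<phi>\<close>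
  with \<open>v\<close> computes \<open>c\<close>. Finally a neutral source that decays like \<open>V\<psi>\<close> has a logarithmic potential
  bounded by a multiple of \<open>1 / (1 + |x|)\<close> (\<open>log_pot_decay\<close>), a function that lies in \<open>L\<^sup>p(\<real>\<^sup>4)\<close>
  exactly for \<open>p > 4\<close>.\<close>

section \<open>Radial integrals over four-dimensional space\<close>

text \<open>The distribution function of \<open>|x - a|\<^sup>2\<close> is the volume \<open>\<pi>\<^sup>2 t\<^sup>2 / 2\<close> of a ball of radius \<open>\<surd>t\<close>, so
  its density is \<open>\<pi>\<^sup>2 s\<close>. Every integral of a radial function below is reduced to one variable in
  this way.\<close>

lemma distr_norm_sq:
  fixes a :: R4
  shows "distr lborel borel (\<lambda>x. (norm (x - a))\<^sup>2)
       = density lborel (\<lambda>s::real. ennreal (pi\<^sup>2 * s) * indicator {0..} s)" (is "?D = ?E")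
proof (rule measure_eqI_generator_eq)
  let ?G = "range (\<lambda>t::real. {..t})"
  show "Int_stable ?G"
    by (auto simp: Int_stable_def)
  show "?G \<subseteq> Pow UNIV" by auto
  show "sets ?D = sigma_sets UNIV ?G" "sets ?E = sigma_sets UNIV ?G"
    by (simp_all add: borel_eq_atMost)
  show "range (\<lambda>n::nat. {..real n}) \<subseteq> ?G" by auto
  show "(\<Union>n::nat. {..real n}) = UNIV"
    by (auto intro: real_arch_simple)
  have cb: "emeasure ?D {..t} = emeasure lborel (cball a (sqrt t))" if "t \<ge> 0" for t
  proof -
    have "(norm (x - a))\<^sup>2 \<le> t \<longleftrightarrow> norm (x - a) \<le> sqrt t" for x
      using real_le_rsqrt[of "norm (x - a)" t] power_mono[of "norm (x-a)" "sqrt t" 2] that by auto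
    then have "(\<lambda>x. (norm (x - a))\<^sup>2) -` {..t} = cball a (sqrt t)"
      by (auto simp: dist_norm norm_minus_commute)
    then show ?thesis by (simp add: emeasure_distr)
  qed
  show "emeasure ?D {..real n} \<noteq> \<infinity>" for n
    using cb[of "real n"] emeasure_lborel_cball_finite[of a "sqrt (real n)"] by simp
  fix X assume "X \<in> ?G"
  then obtain t where X: "X = {..t}" by auto
  show "emeasure ?D X = emeasure ?E X"
  proof (cases "t < 0")
    case True
    then have "(\<lambda>x. (norm (x - a))\<^sup>2) -` X = {}"
      using X by (auto simp: not_le) (smt (verit) zero_le_power2)
    moreover have "emeasure ?E X = 0"
    proof -
      have "(\<integral>\<^sup>+ s. ennreal (pi\<^sup>2 * s) * indicator {0..} s * indicator X s \<partial>lborel) = (\<integral>\<^sup>+ s. 0 * s \<partial>lborel)"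
        by (intro nn_integral_cong) (use X True in \<open>auto split: split_indicator\<close>)
      then show ?thesis using X by (simp add: emeasure_density)
    qed
    ultimately show ?thesis using X by (simp add: emeasure_distr)
  next
    case False
    then have t: "t \<ge> 0" by simp
    have "emeasure ?D X = ennreal (pi\<^sup>2 / 2 * t\<^sup>2)"
      using cb[OF t] t X emeasure_cball[of "sqrt t" a]
      by (simp add: eval_unit_ball_vol power2_eq_square) (simp add: power4_eq_xxxx)
    moreover have "emeasure ?E X = (\<integral>\<^sup>+ s. ennreal (pi\<^sup>2 * s) * indicator {0..t} s \<partial>lborel)"
      using X by (auto simp: emeasure_density intro!: nn_integral_cong split: split_indicator)
    moreover have "\<dots> = ennreal (pi\<^sup>2 / 2 * t\<^sup>2 - pi\<^sup>2 / 2 * 0\<^sup>2)"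
      by (rule nn_integral_FTC_Icc[where F = "\<lambda>s. pi\<^sup>2 / 2 * s\<^sup>2"])
         (use t in \<open>auto intro!: derivative_eq_intros simp: power2_eq_square\<close>)
    ultimately show ?thesis by simp
  qed
qed

lemma nn_integral_radial:
  fixes a :: R4
  assumes [measurable]: "F \<in> borel_measurable borel"
  shows "(\<integral>\<^sup>+ x. F ((norm (x - a))\<^sup>2) \<partial>lborel)
       = (\<integral>\<^sup>+ s. ennreal (pi\<^sup>2 * s) * indicator {0..} s * F s \<partial>lborel)"
proof -
  have "(\<integral>\<^sup>+ x. F ((norm (x - a))\<^sup>2) \<partial>lborel)
      = (\<integral>\<^sup>+ s. F s \<partial>distr lborel borel (\<lambda>x. (norm (x - a))\<^sup>2))"
    by (subst nn_integral_distr) auto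
  also have "\<dots> = (\<integral>\<^sup>+ s. ennreal (pi\<^sup>2 * s) * indicator {0..} s * F s \<partial>lborel)"
    unfolding distr_norm_sq by (subst nn_integral_density) auto
  finally show ?thesis .
qed

lemma integral_radial:
  fixes a :: R4 and F :: "real \<Rightarrow> real"
  assumes [measurable]: "F \<in> borel_measurable borel"
  shows "(LINT x|lborel. F ((norm (x - a))\<^sup>2)) = (LINT s|lborel. indicator {0..} s * (pi\<^sup>2 * s * F s))"
proof -
  have D: "density lborel (\<lambda>s::real. ennreal (pi\<^sup>2 * s) * indicator {0..} s)
      = density lborel (\<lambda>s. ennreal (indicator {0..} s * (pi\<^sup>2 * s)))"
    by (intro density_cong) (auto split: split_indicator)
  have "(LINT x|lborel. F ((norm (x - a))\<^sup>2))
      = (LINT s|distr lborel borel (\<lambda>x. (norm (x - a))\<^sup>2). F s)"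
    by (subst integral_distr) auto
  also have "\<dots> = (LINT s|lborel. (indicator {0..} s * (pi\<^sup>2 * s)) *\<^sub>R F s)"
    unfolding distr_norm_sq D by (subst integral_density) (auto split: split_indicator)
  finally show ?thesis by (simp add: mult.assoc)
qed

text \<open>Since \<open>|ln t| \<le> 1 / t\<close> for small \<open>t\<close>, the local integrability of \<open>|x|\<^sup>-\<^sup>2\<close> controls the square of the
  logarithmic singularity, with an explicit dependence on the radius.\<close>

lemma nn_integral_inverse_square_cball:
  fixes a :: R4
  assumes "r \<ge> 0"
  shows "(\<integral>\<^sup>+ x. ennreal (inverse ((norm (x - a))\<^sup>2)) * indicator (cball a r) x \<partial>lborel) = ennreal (pi\<^sup>2 * r\<^sup>2)"
proof -
  have "(\<integral>\<^sup>+ x. ennreal (inverse ((norm (x - a))\<^sup>2)) * indicator (cball a r) x \<partial>lborel)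
      = (\<integral>\<^sup>+ x. (\<lambda>s. ennreal (inverse s) * indicator {..r\<^sup>2} s) ((norm (x - a))\<^sup>2) \<partial>lborel)"
  proof (intro nn_integral_cong)
    fix x :: R4
    have "x \<in> cball a r \<longleftrightarrow> (norm (x - a))\<^sup>2 \<in> {..r\<^sup>2}"
      using assms by (auto simp: dist_norm norm_minus_commute power_mono abs_le_square_iff[symmetric])
    then show "ennreal (inverse ((norm (x - a))\<^sup>2)) * indicator (cball a r) x
        = ennreal (inverse ((norm (x - a))\<^sup>2)) * indicator {..r\<^sup>2} ((norm (x - a))\<^sup>2)"
      by (simp add: indicator_def)
  qed
  also have "\<dots> = (\<integral>\<^sup>+ s. ennreal (pi\<^sup>2 * s) * indicator {0..} s * (ennreal (inverse s) * indicator {..r\<^sup>2} s) \<partial>lborel)"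
    by (rule nn_integral_radial) auto
  also have "\<dots> = (\<integral>\<^sup>+ s. ennreal (pi\<^sup>2) * indicator {0..r\<^sup>2} s \<partial>lborel)"
  proof (rule nn_integral_cong_AE)
    have "AE s::real in lborel. s \<noteq> 0" by (rule AE_lborel_singleton)
    then show "AE s in lborel. ennreal (pi\<^sup>2 * s) * indicator {0..} s * (ennreal (inverse s) * indicator {..r\<^sup>2} s)
        = ennreal (pi\<^sup>2) * indicator {0..r\<^sup>2} s"
      by eventually_elim (auto split: split_indicator simp: ennreal_mult'[symmetric])
  qed
  also have "\<dots> = ennreal (pi\<^sup>2 * r\<^sup>2)"
    by (simp add: nn_integral_cmult_indicator ennreal_mult)
  finally show ?thesis .
qed

lemma integrable_inverse_square_cball:
  fixes a :: R4
  assumes "r \<ge> 0"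
  shows "integrable lborel (\<lambda>x. inverse ((norm (x - a))\<^sup>2) * indicator (cball a r) x)"
    and "(LINT x|lborel. inverse ((norm (x - a))\<^sup>2) * indicator (cball a r) x) = pi\<^sup>2 * r\<^sup>2"
proof -
  have "(\<integral>\<^sup>+ x. ennreal (inverse ((norm (x - a))\<^sup>2) * indicator (cball a r) x) \<partial>lborel)
      = (\<integral>\<^sup>+ x. ennreal (inverse ((norm (x - a))\<^sup>2)) * indicator (cball a r) x \<partial>lborel)"
    by (intro nn_integral_cong) (auto split: split_indicator)
  also note nn_integral_inverse_square_cball[OF assms]
  finally have *: "(\<integral>\<^sup>+ x. ennreal (inverse ((norm (x - a))\<^sup>2) * indicator (cball a r) x) \<partial>lborel) = ennreal (pi\<^sup>2 * r\<^sup>2)" .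
  show int: "integrable lborel (\<lambda>x. inverse ((norm (x - a))\<^sup>2) * indicator (cball a r) x)"
  proof (rule integrableI_nonneg)
    have "(\<lambda>x. inverse ((norm (x - a))\<^sup>2)) \<in> borel_measurable borel" by measurable
    moreover have "indicat_real (cball a r) \<in> borel_measurable borel"
      by (intro borel_measurable_indicator) auto
    ultimately show "(\<lambda>x. inverse ((norm (x - a))\<^sup>2) * indicator (cball a r) x) \<in> borel_measurable lborel"
      by simp
  qed (auto simp: * split: split_indicator)
  show "(LINT x|lborel. inverse ((norm (x - a))\<^sup>2) * indicator (cball a r) x) = pi\<^sup>2 * r\<^sup>2"
    using borel_measurable_integrable[OF int]
    by (subst integral_eq_nn_integral) (auto simp: * split: split_indicator)
qed

lemma integrable_bracket_powr:
  assumes "q > 2"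
  shows "integrable lborel (\<lambda>x::R4. (1 + (norm x)\<^sup>2) powr (- q))"
proof (rule integrableI_nonneg)
  have "(\<integral>\<^sup>+ x. ennreal ((1 + (norm (x::R4))\<^sup>2) powr (- q)) \<partial>lborel)
      = (\<integral>\<^sup>+ x. (\<lambda>s. ennreal ((1 + s) powr (- q))) ((norm (x - (0::R4)))\<^sup>2) \<partial>lborel)" by simp
  also have "\<dots> = (\<integral>\<^sup>+ s. ennreal (pi\<^sup>2 * s) * indicator {0..} s * ennreal ((1 + s) powr (- q)) \<partial>lborel)"
    by (rule nn_integral_radial) auto
  also have "\<dots> \<le> (\<integral>\<^sup>+ s. ennreal (pi\<^sup>2 * (1 + s) powr (1 - q)) * indicator {0..} s \<partial>lborel)"
  proof (rule nn_integral_mono)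
    fix s :: real
    have "pi\<^sup>2 * s * (1 + s) powr (- q) \<le> pi\<^sup>2 * (1 + s) powr (1 - q)" if "s \<ge> 0"
    proof -
      have "(1 + s) powr (1 - q) = (1 + s) * (1 + s) powr (- q)"
        using that by (simp add: powr_diff powr_minus divide_inverse)
      then show ?thesis using that by (simp add: mult_right_mono)
    qed
    then show "ennreal (pi\<^sup>2 * s) * indicator {0..} s * ennreal ((1 + s) powr (- q))
        \<le> ennreal (pi\<^sup>2 * (1 + s) powr (1 - q)) * indicator {0..} s"
      by (auto split: split_indicator simp: ennreal_mult'[symmetric] intro!: ennreal_leI)
  qed
  also have "\<dots> = ennreal (0 - pi\<^sup>2 * (1 + 0) powr (2 - q) / (2 - q))"
  proof (rule nn_integral_FTC_atLeast)
    show "((\<lambda>s. pi\<^sup>2 * (1 + s) powr (2 - q) / (2 - q)) has_real_derivative pi\<^sup>2 * (1 + s) powr (1 - q)) (at s)"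
      if "0 \<le> s" for s
    proof -
      have "((\<lambda>s. (1 + s) powr (2 - q)) has_real_derivative (2 - q) * (1 + s) powr (1 - q)) (at s)"
        using that by (auto intro!: derivative_eq_intros)
      from DERIV_cmult[OF this, of "pi\<^sup>2 / (2 - q)"] show ?thesis
        using assms by simp
    qed
    have "((\<lambda>s::real. (1 + s) powr (2 - q)) \<longlongrightarrow> 0) at_top"
      using assms by (intro tendsto_neg_powr filterlim_tendsto_add_at_top[OF tendsto_const] filterlim_ident) auto
    then show "((\<lambda>s. pi\<^sup>2 * (1 + s) powr (2 - q) / (2 - q)) \<longlongrightarrow> 0) at_top"
      using tendsto_mult_left[of _ 0 at_top "pi\<^sup>2 / (2 - q)"] by fastforce
  qed auto
  also have "\<dots> < \<infinity>" by simp
  finally show "(\<integral>\<^sup>+ x. ennreal ((1 + (norm (x::R4))\<^sup>2) powr (- q)) \<partial>lborel) < \<infinity>" .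
qed auto

section \<open>A smooth truncation of the logarithm and radial test functions\<close>

definition flat :: "nat \<Rightarrow> real \<Rightarrow> real" where
  "flat k t = (if t > 0 then exp (- inverse t) * inverse t ^ k else 0)"

lemma exp_ge_monomial: "x \<ge> 0 \<Longrightarrow> x ^ n / fact n \<le> exp (x :: real)"
proof -
  assume x: "x \<ge> 0"
  have "(\<Sum>k\<in>{n}. x ^ k /\<^sub>R fact k) \<le> (\<Sum>k. x ^ k /\<^sub>R fact k)"
    using x by (intro sum_le_suminf summable_exp_generic) auto
  then show ?thesis by (simp add: exp_def divide_inverse mult.commute)
qed

lemma flat_le: "\<bar>flat k t\<bar> \<le> fact (k + 2) * t\<^sup>2"
proof (cases "t > 0")
  case True
  let ?u = "inverse t"
  have u: "?u > 0" using True by simp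
  have "?u ^ (k + 2) \<le> fact (k + 2) * exp ?u"
    using exp_ge_monomial[of ?u "k + 2"] u by (simp only: pos_divide_le_eq[OF fact_gt_zero] mult.commute)
  then have "exp (- ?u) * ?u ^ (k + 2) \<le> fact (k + 2)"
    by (simp only: exp_minus inverse_eq_divide[of "exp _"]) (simp add: divide_le_eq)
  then have "exp (- ?u) * ?u ^ (k + 2) * t\<^sup>2 \<le> fact (k + 2) * t\<^sup>2"
    by (intro mult_right_mono) auto
  moreover have "exp (- ?u) * ?u ^ (k + 2) * t\<^sup>2 = flat k t"
    using True by (simp add: flat_def power_add power2_eq_square field_simps)
  moreover have "flat k t \<ge> 0" using True by (simp add: flat_def)
  ultimately show ?thesis by simp
qed (simp add: flat_def)

text \<open>Differentiating \<open>t\<^sup>-\<^sup>k exp (- 1 / t)\<close> gives a combination of functions of the same form. At the origin the bound \<open>flat_le\<close> makes the difference quotient vanish.\<close>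

lemma flat_has_derivative:
  "(flat k has_real_derivative (flat (k + 2) t - real k * flat (k + 1) t)) (at t)"
proof -
  consider "t > 0" | "t < 0" | "t = 0" by linarith
  then show ?thesis
  proof cases
    case 1
    have "((\<lambda>t. exp (- inverse t) * inverse t ^ k) has_real_derivative
        (flat (k + 2) t - real k * flat (k + 1) t)) (at t)"
    proof -
      have inv: "(inverse has_real_derivative - (inverse t * inverse t)) (at t)"
        using 1 DERIV_inverse'[OF DERIV_ident, of t] by simp
      have 2: "((\<lambda>t. inverse t ^ k) has_real_derivative - (real k * inverse t ^ (k + 1))) (at t)"
        using DERIV_power[OF inv, of k] by (cases k) (auto simp: algebra_simps)
      have 3: "((\<lambda>t. exp (- inverse t)) has_real_derivative exp (- inverse t) * (inverse t * inverse t)) (at t)"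
        using DERIV_chain2[OF DERIV_exp DERIV_minus[OF inv]] by simp
      show ?thesis
        using DERIV_mult[OF 3 2] 1 by (simp add: flat_def power2_eq_square algebra_simps)
    qed
    then show ?thesis
      by (rule has_field_derivative_transform_within_open[where S = "{0<..}"]) (use 1 in \<open>auto simp: flat_def\<close>)
  next
    case 2
    have "((\<lambda>t. 0) has_real_derivative (flat (k + 2) t - real k * flat (k + 1) t)) (at t)"
      using 2 by (simp add: flat_def)
    then show ?thesis
      by (rule has_field_derivative_transform_within_open[where S = "{..<0}"]) (use 2 in \<open>auto simp: flat_def\<close>)
  next
    case 3
    have "((\<lambda>y. flat k y / y) \<longlongrightarrow> 0) (at 0)"
    proof (rule Lim_null_comparison)
      show "((\<lambda>y::real. fact (k + 2) * \<bar>y\<bar>) \<longlongrightarrow> 0) (at 0)"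
        by (auto intro!: tendsto_eq_intros)
      have "norm (flat k y / y) \<le> fact (k + 2) * \<bar>y\<bar>" if "y \<noteq> 0" for y
      proof -
        have "norm (flat k y / y) \<le> fact (k + 2) * y\<^sup>2 / \<bar>y\<bar>"
          unfolding real_norm_def abs_divide by (intro divide_right_mono flat_le) simp
        also have "y\<^sup>2 = \<bar>y\<bar> * \<bar>y\<bar>" by (simp add: power2_eq_square)
        finally show ?thesis using that by (simp only: times_divide_eq_left mult.assoc[symmetric]) simp
      qed
      then show "\<forall>\<^sub>F y in at 0. norm (flat k y / y) \<le> fact (k + 2) * \<bar>y\<bar>"
        by (auto simp: eventually_at_filter)
    qed
    then show ?thesis using 3 by (simp add: has_field_derivative_iff flat_def)
  qed
qed

text \<open>The inverse is admitted only for functions without zeros on the whole line, so members are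
  differentiable everywhere.\<close>

inductive elementary :: "(real \<Rightarrow> real) \<Rightarrow> bool" where
  const: "elementary (\<lambda>s. c)"
| ident: "elementary (\<lambda>s. s)"
| flat: "elementary (\<lambda>s. flat k (1 - s))"
| add: "elementary f \<Longrightarrow> elementary g \<Longrightarrow> elementary (\<lambda>s. f s + g s)"
| mult: "elementary f \<Longrightarrow> elementary g \<Longrightarrow> elementary (\<lambda>s. f s * g s)"
| inv: "elementary f \<Longrightarrow> (\<And>s. f s \<noteq> 0) \<Longrightarrow> elementary (\<lambda>s. inverse (f s))"

text \<open>A class of functions closed under differentiation consists of smooth functions.\<close>

lemma elementary_derivative:
  "elementary f \<Longrightarrow> \<exists>f'. elementary f' \<and> (\<forall>s. (f has_real_derivative f' s) (at s))"
proof (induction rule: elementary.induct)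
  case (const c)
  show ?case by (rule exI[of _ "\<lambda>s. 0"]) (auto intro: elementary.const)
next
  case ident
  show ?case by (rule exI[of _ "\<lambda>s. 1"]) (auto intro: elementary.const)
next
  case (flat k)
  let ?f' = "\<lambda>s. (-1) * flat (k + 2) (1 - s) + real k * flat (k + 1) (1 - s)"
  have "elementary ?f'"
    by (intro elementary.intros)
  moreover have "((\<lambda>s. flat k (1 - s)) has_real_derivative ?f' s) (at s)" for s
  proof -
    have "((\<lambda>s::real. 1 - s) has_real_derivative -1) (at s)"
      by (auto intro!: derivative_eq_intros)
    from DERIV_chain2[OF flat_has_derivative this, of k] show ?thesis
      by (simp add: algebra_simps)
  qed
  ultimately show ?case by blast
next
  case (add f g)
  then obtain f' g' where "elementary f'" "elementary g'"
    "\<And>s. (f has_real_derivative f' s) (at s)" "\<And>s. (g has_real_derivative g' s) (at s)" by blast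
  then show ?case
    by (intro exI[of _ "\<lambda>s. f' s + g' s"]) (auto intro!: elementary.add DERIV_add)
next
  case (mult f g)
  then obtain f' g' where "elementary f'" "elementary g'"
    "\<And>s. (f has_real_derivative f' s) (at s)" "\<And>s. (g has_real_derivative g' s) (at s)" by blast
  then show ?case using mult.hyps
    by (intro exI[of _ "\<lambda>s. f' s * g s + g' s * f s"]) (auto intro!: elementary.add elementary.mult DERIV_mult)
next
  case (inv f)
  then obtain f' where f': "elementary f'" "\<And>s. (f has_real_derivative f' s) (at s)" by blast
  have "((\<lambda>s. inverse (f s)) has_real_derivative (-1) * f' s * inverse (f s) * inverse (f s)) (at s)" for s
    using inv.hyps(2) by (auto intro!: derivative_eq_intros f'(2))
  moreover have "elementary (\<lambda>s. (-1) * f' s * inverse (f s) * inverse (f s))"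
    using f'(1) inv.hyps by (intro elementary.mult elementary.const elementary.inv) auto
  ultimately show ?case by blast
qed

text \<open>The argument of the logarithm is positive on the whole line and equals \<open>s\<^sup>2\<close> for \<open>s \<ge> 1\<close>; thus
  \<open>x \<mapsto> reg_log (|x|\<^sup>2)\<close> is a smooth function that agrees with \<open>ln |x|\<close> outside the unit ball.\<close>

definition reg_log :: "real \<Rightarrow> real" where
  "reg_log s = ln (s\<^sup>2 + flat 0 (1 - s)) / 4"

lemma reg_log_arg_pos: "s\<^sup>2 + flat 0 (1 - s) > 0"
  by (cases "s = 0") (auto simp: flat_def intro!: add_pos_nonneg)

lemma reg_log_eq: "s \<ge> 1 \<Longrightarrow> reg_log s = ln s / 2"
  by (simp add: reg_log_def flat_def ln_realpow)

definition reg_log_deriv :: "nat \<Rightarrow> real \<Rightarrow> real" where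
  "reg_log_deriv k = (deriv ^^ k) reg_log"

lemma reg_log_deriv_0: "reg_log_deriv 0 = reg_log" by (simp add: reg_log_deriv_def)

text \<open>The function \<^const>\<open>reg_log\<close> itself is not \<^const>\<open>elementary\<close>, because of the logarithm, but its first
  derivative is.\<close>

lemma reg_log_deriv_derivative: "(reg_log_deriv k has_real_derivative reg_log_deriv (Suc k) s) (at s)"
proof -
  let ?m = "\<lambda>s. s * s + flat 0 (1 - s)"
  have el: "elementary ?m" by (intro elementary.intros)
  have pos: "?m s > 0" for s using reg_log_arg_pos[of s] by (simp add: power2_eq_square)
  obtain m' where m': "elementary m'" "\<And>s. (?m has_real_derivative m' s) (at s)"
    using elementary_derivative[OF el] by blast
  have *: "(reg_log has_real_derivative (1 / 4) * m' s * inverse (?m s)) (at s)" for s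
  proof -
    have "((\<lambda>s. ln (?m s) / 4) has_real_derivative (1 / 4) * m' s * inverse (?m s)) (at s)"
      using DERIV_cmult[OF DERIV_chain2[OF DERIV_ln[OF pos[of s]] m'(2)[of s]], of "1 / 4"]
      by (simp add: mult_ac)
    moreover have "reg_log = (\<lambda>s. ln (?m s) / 4)"
      by (rule ext) (simp add: reg_log_def power2_eq_square)
    ultimately show ?thesis by simp
  qed
  have "elementary (\<lambda>s. (1 / 4) * m' s * inverse (?m s))"
    using pos by (intro elementary.mult elementary.const elementary.inv m' el) (auto simp: less_imp_neq[symmetric])
  then have 1: "elementary (reg_log_deriv (Suc 0))"
  proof -
    have "deriv reg_log = (\<lambda>s. (1 / 4) * m' s * inverse (?m s))"
      by (rule ext, rule DERIV_imp_deriv[OF *])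
    then show ?thesis
      using \<open>elementary (\<lambda>s. (1 / 4) * m' s * inverse (?m s))\<close> by (simp add: reg_log_deriv_def)
  qed
  have "elementary (reg_log_deriv (Suc k))" for k
  proof (induction k)
    case (Suc k)
    obtain f' where "elementary f'" "\<And>s. (reg_log_deriv (Suc k) has_real_derivative f' s) (at s)"
      using elementary_derivative[OF Suc] by blast
    moreover from this have "reg_log_deriv (Suc (Suc k)) = f'"
      unfolding reg_log_deriv_def by (auto intro!: ext DERIV_imp_deriv)
    ultimately show ?case by simp
  qed (rule 1)
  then have "k > 0 \<Longrightarrow> \<exists>D. (reg_log_deriv k has_real_derivative D) (at s)"
    using elementary_derivative by (cases k) blast+
  moreover have "k = 0 \<Longrightarrow> \<exists>D. (reg_log_deriv k has_real_derivative D) (at s)"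
    using * by (auto simp: reg_log_deriv_0)
  ultimately obtain D where D: "(reg_log_deriv k has_real_derivative D) (at s)"
    by (cases "k = 0") auto
  then have "D = reg_log_deriv (Suc k) s"
    using DERIV_imp_deriv[OF D] by (simp add: reg_log_deriv_def)
  with D show ?thesis by simp
qed

inductive radial_algebra :: "(nat \<Rightarrow> real \<Rightarrow> real) \<Rightarrow> R4 \<Rightarrow> (R4 \<Rightarrow> complex) \<Rightarrow> bool"
  for D a where
  const: "radial_algebra D a (\<lambda>x. c)"
| coord: "radial_algebra D a (\<lambda>x. of_real ((x - a) $ i))"
| radial: "radial_algebra D a (\<lambda>x. of_real (D k ((norm (x - a))\<^sup>2)))"
| add: "radial_algebra D a f \<Longrightarrow> radial_algebra D a g \<Longrightarrow> radial_algebra D a (\<lambda>x. f x + g x)"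
| mult: "radial_algebra D a f \<Longrightarrow> radial_algebra D a g \<Longrightarrow> radial_algebra D a (\<lambda>x. f x * g x)"

lemma pd_eq: "(f has_derivative f') (at x) \<Longrightarrow> pd i f x = f' (axis i 1)"
  unfolding pd_def by (metis frechet_derivative_at)

lemma has_derivative_radial:
  fixes a :: R4
  assumes "(F has_real_derivative d) (at ((norm (x - a))\<^sup>2))"
  shows "((\<lambda>x. complex_of_real (F ((norm (x - a))\<^sup>2))) has_derivative
     (\<lambda>v. of_real (d * (2 * ((x - a) \<bullet> v))))) (at x)"
proof -
  have 1: "((\<lambda>x. (norm (x - a))\<^sup>2) has_derivative (\<lambda>v. 2 * ((x - a) \<bullet> v))) (at x)"
    unfolding power2_norm_eq_inner
    by (auto intro!: derivative_eq_intros simp: inner_commute)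
  have 2: "(F has_derivative (\<lambda>y. d * y)) (at ((norm (x - a))\<^sup>2))"
    using assms by (simp add: has_field_derivative_def)
  show ?thesis
    by (rule has_derivative_of_real) (rule has_derivative_compose[OF 1 2])
qed

lemma pd_radial:
  fixes a :: R4
  assumes "(F has_real_derivative d) (at ((norm (x - a))\<^sup>2))"
  shows "pd i (\<lambda>x. complex_of_real (F ((norm (x - a))\<^sup>2))) x = of_real (2 * (x - a) $ i * d)"
  using pd_eq[OF has_derivative_radial[OF assms], of i] by (simp add: inner_axis)

lemma has_derivative_coord:
  fixes a :: R4
  shows "((\<lambda>x. complex_of_real ((x - a) $ i)) has_derivative (\<lambda>v. of_real (v $ i))) (at x)"
proof -
  have "((\<lambda>x. (x - a) $ i) has_derivative (\<lambda>v. v $ i)) (at x)"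
    by (rule has_derivative_eq_rhs, rule bounded_linear.has_derivative[OF bounded_linear_vec_nth])
       (auto intro!: derivative_eq_intros)
  then show ?thesis by (rule has_derivative_of_real)
qed

text \<open>By the chain rule the partial derivatives of \<open>D k (|x - a|\<^sup>2)\<close> are \<open>2 (x - a)\<^sub>i D (k + 1) (|x - a|\<^sup>2)\<close>,
  so the algebra generated by the coordinates and these functions is closed under differentiation;
  its members are smooth.\<close>

lemma radial_algebra_pd:
  assumes D: "\<And>k s. (D k has_real_derivative D (Suc k) s) (at s)"
  shows "radial_algebra D a f \<Longrightarrow> (\<forall>x. f differentiable (at x)) \<and> (\<forall>i. radial_algebra D a (pd i f))"
proof (induction rule: radial_algebra.induct)
  case (const c)
  have "pd i (\<lambda>x. c) = (\<lambda>x. 0)" for i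
    by (rule ext, subst pd_eq[where f' = "\<lambda>v. 0"]) auto
  then show ?case by (auto intro: radial_algebra.const)
next
  case (coord j)
  have "pd i (\<lambda>x. of_real ((x - a) $ j)) = (\<lambda>x. of_real (axis i 1 $ j))" for i
    by (rule ext, subst pd_eq[OF has_derivative_coord]) auto
  then show ?case
    using differentiableI[OF has_derivative_coord] by (auto intro: radial_algebra.const simp del: vector_minus_component)
next
  case (radial k)
  have "pd i (\<lambda>x. of_real (D k ((norm (x - a))\<^sup>2)))
      = (\<lambda>x. 2 * of_real ((x - a) $ i) * of_real (D (Suc k) ((norm (x - a))\<^sup>2)))" for i
    by (rule ext, subst pd_radial[OF D]) simp
  then show ?case
    using differentiableI[OF has_derivative_radial[OF D]]
    by (auto intro!: radial_algebra.mult radial_algebra.const radial_algebra.coord radial_algebra.radial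
        simp del: vector_minus_component)
next
  case (add f g)
  have "pd i (\<lambda>x. f x + g x) = (\<lambda>x. pd i f x + pd i g x)" for i
  proof
    fix x
    obtain f' g' where fg: "(f has_derivative f') (at x)" "(g has_derivative g') (at x)"
      using add.IH unfolding differentiable_def by blast
    show "pd i (\<lambda>x. f x + g x) x = pd i f x + pd i g x"
      using pd_eq[OF has_derivative_add[OF fg], of i] pd_eq[OF fg(1), of i] pd_eq[OF fg(2), of i] by simp
  qed
  then show ?case using add.IH by (auto intro: radial_algebra.add)
next
  case (mult f g)
  have "pd i (\<lambda>x. f x * g x) = (\<lambda>x. f x * pd i g x + pd i f x * g x)" for i
  proof
    fix x
    obtain f' g' where fg: "(f has_derivative f') (at x)" "(g has_derivative g') (at x)"
      using mult.IH unfolding differentiable_def by blast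
    show "pd i (\<lambda>x. f x * g x) x = f x * pd i g x + pd i f x * g x"
      using pd_eq[OF has_derivative_mult[OF fg], of i] pd_eq[OF fg(1), of i] pd_eq[OF fg(2), of i] by simp
  qed
  then show ?case using mult by (auto intro!: radial_algebra.add radial_algebra.mult)
qed

lemma radial_algebra_Ck:
  assumes D: "\<And>k s. (D k has_real_derivative D (Suc k) s) (at s)"
  shows "radial_algebra D a f \<Longrightarrow> Ck n f"
proof (induction n arbitrary: f)
  case 0
  then show ?case using radial_algebra_pd[OF D 0]
    by (auto simp: differentiable_imp_continuous_within continuous_on_eq_continuous_within)
next
  case (Suc n)
  then show ?case using radial_algebra_pd[OF D Suc.prems]
    by (auto simp: differentiable_on_def)
qed

text \<open>With \<open>s = |x - a|\<^sup>2\<close> the Laplacian of a radial function in dimension four is \<open>8 F' + 4 s F''\<close>, again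
  radial in the same variable, so that it can be iterated.\<close>

lemma laplacian_radial:
  fixes a :: R4
  assumes D: "\<And>s. (F has_real_derivative F1 s) (at s)" "\<And>s. (F1 has_real_derivative F2 s) (at s)"
  shows "laplacian (\<lambda>x. complex_of_real (F ((norm (x - a))\<^sup>2)))
       = (\<lambda>x. of_real ((\<lambda>s. 8 * F1 s + 4 * s * F2 s) ((norm (x - a))\<^sup>2)))"
proof
  fix x
  let ?s = "(norm (x - a))\<^sup>2"
  have 1: "pd i (\<lambda>x. complex_of_real (F ((norm (x - a))\<^sup>2)))
      = (\<lambda>x. (2 * of_real ((x - a) $ i)) * of_real (F1 ((norm (x - a))\<^sup>2)))" for i
    by (rule ext, subst pd_radial[OF D(1)]) simp
  have 2: "pd i (\<lambda>x. (2 * complex_of_real ((x - a) $ i)) * of_real (F1 ((norm (x - a))\<^sup>2))) x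
     = of_real (2 * F1 ?s + 4 * ((x - a) $ i)\<^sup>2 * F2 ?s)" for i
  proof -
    have "((\<lambda>x. (2 * complex_of_real ((x - a) $ i)) * of_real (F1 ((norm (x - a))\<^sup>2))) has_derivative
        (\<lambda>v. (2 * of_real ((x - a) $ i)) * of_real (F2 ?s * (2 * ((x - a) \<bullet> v)))
            + (2 * of_real (v $ i)) * of_real (F1 ?s))) (at x)"
      by (rule has_derivative_mult[OF has_derivative_mult_right[OF has_derivative_coord] has_derivative_radial[OF D(2)]])
    from pd_eq[OF this, of i] show ?thesis
      by (simp add: inner_axis axis_nth power2_eq_square algebra_simps del: vector_minus_component)
  qed
  have "(\<Sum>i\<in>UNIV. ((x - a) $ i)\<^sup>2) = ?s"
    by (simp add: norm_vec_def L2_set_def sum_nonneg)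
  then have "(\<Sum>i\<in>UNIV. 4 * ((x - a) $ i)\<^sup>2 * F2 ?s) = 4 * ?s * F2 ?s"
    by (simp add: sum_distrib_left[symmetric] sum_distrib_right[symmetric])
  then have "(\<Sum>i\<in>UNIV. 2 * F1 ?s + 4 * ((x - a) $ i)\<^sup>2 * F2 ?s) = 8 * F1 ?s + 4 * ?s * F2 ?s"
    by (simp add: sum.distrib)
  then show "laplacian (\<lambda>x. complex_of_real (F ((norm (x - a))\<^sup>2))) x
      = of_real ((\<lambda>s. 8 * F1 s + 4 * s * F2 s) ?s)"
    unfolding laplacian_def 1 2 by (simp only: of_real_sum[symmetric])
qed

text \<open>The operator \<open>8 F' + 4 s F''\<close> applied twice, written in terms of a sequence \<open>D\<close> of successive
  derivatives.\<close>

definition bilap :: "(nat \<Rightarrow> real \<Rightarrow> real) \<Rightarrow> real \<Rightarrow> real" where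
  "bilap D s = 96 * D 2 s + 96 * s * D 3 s + 16 * s\<^sup>2 * D 4 s"

lemma bilaplacian_radial:
  fixes a :: R4
  assumes D: "\<And>k s. (D k has_real_derivative D (Suc k) s) (at s)"
  shows "laplacian (laplacian (\<lambda>x. complex_of_real (D 0 ((norm (x - a))\<^sup>2))))
       = (\<lambda>x. of_real (bilap D ((norm (x - a))\<^sup>2)))"
proof -
  define A where "A s = 8 * D 1 s + 4 * s * D 2 s" for s
  define A1 where "A1 s = 12 * D 2 s + 4 * s * D 3 s" for s
  define A2 where "A2 s = 16 * D 3 s + 4 * s * D 4 s" for s
  have D': "(D 1 has_real_derivative D 2 s) (at s)" "(D 2 has_real_derivative D 3 s) (at s)"
    "(D 3 has_real_derivative D 4 s) (at s)" for s
  proof -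
    have "Suc 1 = 2" "Suc 2 = 3" "Suc 3 = 4" by simp_all
    then show "(D 1 has_real_derivative D 2 s) (at s)" "(D 2 has_real_derivative D 3 s) (at s)"
      "(D 3 has_real_derivative D 4 s) (at s)"
      using D[of 1 s] D[of 2 s] D[of 3 s] by metis+
  qed
  have "(A has_real_derivative A1 s) (at s)" for s
    unfolding A_def A1_def by (auto intro!: derivative_eq_intros D' simp del: One_nat_def)
  moreover have "(A1 has_real_derivative A2 s) (at s)" for s
    unfolding A1_def A2_def by (auto intro!: derivative_eq_intros D' simp del: One_nat_def)
  ultimately have "laplacian (\<lambda>x. complex_of_real (A ((norm (x - a))\<^sup>2)))
       = (\<lambda>x. of_real (8 * A1 ((norm (x - a))\<^sup>2) + 4 * (norm (x - a))\<^sup>2 * A2 ((norm (x - a))\<^sup>2)))"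
    using laplacian_radial by simp
  moreover have "8 * A1 s + 4 * s * A2 s = bilap D s" for s
    by (simp add: A1_def A2_def bilap_def power2_eq_square algebra_simps)
  moreover have "laplacian (\<lambda>x. complex_of_real (D 0 ((norm (x - a))\<^sup>2)))
     = (\<lambda>x. complex_of_real (A ((norm (x - a))\<^sup>2)))"
    using laplacian_radial[of "D 0" "D 1" "D 2"] D[of 0] D'(1) unfolding A_def by simp
  ultimately show ?thesis by simp
qed

lemma test_function_radial:
  fixes a :: R4
  assumes D: "\<And>k s. (D k has_real_derivative D (Suc k) s) (at s)"
    and z: "\<And>s. s \<ge> M \<Longrightarrow> D 0 s = 0"
  shows "test_function (\<lambda>x. complex_of_real (D 0 ((norm (x - a))\<^sup>2)))"
proof -
  have "{x. complex_of_real (D 0 ((norm (x - a))\<^sup>2)) \<noteq> 0} \<subseteq> cball a (sqrt M)"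
  proof
    fix x assume "x \<in> {x. complex_of_real (D 0 ((norm (x - a))\<^sup>2)) \<noteq> 0}"
    then have "(norm (x - a))\<^sup>2 < M" using z[of "(norm (x - a))\<^sup>2"] by (auto simp: not_le[symmetric])
    then show "x \<in> cball a (sqrt M)"
      using real_le_rsqrt[of "norm (x - a)" M] by (simp add: dist_norm norm_minus_commute)
  qed
  then have "compact (closure {x. complex_of_real (D 0 ((norm (x - a))\<^sup>2)) \<noteq> 0})"
    using bounded_subset bounded_cball by (auto simp: compact_closure)
  then show ?thesis
    unfolding test_function_def
    using radial_algebra_Ck[OF D radial_algebra.radial[of D a 0]] by blast
qed

lemma continuous_on_reg_log_deriv [continuous_intros]:
  "continuous_on S f \<Longrightarrow> continuous_on S (\<lambda>x. reg_log_deriv k (f x))"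
  by (rule continuous_on_compose2[of UNIV "reg_log_deriv k"])
     (auto intro!: DERIV_continuous_on reg_log_deriv_derivative)

definition bilap_log :: "real \<Rightarrow> real" where
  "bilap_log = bilap reg_log_deriv"

lemma continuous_on_bilap_log: "continuous_on UNIV bilap_log"
  unfolding bilap_log_def bilap_def[abs_def] by (intro continuous_intros)

lemma borel_measurable_bilap_log [measurable]: "bilap_log \<in> borel_measurable borel"
  using continuous_on_bilap_log by (rule borel_measurable_continuous_onI)

lemma borel_measurable_reg_log [measurable]: "reg_log \<in> borel_measurable borel"
proof (rule borel_measurable_continuous_onI)
  show "continuous_on UNIV reg_log"
    using continuous_on_reg_log_deriv[of UNIV "\<lambda>x. x" 0] by (simp add: reg_log_deriv_0)
qed

lemma reg_log_deriv_eq: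
  assumes "s > 1"
  shows "reg_log_deriv 1 s = inverse s / 2" "reg_log_deriv 2 s = - (inverse s ^ 2 / 2)"
    "reg_log_deriv 3 s = inverse s ^ 3" "reg_log_deriv 4 s = - 3 * inverse s ^ 4"
proof -
  have step: "reg_log_deriv (Suc k) s = g s"
    if "\<And>s. s > 1 \<Longrightarrow> reg_log_deriv k s = f s" "\<And>s. s > 1 \<Longrightarrow> (f has_real_derivative g s) (at s)" "s > 1"
    for k f g s
  proof (rule DERIV_unique)
    show "(reg_log_deriv k has_real_derivative g s) (at s)"
      by (rule has_field_derivative_transform_within_open[OF that(2)[OF that(3)], of "{1<..}"])
         (use that in auto)
  qed (rule reg_log_deriv_derivative)
  have 0: "reg_log_deriv 0 s = ln s / 2" if "s > 1" for s
    using reg_log_eq[of s] that by (simp add: reg_log_deriv_0)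
  have 1: "reg_log_deriv (Suc 0) s = inverse s / 2" if "s > 1" for s
    by (rule step[OF 0 _ that]) (auto intro!: derivative_eq_intros simp: field_simps)
  have 2: "reg_log_deriv (Suc (Suc 0)) s = - (inverse s ^ 2 / 2)" if "s > 1" for s
    by (rule step[OF 1 _ that]) (auto intro!: derivative_eq_intros simp: field_simps power2_eq_square)
  have 3: "reg_log_deriv (Suc (Suc (Suc 0))) s = inverse s ^ 3" if "s > 1" for s
    by (rule step[OF 2 _ that]) (auto intro!: derivative_eq_intros simp: field_simps eval_nat_numeral)
  have 4: "reg_log_deriv (Suc (Suc (Suc (Suc 0)))) s = - 3 * inverse s ^ 4" if "s > 1" for s
    by (rule step[OF 3 _ that]) (auto intro!: derivative_eq_intros simp: field_simps eval_nat_numeral)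
  show "reg_log_deriv 1 s = inverse s / 2" "reg_log_deriv 2 s = - (inverse s ^ 2 / 2)"
    "reg_log_deriv 3 s = inverse s ^ 3" "reg_log_deriv 4 s = - 3 * inverse s ^ 4"
    using 1[OF assms] 2[OF assms] 3[OF assms] 4[OF assms] by (simp_all add: eval_nat_numeral)
qed

text \<open>Outside the unit ball the truncated logarithm is \<open>ln |x|\<close>, which is biharmonic away from the origin
  in dimension four.\<close>

lemma bilap_log_eq_0: "s > 1 \<Longrightarrow> bilap_log s = 0"
proof -
  assume s: "s > 1"
  have "96 * - (inverse s ^ 2 / 2) + 96 * s * inverse s ^ 3 + 16 * s\<^sup>2 * (- 3 * inverse s ^ 4)
      = - 48 * inverse s ^ 2 + 96 * (s * inverse s) * inverse s ^ 2 - 48 * (s * inverse s)\<^sup>2 * inverse s ^ 2"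
    by algebra
  also have "\<dots> = 0" using s by simp
  finally show ?thesis
    unfolding bilap_log_def bilap_def reg_log_deriv_eq[OF s] .
qed

lemma bilap_log_bounded: obtains M where "M > 0" "\<And>s. s \<ge> 0 \<Longrightarrow> \<bar>bilap_log s\<bar> \<le> M"
proof -
  have "compact (bilap_log ` {0..1})"
    by (rule compact_continuous_image) (auto intro: continuous_on_subset[OF continuous_on_bilap_log])
  from compact_imp_bounded[OF this] obtain M where M: "\<And>s. s \<in> {0..1} \<Longrightarrow> \<bar>bilap_log s\<bar> \<le> M"
    unfolding bounded_iff real_norm_def by blast
  show thesis
  proof (rule that[of "\<bar>M\<bar> + 1"])
    fix s :: real assume "s \<ge> 0"
    then show "\<bar>bilap_log s\<bar> \<le> \<bar>M\<bar> + 1"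
      using M[of s] bilap_log_eq_0[of s] by (cases "s \<le> 1") auto
  qed simp
qed

text \<open>In the variable \<open>s\<close> the bilaplacian times the radial weight is an exact derivative:
  \<open>\<pi>\<^sup>2 s (8 A' + 4 s A'') = (4 \<pi>\<^sup>2 s\<^sup>2 A')'\<close> with \<open>A\<close> the Laplacian. For \<open>s > 1\<close> one has \<open>A' = - 2 / s\<^sup>2\<close>, so
  the boundary term is \<open>- 8 \<pi>\<^sup>2\<close>, independently of how the logarithm was truncated.\<close>

lemma integral_bilap_log:
  fixes a :: R4
  assumes "e > 0"
  shows "(LINT x|lborel. bilap_log ((norm (x - a))\<^sup>2 / e\<^sup>2)) = - 8 * pi\<^sup>2 * e ^ 4"
proof -
  define A where "A s = 4 * pi\<^sup>2 * e ^ 4 * ((s / e\<^sup>2) * (s / e\<^sup>2) * (12 * reg_log_deriv 2 (s / e\<^sup>2) + 4 * (s / e\<^sup>2) * reg_log_deriv 3 (s / e\<^sup>2)))" for s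
  have D': "(reg_log_deriv 2 has_real_derivative reg_log_deriv 3 s) (at s)" "(reg_log_deriv 3 has_real_derivative reg_log_deriv 4 s) (at s)" for s
  proof -
    have "Suc 2 = 3" "Suc 3 = 4" by simp_all
    then show "(reg_log_deriv 2 has_real_derivative reg_log_deriv 3 s) (at s)" "(reg_log_deriv 3 has_real_derivative reg_log_deriv 4 s) (at s)"
      using reg_log_deriv_derivative[of 2 s] reg_log_deriv_derivative[of 3 s] by metis+
  qed
  have A: "(A has_real_derivative pi\<^sup>2 * s * bilap_log (s / e\<^sup>2)) (at s)" for s
  proof -
    have i: "((\<lambda>s. s / e\<^sup>2) has_real_derivative 1 / e\<^sup>2) (at s)"
      using DERIV_cdivide[OF DERIV_ident] .
    let ?t = "s / e\<^sup>2"
    have "((\<lambda>t. 4 * pi\<^sup>2 * e ^ 4 * (t * t * (12 * reg_log_deriv 2 t + 4 * t * reg_log_deriv 3 t))) has_real_derivative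
       e ^ 4 * (pi\<^sup>2 * ?t * bilap_log ?t)) (at ?t)"
      unfolding bilap_log_def bilap_def
      by (rule DERIV_cong, (rule derivative_intros D')+, algebra)
    from DERIV_chain2[OF this i] have "(A has_real_derivative e ^ 4 * (pi\<^sup>2 * ?t * bilap_log ?t) * (1 / e\<^sup>2)) (at s)"
      unfolding A_def[abs_def] .
    moreover have "e ^ 4 * (pi\<^sup>2 * ?t * bilap_log ?t) * (1 / e\<^sup>2) = pi\<^sup>2 * s * bilap_log (s / e\<^sup>2)"
      using assms by (simp add: eval_nat_numeral)
    ultimately show ?thesis by simp
  qed
  have "(LINT x|lborel. bilap_log ((norm (x - a))\<^sup>2 / e\<^sup>2))
      = (LINT s|lborel. indicator {0..} s * (pi\<^sup>2 * s * bilap_log (s / e\<^sup>2)))"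
    by (rule integral_radial) measurable
  \<comment> \<open>Integrating up to \<open>2 e\<^sup>2\<close> puts the boundary term where the logarithm is exact in a neighbourhood.\<close>
  also have "\<dots> = (LINT s|lborel. indicator {0..2 * e\<^sup>2} s *\<^sub>R (pi\<^sup>2 * s * bilap_log (s / e\<^sup>2)))"
  proof (intro Bochner_Integration.integral_cong refl)
    fix s
    have "bilap_log (s / e\<^sup>2) = 0" if "s > 2 * e\<^sup>2"
      by (rule bilap_log_eq_0) (use that assms in \<open>simp add: less_divide_eq; smt (verit) zero_less_power\<close>)
    then show "indicator {0..} s * (pi\<^sup>2 * s * bilap_log (s / e\<^sup>2))
      = indicator {0..2 * e\<^sup>2} s *\<^sub>R (pi\<^sup>2 * s * bilap_log (s / e\<^sup>2))"
      by (auto simp: indicator_def)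
  qed
  also have "\<dots> = A (2 * e\<^sup>2) - A 0"
  proof (rule integral_FTC_atLeastAtMost)
    show "(A has_vector_derivative pi\<^sup>2 * s * bilap_log (s / e\<^sup>2)) (at s within {0..2 * e\<^sup>2})" for s
      using A by (auto simp: has_real_derivative_iff_has_vector_derivative[symmetric] intro: has_field_derivative_at_within)
    show "continuous_on {0..2 * e\<^sup>2} (\<lambda>s. pi\<^sup>2 * s * bilap_log (s / e\<^sup>2))"
      using assms by (intro continuous_intros continuous_on_compose2[OF continuous_on_bilap_log]) auto
  qed simp
  also have "\<dots> = - 8 * pi\<^sup>2 * e ^ 4"
    using assms by (simp add: A_def reg_log_deriv_eq power2_eq_square power3_eq_cube)
  finally show ?thesis .
qed

text \<open>Both truncated logarithms equal \<open>ln |x - a|\<close> outside the ball of radius \<open>R\<close>, so their difference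
  has compact support.\<close>

lemma test_function_log_difference:
  fixes a :: R4
  assumes "0 < e" "e < R"
  defines "\<eta> \<equiv> \<lambda>x. complex_of_real ((ln e + reg_log ((norm (x - a))\<^sup>2 / e\<^sup>2)) - (ln R + reg_log ((norm (x - a))\<^sup>2 / R\<^sup>2)))"
  shows "test_function \<eta>"
    and "laplacian (laplacian \<eta>) x =
      of_real (bilap_log ((norm (x - a))\<^sup>2 / e\<^sup>2) / e ^ 4 - bilap_log ((norm (x - a))\<^sup>2 / R\<^sup>2) / R ^ 4)"
proof -
  define D where "D k s = (if k = 0 then ln e - ln R else 0)
      + (inverse (e\<^sup>2) ^ k * reg_log_deriv k (s / e\<^sup>2) - inverse (R\<^sup>2) ^ k * reg_log_deriv k (s / R\<^sup>2))" for k s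
  have scaled: "((\<lambda>s. inverse (r\<^sup>2) ^ k * reg_log_deriv k (s / r\<^sup>2)) has_real_derivative
      inverse (r\<^sup>2) ^ Suc k * reg_log_deriv (Suc k) (s / r\<^sup>2)) (at s)" for r k s
  proof -
    have i: "((\<lambda>s. s / r\<^sup>2) has_real_derivative 1 / r\<^sup>2) (at s)"
      using DERIV_cdivide[OF DERIV_ident] .
    show ?thesis
      using DERIV_cmult[OF DERIV_chain2[OF reg_log_deriv_derivative i, of k], of "inverse (r\<^sup>2) ^ k"]
      by (simp add: divide_inverse mult_ac)
  qed
  have D: "(D k has_real_derivative D (Suc k) s) (at s)" for k s
    unfolding D_def[abs_def] using DERIV_add[OF DERIV_const DERIV_diff[OF scaled scaled]] by simp
  have z: "D 0 s = 0" if "s \<ge> R\<^sup>2" for s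
  proof -
    have "e\<^sup>2 \<le> R\<^sup>2" using assms by (intro power_mono) auto
    then have "e\<^sup>2 \<le> s" using that by (rule order_trans)
    then have "s / e\<^sup>2 \<ge> 1" "s / R\<^sup>2 \<ge> 1" "s > 0"
      using that \<open>0 < e\<close> \<open>e < R\<close> less_le_trans[of 0 "R\<^sup>2" s] by (auto simp: le_divide_eq)
    then show ?thesis
      using \<open>0 < e\<close> \<open>e < R\<close> by (simp add: D_def reg_log_deriv_0 reg_log_eq ln_div ln_realpow diff_divide_distrib)
  qed
  have \<eta>: "\<eta> = (\<lambda>x. complex_of_real (D 0 ((norm (x - a))\<^sup>2)))"
    unfolding \<eta>_def D_def reg_log_deriv_0 by (auto simp: fun_eq_iff)
  show "test_function \<eta>"
    unfolding \<eta> by (rule test_function_radial[OF D z])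
  have "bilap D s = bilap_log (s / e\<^sup>2) / e ^ 4 - bilap_log (s / R\<^sup>2) / R ^ 4" for s
  proof -
    have scale: "96 * (inverse (r\<^sup>2) ^ 2 * x) + 96 * s * (inverse (r\<^sup>2) ^ 3 * y) + 16 * s\<^sup>2 * (inverse (r\<^sup>2) ^ 4 * z)
        = (96 * x + 96 * (s / r\<^sup>2) * y + 16 * (s / r\<^sup>2)\<^sup>2 * z) / r ^ 4" for r x y z :: real
    proof -
      have "96 * ((q\<^sup>2) ^ 2 * x) + 96 * s * ((q\<^sup>2) ^ 3 * y) + 16 * s\<^sup>2 * ((q\<^sup>2) ^ 4 * z)
        = (96 * x + 96 * (s * q\<^sup>2) * y + 16 * (s * q\<^sup>2)\<^sup>2 * z) * q ^ 4" for q
        by algebra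
      from this[of "inverse r"] show ?thesis
        by (simp only: divide_inverse power_inverse)
    qed
    show ?thesis
      unfolding bilap_log_def bilap_def D_def scale[symmetric] by (simp add: algebra_simps)
  qed
  then show "laplacian (laplacian \<eta>) x =
      of_real (bilap_log ((norm (x - a))\<^sup>2 / e\<^sup>2) / e ^ 4 - bilap_log ((norm (x - a))\<^sup>2 / R\<^sup>2) / R ^ 4)"
    unfolding \<eta> bilaplacian_radial[of D, OF D] by simp
qed

lemma abs_ln_le: "x > 0 \<Longrightarrow> \<bar>ln x\<bar> \<le> max x (inverse (x :: real))"
  using ln_le_minus_one[of x] ln_le_minus_one[of "inverse x"] by (auto simp: ln_inverse max_def)

text \<open>The first bound dominates the truncated logarithm at large scales. The second measures its distance
  to the true logarithm inside the truncation radius by an inverse distance, the quantity that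
  \<open>near_singularity\<close> below integrates.\<close>

lemma reg_log_bounds:
  obtains C where "C > 0" "\<And>s. s \<ge> 0 \<Longrightarrow> \<bar>reg_log s\<bar> \<le> C + sqrt s"
    "\<And>s. s > 0 \<Longrightarrow> s \<le> 1 \<Longrightarrow> \<bar>reg_log s - ln s / 2\<bar> \<le> C * inverse (sqrt s)"
proof -
  have "continuous_on UNIV reg_log"
    using continuous_on_reg_log_deriv[of UNIV "\<lambda>x. x" 0] by (simp add: reg_log_deriv_0)
  then have "compact (reg_log ` {0..1})"
    by (intro compact_continuous_image) (auto intro: continuous_on_subset)
  from compact_imp_bounded[OF this] obtain M where M: "\<And>s. s \<in> {0..1} \<Longrightarrow> \<bar>reg_log s\<bar> \<le> M"
    unfolding bounded_iff real_norm_def by blast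
  have ln: "ln s / 2 = ln (sqrt s)" if "s > 0" for s :: real
    using that by (simp add: ln_sqrt)
  show thesis
  proof (rule that[of "\<bar>M\<bar> + 1"])
    fix s :: real assume "s \<ge> 0"
    show "\<bar>reg_log s\<bar> \<le> (\<bar>M\<bar> + 1) + sqrt s"
    proof (cases "s \<le> 1")
      case True
      then show ?thesis using M[of s] \<open>s \<ge> 0\<close> by (auto intro: add_increasing2)
    next
      case False
      then have "reg_log s = ln (sqrt s)" "sqrt s \<ge> 1" by (simp_all add: reg_log_eq ln)
      then show ?thesis using ln_le_minus_one[of "sqrt s"] ln_ge_zero[of "sqrt s"] by auto
    qed
  next
    fix s :: real assume s: "s > 0" "s \<le> 1"
    have i: "inverse (sqrt s) \<ge> 1" using s by (simp add: one_le_inverse)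
    have "\<bar>ln s / 2\<bar> \<le> inverse (sqrt s)"
      using abs_ln_le[of "sqrt s"] s i unfolding ln[OF s(1)]
      by (metis (no_types, opaque_lifting) dual_order.trans max.absorb2 real_sqrt_gt_0_iff real_sqrt_le_1_iff)
    moreover have "\<bar>reg_log s\<bar> \<le> \<bar>M\<bar> * inverse (sqrt s)"
      using M[of s] s i by (smt (verit) atLeastAtMost_iff mult_left_le mult_le_cancel_left1 mult.right_neutral mult_left_mono)
    ultimately show "\<bar>reg_log s - ln s / 2\<bar> \<le> (\<bar>M\<bar> + 1) * inverse (sqrt s)"
      by (simp add: distrib_right)
  qed simp
qed

section \<open>Recovering a function from its mollifications\<close>

lemma integrable_dominated:
  fixes f :: "'a \<Rightarrow> 'b::{banach, second_countable_topology}"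
  assumes "integrable M g" "f \<in> borel_measurable M" "\<And>x. norm (f x) \<le> g x"
  shows "integrable M f"
  by (rule Bochner_Integration.integrable_bound[OF assms(1,2)])
     (auto intro!: AE_I2 order_trans[OF assms(3) abs_ge_self])

text \<open>At almost every point the value is the limit of the means over shrinking cubes with a corner there.\<close>

lemma AE_eq_0_if_cbox_integrals_0:
  fixes u :: "R4 \<Rightarrow> complex"
  assumes int: "\<And>l r. set_integrable lborel (cbox l r) u"
    and zero: "\<And>l r. (LINT x:cbox l r|lborel. u x) = 0"
  shows "AE x in lborel. u x = 0"
proof -
  have "u integrable_on cbox l r" for l r
    by (rule set_borel_integral_eq_integral(1)[OF int])
  from integrable_ccontinuous_explicit[OF this] obtain N where N: "negligible N"
    "\<And>x e. \<lbrakk>x \<notin> N; 0 < e\<rbrakk> \<Longrightarrow> \<exists>d>0. \<forall>h. 0 < h \<and> h < d \<longrightarrow>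
        norm (integral (cbox x (x + h *\<^sub>R One)) u /\<^sub>R h ^ DIM(R4) - u x) < e" by blast
  have 0: "integral (cbox l r) u = 0" for l r
    using set_borel_integral_eq_integral(2)[OF int, of l r] zero[of l r] by simp
  have "u x = 0" if xN: "x \<notin> N" for x
  proof (rule ccontr)
    assume "u x \<noteq> 0"
    then have "\<exists>d>0::real. \<forall>h. 0 < h \<and> h < d \<longrightarrow> norm (u x) < norm (u x)"
      using N(2)[OF xN, of "norm (u x)"] by (simp add: 0)
    then show False using dense[of 0] by blast
  qed
  then have "AE x in lebesgue. u x = 0"
    using N(1) unfolding negligible_iff_null_sets by (intro AE_I'[of N]) auto
  then show ?thesis by (simp add: AE_completion_iff)
qed

text \<open>If the averages of \<open>\<psi>\<close> against the dilates of a kernel of mass \<open>\<kappa>\<close> approach \<open>\<kappa> \<Theta>\<close> uniformly, then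
  \<open>\<psi> = \<Theta>\<close> almost everywhere. To see this, integrate the averages over a box. Fubini's
  theorem moves the kernel onto the indicator function of the box, and the mollified indicator
  converges boundedly to \<open>\<kappa>\<close> times the indicator off the boundary. So the integrals of \<open>\<psi>\<close>
  and \<open>\<Theta>\<close> over all boxes agree.\<close>

lemma mollification_determines:
  fixes \<psi> \<Theta> :: "R4 \<Rightarrow> complex" and K :: "real \<Rightarrow> real" and \<kappa> C M :: real
  assumes \<psi>_loc: "\<And>r. integrable lborel (\<lambda>x. indicator (cball 0 r) x *\<^sub>R \<psi> x)"
    and \<Theta>_loc: "\<And>r. integrable lborel (\<lambda>x. indicator (cball 0 r) x *\<^sub>R \<Theta> x)"
    and [measurable]: "\<psi> \<in> borel_measurable borel" "\<Theta> \<in> borel_measurable borel" "K \<in> borel_measurable borel"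
    and K_le: "\<And>s. s \<ge> 0 \<Longrightarrow> \<bar>K s\<bar> \<le> M"
    and K_0: "\<And>s. s > 1 \<Longrightarrow> K s = 0"
    and K_int: "\<And>a e. e > 0 \<Longrightarrow> (LINT x|lborel. K ((norm (x - a :: R4))\<^sup>2 / e\<^sup>2)) = \<kappa> * e ^ 4"
    and "\<kappa> \<noteq> 0"
    and approx: "\<And>a e. 0 < e \<Longrightarrow> e \<le> 1 \<Longrightarrow>
      norm ((LINT x|lborel. \<psi> x * of_real (K ((norm (x - a))\<^sup>2 / e\<^sup>2))) / of_real (e ^ 4) - of_real \<kappa> * \<Theta> a) \<le> C * e"
  shows "AE a in lborel. \<psi> a = \<Theta> a"
proof -
  have box: "(LINT x:cbox l u|lborel. \<psi> x) = (LINT x:cbox l u|lborel. \<Theta> x)"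
    and int_\<psi>: "set_integrable lborel (cbox l u) \<psi>" and int_\<Theta>: "set_integrable lborel (cbox l u) \<Theta>" for l u
  proof -
    let ?B = "cbox l u"
    obtain r where "?B \<subseteq> ball 0 r" using bounded_cbox bounded_subset_ballD by blast
    then have r: "?B \<subseteq> cball 0 r" by auto
    let ?S = "cball 0 (r + 1) :: R4 set"
    show int_\<psi>: "set_integrable lborel (cbox l u) \<psi>"
    proof -
      have eq: "(\<lambda>x. indicator ?B x *\<^sub>R (indicator (cball 0 r) x *\<^sub>R \<psi> x)) = (\<lambda>x. indicator ?B x *\<^sub>R \<psi> x)"
        using r by (auto simp: fun_eq_iff split: split_indicator)
      show ?thesis
        using integrable_mult_indicator[OF _ \<psi>_loc[of r], of ?B] unfolding set_integrable_def eq by simp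
    qed
    show int_\<Theta>: "set_integrable lborel (cbox l u) \<Theta>"
    proof -
      have eq: "(\<lambda>x. indicator ?B x *\<^sub>R (indicator (cball 0 r) x *\<^sub>R \<Theta> x)) = (\<lambda>x. indicator ?B x *\<^sub>R \<Theta> x)"
        using r by (auto simp: fun_eq_iff split: split_indicator)
      show ?thesis
        using integrable_mult_indicator[OF _ \<Theta>_loc[of r], of ?B] unfolding set_integrable_def eq by simp
    qed
    have ind: "integrable lborel (indicat_real ?B)"
      by (rule integrable_real_indicator) (simp_all add: emeasure_lborel_cbox_eq)
    \<comment> \<open>\<open>k\<close> is the kernel at scale \<open>e\<close>, and \<open>mol\<close> is the indicator function of the box mollified by it.\<close>
    define k where "k e x a = K ((norm (x - a))\<^sup>2 / e\<^sup>2) / e ^ 4" for e :: real and x a :: R4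
    define mol where "mol e x = (LINT a|lborel. indicator ?B a * k e x a)" for e x
    have k_meas [measurable]: "(\<lambda>p. k e (fst p) (snd p)) \<in> borel_measurable (borel \<Otimes>\<^sub>M borel)"
      "(\<lambda>a. k e x a) \<in> borel_measurable borel" "(\<lambda>x. k e x a) \<in> borel_measurable borel" for e x a
      unfolding k_def by measurable
    have M: "M \<ge> 0" using K_le[of 0] by linarith
    have k_le: "\<bar>k e x a\<bar> \<le> M / e ^ 4 * indicator (cball a e) x" if "e > 0" for e x a
    proof (cases "x \<in> cball a e")
      case True
      then show ?thesis using K_le[of "(norm (x - a))\<^sup>2 / e\<^sup>2"] that
        by (simp add: k_def divide_right_mono)
    next
      case False
      then have "e < norm (x - a)" by (simp add: dist_norm norm_minus_commute)
      then have "e\<^sup>2 < (norm (x - a))\<^sup>2" using that by (intro power_strict_mono) auto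
      then have "(norm (x - a))\<^sup>2 / e\<^sup>2 > 1" using that by simp
      then show ?thesis by (simp add: k_def K_0 M that less_imp_le)
    qed
    have sym: "indicator (cball a e) x = (indicator (cball x e) a :: real)" for a x :: R4 and e
      by (simp add: indicator_def dist_commute)
    have S: "indicator ?B a * indicator (cball a e) x \<le> (indicator ?B a * indicator ?S x :: real)"
      if "e \<le> 1" for a x e
      using that r norm_triangle_ineq[of "x - a" a]
      by (auto simp: indicator_def dist_norm norm_minus_commute subset_iff split: if_splits)
    have fub: "(LINT a|lborel. indicator ?B a *\<^sub>R (LINT x|lborel. \<psi> x * of_real (k e x a)))
        = (LINT x|lborel. \<psi> x * of_real (mol e x))"
      and int_fub: "integrable lborel (\<lambda>a. indicator ?B a *\<^sub>R (LINT x|lborel. \<psi> x * of_real (k e x a)))"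
      if e: "0 < e" "e \<le> 1" for e
    proof -
      let ?F = "\<lambda>a x. indicator ?B a *\<^sub>R (\<psi> x * of_real (k e x a))"
      let ?G = "\<lambda>a x. (M / e ^ 4 * indicator ?B a) * (indicator ?S x * norm (\<psi> x))"
      have h: "integrable lborel (\<lambda>x. indicator ?S x * norm (\<psi> x))"
        using integrable_norm[OF \<psi>_loc[of "r + 1"]] by simp
      have G: "integrable (lborel \<Otimes>\<^sub>M lborel) (case_prod ?G)"
      proof (rule lborel_pair.Fubini_integrable)
        have "integrable lborel (\<lambda>a. M / e ^ 4 * indicator ?B a * (LINT x|lborel. indicator ?S x * norm (\<psi> x)))"
          by (intro integrable_mult_left integrable_mult_right ind)
        then show "integrable lborel (\<lambda>a. LINT x|lborel. norm (case_prod ?G (a, x)))"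
          using M e by (simp add: abs_mult)
        show "AE a in lborel. integrable lborel (\<lambda>x. case_prod ?G (a, x))"
          using h by simp
        have "(\<lambda>p. M / e ^ 4 * indicator ?B (fst p) * (indicator ?S (snd p) * norm (\<psi> (snd p))))
           \<in> borel_measurable (lborel \<Otimes>\<^sub>M lborel)"
          by (intro borel_measurable_times borel_measurable_const
                measurable_compose[OF measurable_fst borel_measurable_integrable[OF ind]]
                measurable_compose[OF measurable_snd borel_measurable_integrable[OF h]])
        then show "case_prod ?G \<in> borel_measurable (lborel \<Otimes>\<^sub>M lborel)"
          by (simp add: case_prod_beta')
      qed
      have F: "integrable (lborel \<Otimes>\<^sub>M lborel) (case_prod ?F)"
      proof (rule integrable_dominated[OF G])
        have "(\<lambda>p. indicator ?B (fst p) *\<^sub>R (\<psi> (snd p) * of_real (k e (snd p) (fst p))))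
           \<in> borel_measurable (lborel \<Otimes>\<^sub>M lborel)"
        proof (intro borel_measurable_scaleR borel_measurable_times)
          show "(\<lambda>p. indicat_real ?B (fst p)) \<in> borel_measurable (lborel \<Otimes>\<^sub>M lborel)"
            by (rule measurable_compose[OF measurable_fst borel_measurable_integrable[OF ind]])
          have "\<psi> \<in> borel_measurable lborel" by simp
          from measurable_compose[OF measurable_snd this]
          show "(\<lambda>p. \<psi> (snd p)) \<in> borel_measurable (lborel \<Otimes>\<^sub>M lborel)" .
          have "(\<lambda>p. complex_of_real (k e (snd p) (fst p))) \<in> borel_measurable (borel \<Otimes>\<^sub>M borel)"
            unfolding k_def by measurable
          moreover have "sets (lborel \<Otimes>\<^sub>M lborel) = sets ((borel :: R4 measure) \<Otimes>\<^sub>M (borel :: R4 measure))"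
            by (intro sets_pair_measure_cong) simp_all
          ultimately show "(\<lambda>p. complex_of_real (k e (snd p) (fst p))) \<in> borel_measurable (lborel \<Otimes>\<^sub>M lborel)"
            by (simp cong: measurable_cong_sets)
        qed
        then show "case_prod ?F \<in> borel_measurable (lborel \<Otimes>\<^sub>M lborel)"
          by (simp add: case_prod_beta')
        fix p :: "R4 \<times> R4"
        obtain a x where p: "p = (a, x)" by (cases p)
        have "norm (?F a x) = indicator ?B a * \<bar>k e x a\<bar> * norm (\<psi> x)"
          by (simp add: norm_mult)
        also have "\<dots> \<le> indicator ?B a * (M / e ^ 4 * indicator (cball a e) x) * norm (\<psi> x)"
          using k_le[OF e(1)] by (intro mult_right_mono mult_left_mono) auto
        also have "\<dots> = (M / e ^ 4 * norm (\<psi> x)) * (indicator ?B a * indicator (cball a e) x)"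
          by (simp add: mult_ac)
        also have "\<dots> \<le> (M / e ^ 4 * norm (\<psi> x)) * (indicator ?B a * indicator ?S x)"
          by (rule mult_left_mono[OF S[OF e(2)]]) (use M e in simp)
        finally show "norm (case_prod ?F p) \<le> case_prod ?G p"
          unfolding p by (simp add: mult_ac)
      qed
      have "(LINT x|lborel. (LINT a|lborel. ?F a x)) = (LINT a|lborel. (LINT x|lborel. ?F a x))"
        by (rule lborel_pair.Fubini_integral[OF F])
      moreover have "(LINT a|lborel. ?F a x) = \<psi> x * of_real (mol e x)" for x
      proof -
        have "(LINT a|lborel. ?F a x) = (LINT a|lborel. \<psi> x * of_real (indicator ?B a * k e x a))"
          by (intro Bochner_Integration.integral_cong) (auto split: split_indicator)
        then show ?thesis by (simp add: mol_def del: of_real_mult)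
      qed
      ultimately show "(LINT a|lborel. indicator ?B a *\<^sub>R (LINT x|lborel. \<psi> x * of_real (k e x a)))
        = (LINT x|lborel. \<psi> x * of_real (mol e x))" by simp
      show "integrable lborel (\<lambda>a. indicator ?B a *\<^sub>R (LINT x|lborel. \<psi> x * of_real (k e x a)))"
        using lborel_pair.integrable_fst'[OF F] by simp
    qed
    define e where "e n = inverse (real (Suc n))" for n
    have e: "0 < e n" "e n \<le> 1" for n by (auto simp: e_def inverse_le_1_iff)
    have e_lim: "e \<longlonglongrightarrow> 0" unfolding e_def by (rule LIMSEQ_inverse_real_of_nat)
    have mol_meas [measurable]: "mol e \<in> borel_measurable borel" for e
    proof -
      have "(\<lambda>x. LINT a|lborel. indicator ?B a * k e x a) \<in> borel_measurable lborel"
        unfolding k_def by (rule lborel.borel_measurable_lebesgue_integral) measurable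
      then show ?thesis by (simp add: mol_def[abs_def])
    qed
    have mol_le: "\<bar>mol e x\<bar> \<le> M * (pi\<^sup>2 / 2) * indicator ?S x" if "0 < e" "e \<le> 1" for e x
    proof -
      have kk: "\<bar>indicator ?B a * k e x a\<bar> \<le> M / e ^ 4 * indicator ?S x * indicator (cball x e) a" for a
      proof -
        have "\<bar>indicator ?B a * k e x a\<bar> \<le> indicator ?B a * (M / e ^ 4 * indicator (cball a e) x)"
          unfolding abs_mult abs_indicator by (rule mult_left_mono[OF k_le[OF that(1)]]) simp
        also have "\<dots> \<le> M / e ^ 4 * indicator ?S x * indicator (cball a e) x"
        proof (cases "a \<in> ?B \<and> x \<in> cball a e")
          case True
          then have "1 \<le> indicat_real ?S x"
            using S[OF that(2), of a x] by (simp only: indicator_simps)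
          then have "x \<in> ?S" by (metis indicator_simps(2) not_one_le_zero)
          then show ?thesis using True by (simp only: indicator_simps)
        next
          case False
          then have "indicat_real ?B a * indicator (cball a e) x = 0" by (simp only: indicator_def) auto
          then have "indicator ?B a * (M / e ^ 4 * indicator (cball a e) x) = 0"
            by (metis mult.left_commute mult_zero_right)
          moreover have "0 \<le> M / e ^ 4 * indicator ?S x * indicator (cball a e) x" using M that by simp
          ultimately show ?thesis by (simp only:)
        qed
        finally show ?thesis unfolding sym[where a = a and x = x and e = e] .
      qed
      have ball: "integrable lborel (indicat_real (cball x e))"
        by (rule integrable_real_indicator[OF _ emeasure_lborel_cball_finite]) simp
      have ii: "integrable lborel (\<lambda>a. M / e ^ 4 * indicator ?S x * indicator (cball x e) a)"
        by (intro integrable_mult_right ball)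
      have "(\<lambda>a. indicator ?B a * k e x a) \<in> borel_measurable lborel"
        using borel_measurable_integrable[OF ind] k_meas(2)[of e x] by (intro borel_measurable_times) simp_all
      then have "integrable lborel (\<lambda>a. indicator ?B a * k e x a)"
        by (rule integrable_dominated[OF ii]) (simp only: real_norm_def kk)
      then have "\<bar>mol e x\<bar> \<le> (LINT a|lborel. M / e ^ 4 * indicator ?S x * indicator (cball x e) a)"
        unfolding mol_def real_norm_def[symmetric]
        by (rule Bochner_Integration.integral_norm_bound_integral[OF _ ii]) (simp only: real_norm_def kk)
      also have "\<dots> = M / e ^ 4 * indicator ?S x * measure lborel (cball x e)"
        by simp
      also have "measure lborel (cball x e) = pi\<^sup>2 / 2 * e ^ 4"
        using content_cball[of e x] that by (simp add: eval_unit_ball_vol)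
      finally show ?thesis using that by (simp add: mult_ac)
    qed
    have mol_lim: "(\<lambda>n. mol (e n) x) \<longlonglongrightarrow> \<kappa> * indicator ?B x" if x: "x \<notin> frontier ?B" for x
    proof -
      have e_small: "\<forall>\<^sub>F n in sequentially. e n < d" if "d > 0" for d
        using order_tendstoD(2)[OF e_lim that] .
      have "x \<in> interior ?B \<or> x \<in> - ?B" using x by (auto simp: frontier_def)
      then show ?thesis
      proof
        assume xi: "x \<in> interior ?B"
        then obtain d where d: "d > 0" "ball x d \<subseteq> ?B" by (meson mem_interior)
        have "\<forall>\<^sub>F n in sequentially. \<kappa> = mol (e n) x"
          using e_small[OF d(1)]
        proof eventually_elim
          case (elim n)
          have "indicator ?B a * k (e n) x a = k (e n) x a" for a
          proof (cases "a \<in> ?B")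
            case False
            then have "x \<notin> cball a (e n)" using d elim by (auto simp: dist_commute subset_iff)
            then show ?thesis using k_le[OF e(1), of n x a] by simp
          qed simp
          then have "mol (e n) x = (LINT a|lborel. K ((norm (a - x))\<^sup>2 / (e n)\<^sup>2)) / (e n) ^ 4"
            unfolding mol_def by (simp only:) (simp add: k_def norm_minus_commute)
          then show ?case using K_int[OF e(1), of x n] e(1)[of n] by simp
        qed
        then have "(\<lambda>n. mol (e n) x) \<longlonglongrightarrow> \<kappa>" by (rule tendsto_eventually[OF eventually_mono]) simp
        moreover have "x \<in> ?B" using xi interior_subset by blast
        ultimately show ?thesis by simp
      next
        assume xo: "x \<in> - ?B"
        moreover have "open (- ?B)" by (simp add: open_Compl closed_cbox)
        ultimately obtain d where d: "d > 0" "ball x d \<subseteq> - ?B" by (meson open_contains_ball)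
        have "\<forall>\<^sub>F n in sequentially. 0 = mol (e n) x"
          using e_small[OF d(1)]
        proof eventually_elim
          case (elim n)
          have "indicator ?B a * k (e n) x a = 0" for a
          proof (cases "a \<in> ?B")
            case True
            then have "x \<notin> cball a (e n)" using d elim by (auto simp: dist_commute subset_iff)
            then show ?thesis using k_le[OF e(1), of n x a] by simp
          qed simp
          then show ?case unfolding mol_def by (simp only:) simp
        qed
        then have "(\<lambda>n. mol (e n) x) \<longlonglongrightarrow> 0" by (rule tendsto_eventually[OF eventually_mono]) simp
        then show ?thesis using xo by simp
      qed
    qed
    have front: "AE x in lborel. x \<notin> frontier ?B"
    proof -
      have "frontier ?B \<in> null_sets lebesgue"
        using negligible_convex_frontier[OF convex_box(1)] by (simp add: negligible_iff_null_sets)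
      then have "AE x in lebesgue. x \<notin> frontier ?B" by (rule AE_not_in)
      then show ?thesis by (simp add: AE_completion_iff)
    qed
    have "(\<lambda>n. LINT x|lborel. \<psi> x * of_real (mol (e n) x)) \<longlonglongrightarrow> (LINT x|lborel. \<psi> x * of_real (\<kappa> * indicator ?B x))"
    proof (rule integral_dominated_convergence)
      show "integrable lborel (\<lambda>x. M * (pi\<^sup>2 / 2) * norm (indicator ?S x *\<^sub>R \<psi> x))"
        by (intro integrable_mult_right integrable_norm \<psi>_loc)
      show "AE x in lborel. (\<lambda>n. \<psi> x * of_real (mol (e n) x)) \<longlonglongrightarrow> \<psi> x * of_real (\<kappa> * indicator ?B x)"
        using front by eventually_elim (intro tendsto_mult tendsto_const tendsto_of_real mol_lim)
      show "AE x in lborel. norm (\<psi> x * of_real (mol (e n) x)) \<le> M * (pi\<^sup>2 / 2) * norm (indicator ?S x *\<^sub>R \<psi> x)" for n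
        using mult_left_mono[OF mol_le[OF e], of "norm (\<psi> _)" n] by (auto simp: norm_mult mult_ac)
    qed measurable
    moreover have "(\<lambda>n. LINT x|lborel. \<psi> x * of_real (mol (e n) x)) \<longlonglongrightarrow> of_real \<kappa> * (LINT x:?B|lborel. \<Theta> x)"
    proof (rule LIM_zero_cancel, rule Lim_null_comparison)
      show "(\<lambda>n. C * measure lborel ?B * e n) \<longlonglongrightarrow> 0"
        using tendsto_mult_right_zero[OF e_lim] by simp
      show "\<forall>\<^sub>F n in sequentially. norm ((LINT x|lborel. \<psi> x * of_real (mol (e n) x)) - of_real \<kappa> * (LINT x:?B|lborel. \<Theta> x))
          \<le> C * measure lborel ?B * e n"
      proof (rule always_eventually, rule allI)
        fix n
        have i\<Theta>: "integrable lborel (\<lambda>a. of_real \<kappa> * (indicator ?B a *\<^sub>R \<Theta> a))"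
          using int_\<Theta> unfolding set_integrable_def by (rule integrable_mult_right)
        have iC: "integrable lborel (\<lambda>a. C * e n * indicator ?B a)"
          by (intro integrable_mult_right ind)
        have "(LINT x|lborel. \<psi> x * of_real (mol (e n) x)) - of_real \<kappa> * (LINT x:?B|lborel. \<Theta> x)
          = (LINT a|lborel. indicator ?B a *\<^sub>R (LINT x|lborel. \<psi> x * of_real (k (e n) x a)) - of_real \<kappa> * (indicator ?B a *\<^sub>R \<Theta> a))"
          unfolding fub[OF e, symmetric] set_lebesgue_integral_def
          by (simp only: Bochner_Integration.integral_diff[OF int_fub[OF e] i\<Theta>] integral_mult_right_zero)
        also have "norm \<dots> \<le> (LINT a|lborel. C * e n * indicator ?B a)"
        proof (rule Bochner_Integration.integral_norm_bound_integral[OF Bochner_Integration.integrable_diff[OF int_fub[OF e] i\<Theta>] iC])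
          fix a
          have "(LINT x|lborel. \<psi> x * of_real (k (e n) x a)) = (LINT x|lborel. \<psi> x * of_real (K ((norm (x - a))\<^sup>2 / (e n)\<^sup>2)) / of_real (e n ^ 4))"
            by (simp add: k_def)
          also have "\<dots> = (LINT x|lborel. \<psi> x * of_real (K ((norm (x - a))\<^sup>2 / (e n)\<^sup>2))) / of_real (e n ^ 4)"
            by (rule integral_divide_zero)
          finally have "norm ((LINT x|lborel. \<psi> x * of_real (k (e n) x a)) - of_real \<kappa> * \<Theta> a) \<le> C * e n"
            using approx[OF e, of a n] by simp
          then show "norm (indicator ?B a *\<^sub>R (LINT x|lborel. \<psi> x * of_real (k (e n) x a)) - of_real \<kappa> * (indicator ?B a *\<^sub>R \<Theta> a))
             \<le> C * e n * indicator ?B a"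
            by (simp split: split_indicator)
        qed
        also have "\<dots> = C * measure lborel ?B * e n" by simp
        finally show "norm ((LINT x|lborel. \<psi> x * of_real (mol (e n) x)) - of_real \<kappa> * (LINT x:?B|lborel. \<Theta> x))
          \<le> C * measure lborel ?B * e n" .
      qed
    qed
    ultimately have "(LINT x|lborel. \<psi> x * of_real (\<kappa> * indicator ?B x)) = of_real \<kappa> * (LINT x:?B|lborel. \<Theta> x)"
      by (rule LIMSEQ_unique)
    moreover have "(LINT x|lborel. \<psi> x * of_real (\<kappa> * indicator ?B x)) = (LINT x|lborel. of_real \<kappa> * (indicator ?B x *\<^sub>R \<psi> x))"
      by (intro Bochner_Integration.integral_cong) (auto split: split_indicator)
    ultimately show "(LINT x:cbox l u|lborel. \<psi> x) = (LINT x:cbox l u|lborel. \<Theta> x)"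
      using \<open>\<kappa> \<noteq> 0\<close> unfolding set_lebesgue_integral_def
      by (simp only: integral_mult_right_zero mult_cancel_left of_real_eq_0_iff) simp
  qed
  have "AE x in lborel. \<psi> x - \<Theta> x = 0"
  proof (rule AE_eq_0_if_cbox_integrals_0)
    fix l r
    show "set_integrable lborel (cbox l r) (\<lambda>x. \<psi> x - \<Theta> x)"
      by (rule set_integral_diff(1)[OF int_\<psi> int_\<Theta>])
    show "(LINT x:cbox l r|lborel. \<psi> x - \<Theta> x) = 0"
      using set_integral_diff(2)[OF int_\<psi>[of l r] int_\<Theta>[of l r]] box[of l r] by simp
  qed
  then show ?thesis by simp
qed

section \<open>Logarithmic potentials\<close>

text \<open>Young's inequality with weight \<open>r\<close> balances \<open>\<parallel>f\<parallel>\<^sub>2\<^sup>2\<close> against the integral \<open>\<pi>\<^sup>2 r\<^sup>2\<close> of \<open>|x - a|\<^sup>-\<^sup>2\<close>, which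
  makes the bound linear in \<open>r\<close>.\<close>

lemma near_singularity:
  fixes f :: "R4 \<Rightarrow> 'b::{banach, second_countable_topology}"
  assumes [measurable]: "f \<in> borel_measurable borel"
    and sq: "integrable lborel (\<lambda>x. (norm (f x))\<^sup>2)" and r: "r > 0"
  shows "integrable lborel (\<lambda>x. inverse (norm (x - a)) * indicator (cball a r) x * norm (f x))" (is ?int)
    and "(LINT x|lborel. inverse (norm (x - a)) * indicator (cball a r) x * norm (f x))
      \<le> r * (((LINT x|lborel. (norm (f x))\<^sup>2) + pi\<^sup>2) / 2)" (is ?le)
proof -
  let ?u = "\<lambda>x. inverse (norm (x - a)) * indicator (cball a r) x"
  let ?g = "\<lambda>x. r / 2 * (norm (f x))\<^sup>2 + inverse (2 * r) * (inverse ((norm (x - a))\<^sup>2) * indicator (cball a r) x)"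
  note i2 = integrable_inverse_square_cball[of r a]
  have g: "integrable lborel ?g"
    using sq i2(1) r by (intro Bochner_Integration.integrable_add integrable_mult_right) auto
  have le: "norm (?u x * norm (f x)) \<le> ?g x" for x
  proof -
    have u: "(?u x)\<^sup>2 = inverse ((norm (x - a))\<^sup>2) * indicator (cball a r) x"
      by (auto simp: power_inverse split: split_indicator)
    have young: "p * q \<le> r / 2 * q\<^sup>2 + inverse (2 * r) * p\<^sup>2" for p q :: real
    proof -
      have "0 \<le> inverse (2 * r) * (p - r * q)\<^sup>2" using r by simp
      also have "\<dots> = r / 2 * q\<^sup>2 + inverse (2 * r) * p\<^sup>2 - p * q"
        using r by (simp add: field_simps power2_eq_square)
      finally show ?thesis by simp
    qed
    have "norm (?u x * norm (f x)) = ?u x * norm (f x)"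
      by simp
    also have "\<dots> \<le> r / 2 * (norm (f x))\<^sup>2 + inverse (2 * r) * (?u x)\<^sup>2" by (rule young)
    finally show ?thesis by (simp only: u)
  qed
  have "indicat_real (cball a r) \<in> borel_measurable borel" by (rule borel_measurable_indicator) simp
  then have meas: "(\<lambda>x. ?u x * norm (f x)) \<in> borel_measurable lborel"
    by simp
  show ?int by (rule integrable_dominated[OF g meas le])
  then have "(LINT x|lborel. ?u x * norm (f x)) \<le> (LINT x|lborel. ?g x)"
    using le by (intro integral_mono g) (auto intro: order_trans[OF abs_ge_self])
  also have "\<dots> = r / 2 * (LINT x|lborel. (norm (f x))\<^sup>2) + inverse (2 * r) * (pi\<^sup>2 * r\<^sup>2)"
    by (simp only: Bochner_Integration.integral_add[OF integrable_mult_right[OF sq] integrable_mult_right[OF i2(1)[OF less_imp_le[OF r]]]]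
        integral_mult_right_zero i2(2)[OF less_imp_le[OF r]])
  also have "\<dots> = r * (((LINT x|lborel. (norm (f x))\<^sup>2) + pi\<^sup>2) / 2)"
    using r by (simp add: field_simps power2_eq_square)
  finally show ?le .
qed

lemma abs_ln_norm_le:
  fixes z :: R4
  shows "\<bar>ln (norm z)\<bar> \<le> inverse (norm z) * indicator (cball 0 1) z + norm z"
proof (cases "z = 0")
  case False
  then have "norm z > 0" by simp
  from abs_ln_le[OF this] show ?thesis
    using one_le_inverse[of "norm z"] inverse_le_1_iff[of "norm z"] \<open>norm z > 0\<close>
    by (cases "norm z \<le> 1"; cases "norm z = 1") (auto simp: max_absorb2 max_absorb1 add_increasing2)
qed simp

text \<open>Conditions under which the logarithmic potential of \<open>f\<close> converges at every point.\<close>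

locale log_source =
  fixes f :: "R4 \<Rightarrow> complex"
  assumes f_meas [measurable]: "f \<in> borel_measurable borel"
    and moment: "integrable lborel (\<lambda>x. (1 + norm x) * norm (f x))"
    and square: "integrable lborel (\<lambda>x. (norm (f x))\<^sup>2)"
begin

definition log_pot :: "R4 \<Rightarrow> complex" where
  "log_pot a = (LINT x|lborel. of_real (ln (norm (a - x))) * f x)"

lemma integrable_linear_weight:
  assumes "w \<in> borel_measurable borel" "\<And>x. \<bar>w x\<bar> \<le> A * (1 + norm x)"
  shows "integrable lborel (\<lambda>x. of_real (w x) * f x)"
proof (rule integrable_dominated)
  show "integrable lborel (\<lambda>x. A * ((1 + norm x) * norm (f x)))"
    by (rule integrable_mult_right[OF moment])
  show "(\<lambda>x. of_real (w x) * f x) \<in> borel_measurable lborel" using assms(1) by simp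
  show "norm (of_real (w x) * f x) \<le> A * ((1 + norm x) * norm (f x))" for x
    using mult_right_mono[OF assms(2), of "norm (f x)" x] by (simp add: norm_mult mult.assoc)
qed

lemma integrable_source: "integrable lborel f"
  using integrable_linear_weight[of "\<lambda>_. 1" 1] by simp

definition near_const :: real where
  "near_const = ((LINT x|lborel. (norm (f x))\<^sup>2) + pi\<^sup>2) / 2"

definition moment_const :: real where
  "moment_const = (LINT x|lborel. (1 + norm x) * norm (f x))"

lemma consts_nonneg: "near_const \<ge> 0" "moment_const \<ge> 0"
  by (auto simp: near_const_def moment_const_def intro!: add_nonneg_nonneg divide_nonneg_nonneg integral_nonneg)

text \<open>Split at \<open>|x - a| = 1\<close>: near \<open>a\<close> the logarithm is at most \<open>1 / |x - a|\<close> and the source is square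
  integrable; far away it is at most \<open>|x - a|\<close> and the first moment takes over.\<close>

lemma integrable_log: "integrable lborel (\<lambda>x. of_real (ln (norm (a - x))) * f x)"
  and norm_log_pot_le: "norm (log_pot a) \<le> (near_const + moment_const) * (1 + norm a)"
proof -
  let ?n = "\<lambda>x. inverse (norm (x - a)) * indicator (cball a 1) x * norm (f x)"
  let ?g = "\<lambda>x. ?n x + (1 + norm a) * ((1 + norm x) * norm (f x))"
  note near = near_singularity[OF f_meas square zero_less_one, of a]
  have g: "integrable lborel ?g"
    by (intro Bochner_Integration.integrable_add integrable_mult_right near(1) moment)
  have le: "norm (of_real (ln (norm (a - x))) * f x) \<le> ?g x" for x
  proof -
    have "\<bar>ln (norm (a - x))\<bar> \<le> inverse (norm (x - a)) * indicator (cball a 1) x + norm (x - a)"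
      using abs_ln_norm_le[of "a - x"] by (simp add: norm_minus_commute indicator_def dist_norm)
    moreover have "norm (x - a) \<le> norm x + norm a" by (rule norm_triangle_ineq4)
    moreover have "norm x + norm a \<le> (1 + norm a) * (1 + norm x)" by (simp add: algebra_simps)
    ultimately have "\<bar>ln (norm (a - x))\<bar> \<le> inverse (norm (x - a)) * indicator (cball a 1) x + (1 + norm a) * (1 + norm x)"
      by linarith
    from mult_right_mono[OF this, of "norm (f x)"] show ?thesis
      by (simp add: norm_mult algebra_simps)
  qed
  show int: "integrable lborel (\<lambda>x. of_real (ln (norm (a - x))) * f x)"
    by (rule integrable_dominated[OF g _ le]) measurable
  have "norm (log_pot a) \<le> (LINT x|lborel. ?g x)"
    unfolding log_pot_def by (rule Bochner_Integration.integral_norm_bound_integral[OF int g le])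
  also have "\<dots> = (LINT x|lborel. ?n x) + (1 + norm a) * moment_const"
    unfolding moment_const_def
    by (simp only: Bochner_Integration.integral_add[OF near(1) integrable_mult_right[OF moment]] integral_mult_right_zero)
  also have "\<dots> \<le> near_const * 1 + (1 + norm a) * moment_const"
    using near(2) by (simp add: near_const_def)
  also have "\<dots> \<le> near_const * (1 + norm a) + (1 + norm a) * moment_const"
    using consts_nonneg by (intro add_mono mult_left_mono) auto
  finally show "norm (log_pot a) \<le> (near_const + moment_const) * (1 + norm a)"
    by (simp add: algebra_simps)
qed

lemma borel_measurable_log_pot [measurable]: "log_pot \<in> borel_measurable borel"
proof -
  have "(\<lambda>a. LINT x|lborel. of_real (ln (norm (a - x))) * f x) \<in> borel_measurable lborel"
  proof (rule lborel.borel_measurable_lebesgue_integral)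
    have "(\<lambda>(a, x). complex_of_real (ln (norm (a - x))) * f x) \<in> borel_measurable (borel \<Otimes>\<^sub>M borel)"
      by measurable
    moreover have "sets (lborel \<Otimes>\<^sub>M lborel) = sets ((borel :: R4 measure) \<Otimes>\<^sub>M (borel :: R4 measure))"
      by (intro sets_pair_measure_cong) simp_all
    ultimately show "(\<lambda>(a, x). complex_of_real (ln (norm (a - x))) * f x) \<in> borel_measurable (lborel \<Otimes>\<^sub>M lborel)"
      by (simp cong: measurable_cong_sets)
  qed
  then show ?thesis by (simp add: log_pot_def[abs_def])
qed

text \<open>Neutrality allows \<open>ln |a - x|\<close> to be replaced by \<open>ln t\<close> with \<open>t = |a - x| / |a|\<close>. If \<open>t \<ge> 1/2\<close>, then
  \<open>|ln t| \<le> 2 |t - 1| \<le> 2 |x| / |a|\<close> and the first moment gives \<open>O(1 / |a|)\<close>. If \<open>t < 1/2\<close>, then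
  \<open>|x| \<ge> |a| / 2\<close>, so the cubic weight contributes a factor \<open>|a|\<^sup>-\<^sup>3\<close>, and \<open>|ln t| \<le> |a| / |a - x|\<close> is
  integrated by \<open>near_singularity\<close> over a ball of radius \<open>|a|\<close>.\<close>

lemma log_pot_decay:
  assumes cubic: "integrable lborel (\<lambda>x. (norm ((1 + norm x) ^ 3 *\<^sub>R f x))\<^sup>2)"
    and neutral: "(LINT x|lborel. f x) = 0"
  obtains C where "C > 0" "\<And>a. norm (log_pot a) \<le> C / (1 + norm a)"
proof -
  define w where "w x = (1 + norm x) ^ 3 *\<^sub>R f x" for x
  have w_meas: "w \<in> borel_measurable borel" unfolding w_def[abs_def] by measurable
  define B where "B = ((LINT x|lborel. (norm (w x))\<^sup>2) + pi\<^sup>2) / 2"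
  have B: "B \<ge> 0" by (auto simp: B_def intro!: add_nonneg_nonneg divide_nonneg_nonneg integral_nonneg)
  have far: "norm (log_pot a) \<le> (2 * moment_const + 8 * B) / norm a" if a: "norm a \<ge> 1" for a
  proof -
    have a0: "norm a > 0" using a by linarith
    let ?n = "\<lambda>x. inverse (norm (x - a)) * indicator (cball a (norm a)) x * norm (w x)"
    let ?g = "\<lambda>x. 2 / norm a * ((1 + norm x) * norm (f x)) + 8 / (norm a)\<^sup>2 * ?n x"
    note near = near_singularity[OF w_meas cubic[folded w_def] a0, of a]
    have g: "integrable lborel ?g"
      by (intro Bochner_Integration.integrable_add integrable_mult_right near(1) moment)
    have le: "norm (of_real (ln (norm (a - x)) - ln (norm a)) * f x) \<le> ?g x" if xa: "x \<noteq> a" for x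
    proof -
      define t where "t = norm (a - x) / norm a"
      have t: "t > 0" using xa a0 by (simp add: t_def)
      have ln: "ln (norm (a - x)) - ln (norm a) = ln t"
        using xa a0 by (simp add: t_def ln_div)
      have n0: "0 \<le> 8 / (norm a)\<^sup>2 * ?n x" by simp
      have m0: "0 \<le> 2 / norm a * ((1 + norm x) * norm (f x))" by simp
      show ?thesis
      proof (cases "t \<ge> 1 / 2")
        case True
        have "\<bar>ln t\<bar> \<le> 2 * \<bar>t - 1\<bar>"
        proof (cases "t \<ge> 1")
          case False
          have "- ln t = ln (inverse t)" using t by (simp add: ln_inverse)
          also have "\<dots> \<le> inverse t - 1" using t by (intro ln_le_minus_one) simp
          also have "\<dots> = inverse t * (1 - t)" using t by (simp add: algebra_simps)
          also have "\<dots> \<le> 2 * (1 - t)"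
            using True t False by (intro mult_right_mono) (auto simp: field_simps)
          finally show ?thesis using False t ln_less_zero[of t] by auto
        qed (use ln_le_minus_one[of t] ln_ge_zero[of t] in auto)
        also have "\<bar>t - 1\<bar> \<le> norm x / norm a"
        proof -
          have "\<bar>norm (a - x) - norm a\<bar> \<le> norm x"
            using norm_triangle_ineq3[of "a - x" a] by simp
          moreover have "t - 1 = (norm (a - x) - norm a) / norm a"
            using a0 by (simp add: t_def diff_divide_distrib)
          ultimately show ?thesis using a0 by (simp add: divide_right_mono)
        qed
        also have "norm x / norm a \<le> (1 + norm x) / norm a"
          using a0 by (intro divide_right_mono) auto
        finally have "\<bar>ln t\<bar> \<le> 2 / norm a * (1 + norm x)" by simp
        from mult_right_mono[OF this, of "norm (f x)"]
        have "norm (of_real (ln t) * f x) \<le> 2 / norm a * ((1 + norm x) * norm (f x))"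
          by (simp only: norm_mult norm_of_real mult.assoc norm_ge_zero simp_thms)
        then show ?thesis using n0 unfolding ln by linarith
      next
        case False
        then have "2 * norm (a - x) < norm a" using a0 by (simp add: t_def field_simps)
        moreover have "norm a \<le> norm (a - x) + norm x" using norm_triangle_ineq[of "a - x" x] by simp
        ultimately have half: "norm a \<le> 2 * norm x" and "norm (a - x) \<le> norm a"
          using norm_ge_zero[of "a - x"] by linarith+
        then have cb: "x \<in> cball a (norm a)" by (simp add: dist_norm)
        have "(norm a) ^ 3 \<le> (2 * (1 + norm x)) ^ 3" using half by (intro power_mono) auto
        then have "(norm a) ^ 3 \<le> 8 * (1 + norm x) ^ 3" by (simp only: power_mult_distrib) simp
        from mult_right_mono[OF this, of "norm (f x)"] have "(norm a) ^ 3 * norm (f x) \<le> 8 * norm (w x)"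
          by (simp add: w_def)
        then have fw: "norm (f x) \<le> 8 / (norm a) ^ 3 * norm (w x)"
          using a0 by (simp add: field_simps)
        have "\<bar>ln t\<bar> \<le> inverse t" using abs_ln_le[OF t] False one_le_inverse[OF t] by (auto simp: max_def split: if_splits)
        also have "inverse t = norm a * inverse (norm (x - a))"
          by (simp add: t_def norm_minus_commute divide_inverse)
        finally have "\<bar>ln t\<bar> * norm (f x) \<le> (norm a * inverse (norm (x - a))) * (8 / (norm a) ^ 3 * norm (w x))"
          using fw by (intro mult_mono) auto
        also have "\<dots> = 8 / (norm a)\<^sup>2 * ?n x"
          using cb a0 by (simp add: power2_eq_square power3_eq_cube field_simps)
        finally have "norm (of_real (ln t) * f x) \<le> 8 / (norm a)\<^sup>2 * ?n x"
          by (simp only: norm_mult norm_of_real)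
        then show ?thesis using m0 unfolding ln by linarith
      qed
    qed
    have i0: "integrable lborel (\<lambda>x. of_real (ln (norm a)) * f x)"
      using integrable_source by simp
    have int: "integrable lborel (\<lambda>x. of_real (ln (norm (a - x)) - ln (norm a)) * f x)"
      using Bochner_Integration.integrable_diff[OF integrable_log[of a] i0] by (simp add: left_diff_distrib)
    have "log_pot a = (LINT x|lborel. of_real (ln (norm (a - x)) - ln (norm a)) * f x)"
      using Bochner_Integration.integral_diff[OF integrable_log[of a] i0] neutral
      by (simp add: left_diff_distrib log_pot_def)
    then have "norm (log_pot a) \<le> (LINT x|lborel. norm (of_real (ln (norm (a - x)) - ln (norm a)) * f x))"
      by (simp only: integral_norm_bound)
    also have "\<dots> \<le> (LINT x|lborel. ?g x)"
    proof (rule integral_mono_AE[OF integrable_norm[OF int] g])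
      have "AE x in lborel. x \<noteq> a" by (rule AE_lborel_singleton)
      then show "AE x in lborel. norm (of_real (ln (norm (a - x)) - ln (norm a)) * f x) \<le> ?g x"
        by eventually_elim (rule le)
    qed
    also have "\<dots> = 2 / norm a * moment_const + 8 / (norm a)\<^sup>2 * (LINT x|lborel. ?n x)"
      unfolding moment_const_def
      by (simp only: Bochner_Integration.integral_add[OF integrable_mult_right[OF moment] integrable_mult_right[OF near(1)]] integral_mult_right_zero)
    also have "\<dots> \<le> 2 / norm a * moment_const + 8 / (norm a)\<^sup>2 * (norm a * B)"
      using near(2) by (intro add_left_mono mult_left_mono) (auto simp: B_def)
    also have "\<dots> = (2 * moment_const + 8 * B) / norm a"
      using a0 by (simp add: field_simps power2_eq_square)
    finally show ?thesis .
  qed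
  let ?C = "2 * (2 * moment_const + 8 * B) + 4 * (near_const + moment_const) + 1"
  show thesis
  proof (rule that[of ?C])
    show "?C > 0" using consts_nonneg B by (intro add_nonneg_pos add_nonneg_nonneg) auto
    fix a
    show "norm (log_pot a) \<le> ?C / (1 + norm a)"
    proof (cases "norm a \<ge> 1")
      case True
      have "(2 * moment_const + 8 * B) / norm a \<le> (2 * moment_const + 8 * B) * 2 / (1 + norm a)"
      proof -
        have "1 / norm a \<le> 2 / (1 + norm a)" using True by (simp add: divide_simps)
        then have "(2 * moment_const + 8 * B) * (1 / norm a) \<le> (2 * moment_const + 8 * B) * (2 / (1 + norm a))"
          using consts_nonneg B by (intro mult_left_mono) auto
        then show ?thesis by simp
      qed
      also have "\<dots> \<le> ?C / (1 + norm a)"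
        using consts_nonneg by (intro divide_right_mono) auto
      finally show ?thesis using far[OF True] by simp
    next
      case False
      have "norm (log_pot a) * (1 + norm a) \<le> ((near_const + moment_const) * (1 + norm a)) * (1 + norm a)"
        by (intro mult_right_mono norm_log_pot_le) auto
      also have "\<dots> \<le> ((near_const + moment_const) * 2) * 2"
        using False consts_nonneg by (intro mult_mono) auto
      also have "\<dots> \<le> ?C" using consts_nonneg B by auto
      finally show ?thesis by (simp add: pos_le_divide_eq add_pos_nonneg)
    qed
  qed
qed

end

section \<open>Weak solutions with a logarithmic fundamental solution\<close>

lemma reg_log_tendsto_0: "(X \<longlongrightarrow> 0) F \<Longrightarrow> ((\<lambda>n. reg_log (X n)) \<longlongrightarrow> reg_log 0) F"
proof -
  assume X: "(X \<longlongrightarrow> 0) F"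
  have "isCont reg_log 0" using DERIV_isCont[OF reg_log_deriv_derivative[of 0 0]] by (simp add: reg_log_deriv_0)
  then show ?thesis using X by (rule isCont_tendsto_compose)
qed

lemma tendsto_ln_multiple_imp_0:
  fixes z L :: complex
  assumes "(\<lambda>n. of_real (ln (real (Suc n))) * z) \<longlonglongrightarrow> L"
  shows "z = 0"
proof (rule ccontr)
  assume z: "z \<noteq> 0"
  have "(\<lambda>n. norm (of_real (ln (real (Suc n))) * z) / norm z) \<longlonglongrightarrow> norm L / norm z"
    by (intro tendsto_divide tendsto_norm assms tendsto_const) (use z in simp)
  moreover have "norm (of_real (ln (real (Suc n))) * z) / norm z = ln (real (Suc n))" for n
    using z by (simp add: norm_mult)
  ultimately have "(\<lambda>n. ln (real (Suc n))) \<longlonglongrightarrow> norm L / norm z"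
    by (simp only:)
  moreover have "filterlim (\<lambda>n. ln (real (Suc n))) at_top sequentially"
    by (rule filterlim_compose[OF ln_at_top], rule filterlim_compose[OF filterlim_real_sequentially filterlim_Suc])
  then have "filterlim (\<lambda>n. ln (real (Suc n))) at_infinity sequentially"
    by (rule filterlim_at_top_imp_at_infinity)
  ultimately show False
    by (metis not_tendsto_and_filterlim_at_infinity sequentially_bot)
qed

context log_source
begin

text \<open>A weak solution of \<open>\<Delta>\<^sup>2\<psi> = - f\<close> that is close to \<open>c\<close> on average. The assumption \<open>near_c\<close> is the
  common feature of constants plus sums of \<open>L\<^sup>p\<close> functions with finite exponents. Measurability of the
  test function is added to \<open>weak\<close> so that the assumption passes between representatives.\<close>

context
  fixes \<psi> :: "R4 \<Rightarrow> complex" and c :: complex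
  assumes \<psi>_meas [measurable]: "\<psi> \<in> borel_measurable borel"
    and near_c: "\<And>\<delta>. \<delta> > 0 \<Longrightarrow> \<exists>N. integrable lborel N \<and> (\<forall>x. 0 \<le> N x) \<and>
        (AE x in lborel. norm (\<psi> x - c) \<le> \<delta> + (N x :: real))"
    and weak: "\<And>\<eta>. \<lbrakk>test_function \<eta>; \<eta> \<in> borel_measurable borel;
        laplacian (laplacian \<eta>) \<in> borel_measurable borel\<rbrakk> \<Longrightarrow>
        (LINT x|lborel. \<psi> x * laplacian (laplacian \<eta>) x) + (LINT x|lborel. f x * \<eta> x) = 0"
begin

text \<open>The bilaplacian of \<open>glog e a\<close>, scaled by \<open>e\<^sup>4\<close>.\<close>

definition kern :: "real \<Rightarrow> R4 \<Rightarrow> R4 \<Rightarrow> real" where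
  "kern e a x = bilap_log ((norm (x - a))\<^sup>2 / e\<^sup>2)"

definition glog :: "real \<Rightarrow> R4 \<Rightarrow> R4 \<Rightarrow> real" where
  "glog e a x = ln e + reg_log ((norm (x - a))\<^sup>2 / e\<^sup>2)"

lemma kern_meas [measurable]: "kern e a \<in> borel_measurable borel"
  and glog_meas [measurable]: "glog e a \<in> borel_measurable borel"
  unfolding kern_def[abs_def] glog_def[abs_def] by measurable

lemma kern_le:
  obtains M where "M > 0" "\<And>e a x. e > 0 \<Longrightarrow> \<bar>kern e a x\<bar> \<le> M * indicator (cball a e) x"
proof -
  obtain M where M: "M > 0" "\<And>s. s \<ge> 0 \<Longrightarrow> \<bar>bilap_log s\<bar> \<le> M" by (rule bilap_log_bounded) (rule that)
  show thesis
  proof (rule that[OF M(1)])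
    fix e :: real and a x :: R4 assume e: "e > 0"
    show "\<bar>kern e a x\<bar> \<le> M * indicator (cball a e) x"
    proof (cases "x \<in> cball a e")
      case True
      then show ?thesis using M(2)[of "(norm (x - a))\<^sup>2 / e\<^sup>2"] by (simp add: kern_def)
    next
      case False
      then have "e < norm (x - a)" by (simp add: dist_norm norm_minus_commute)
      then have "e\<^sup>2 < (norm (x - a))\<^sup>2" using e by (intro power_strict_mono) auto
      then have "(norm (x - a))\<^sup>2 / e\<^sup>2 > 1" using e by simp
      then show ?thesis using False by (simp add: kern_def bilap_log_eq_0)
    qed
  qed
qed

lemma integrable_cball: "integrable lborel (\<lambda>x. K * indicat_real (cball (a :: R4) r) x)"
  by (rule integrable_mult_right, rule integrable_real_indicator[OF _ emeasure_lborel_cball_finite]) simp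

lemma integral_cball: "r \<ge> 0 \<Longrightarrow> (LINT x|lborel. K * indicat_real (cball (a :: R4) r) x) = K * (pi\<^sup>2 / 2 * r ^ 4)"
  using content_cball[of r a] by (simp add: eval_unit_ball_vol)

lemma \<psi>_loc: "integrable lborel (\<lambda>x. indicat_real (cball a r) x *\<^sub>R \<psi> x)"
proof -
  obtain N where N: "integrable lborel N" "\<And>x. 0 \<le> N x" "AE x in lborel. norm (\<psi> x - c) \<le> 1 + N x"
    using near_c[of 1] by auto
  have g: "integrable lborel (\<lambda>x. (norm c + 1) * indicator (cball a r) x + N x)"
    by (intro Bochner_Integration.integrable_add integrable_cball N(1))
  have "indicat_real (cball a r) \<in> borel_measurable borel" by (rule borel_measurable_indicator) simp
  then have m: "(\<lambda>x. indicat_real (cball a r) x *\<^sub>R \<psi> x) \<in> borel_measurable lborel" by simp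
  show ?thesis
  proof (rule Bochner_Integration.integrable_bound[OF g m])
    show "AE x in lborel. norm (indicat_real (cball a r) x *\<^sub>R \<psi> x)
        \<le> norm ((norm c + 1) * indicator (cball a r) x + N x)"
      using N(3)
    proof eventually_elim
      case (elim x)
      have "norm (\<psi> x) \<le> norm c + 1 + N x"
        using norm_triangle_ineq[of "\<psi> x - c" c] elim by simp
      then show ?case using N(2)[of x] by (simp add: indicator_def)
    qed
  qed
qed

lemma integrable_kern: "e > 0 \<Longrightarrow> integrable lborel (kern e a)"
proof -
  assume e: "e > 0"
  obtain M where M: "M > 0" "\<And>e a x. e > 0 \<Longrightarrow> \<bar>kern e a x\<bar> \<le> M * indicator (cball a e) x"
    by (rule kern_le) (rule that)
  show ?thesis
    by (rule integrable_dominated[OF integrable_cball[of M a e]]) (use M(2)[OF e] in simp_all)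
qed

lemma integrable_\<psi>_kern:
  assumes e: "e > 0"
  shows "integrable lborel (\<lambda>x. \<psi> x * of_real (kern e a x))"
proof -
  obtain M where M: "M > 0" "\<And>e a x. e > 0 \<Longrightarrow> \<bar>kern e a x\<bar> \<le> M * indicator (cball a e) x"
    by (rule kern_le) (rule that)
  show ?thesis
  proof (rule integrable_dominated[OF integrable_mult_right[OF integrable_norm[OF \<psi>_loc[of a e]], of M]])
    show "norm (\<psi> x * of_real (kern e a x)) \<le> M * norm (indicat_real (cball a e) x *\<^sub>R \<psi> x)" for x
      using mult_left_mono[OF M(2)[OF e, of a x], of "norm (\<psi> x)"] by (simp add: norm_mult mult_ac)
  qed measurable
qed

lemma integrable_f_glog:
  assumes e: "e > 0"
  shows "integrable lborel (\<lambda>x. f x * of_real (glog e a x))"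
proof -
  obtain C where C: "C > 0" "\<And>s. s \<ge> 0 \<Longrightarrow> \<bar>reg_log s\<bar> \<le> C + sqrt s" by (rule reg_log_bounds) (rule that)
  have "\<bar>glog e a x\<bar> \<le> (\<bar>ln e\<bar> + C + (1 + norm a) / e) * (1 + norm x)" for x
  proof -
    have "\<bar>glog e a x\<bar> \<le> \<bar>ln e\<bar> + (C + sqrt ((norm (x - a))\<^sup>2 / e\<^sup>2))"
      unfolding glog_def by (intro order_trans[OF abs_triangle_ineq] add_left_mono C(2)) auto
    also have "sqrt ((norm (x - a))\<^sup>2 / e\<^sup>2) = norm (x - a) / e"
      using e by (simp add: real_sqrt_divide)
    also have "norm (x - a) / e \<le> (1 + norm a) * (1 + norm x) / e"
    proof (rule divide_right_mono)
      show "norm (x - a) \<le> (1 + norm a) * (1 + norm x)"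
      proof -
        have "(1 + norm a) * (1 + norm x) = 1 + norm a + norm x + norm a * norm x" by (simp add: algebra_simps)
        then show ?thesis
          using norm_triangle_ineq4[of x a] mult_nonneg_nonneg[OF norm_ge_zero[of a] norm_ge_zero[of x]] by linarith
      qed
    qed (use e in simp)
    also have "\<bar>ln e\<bar> + (C + (1 + norm a) * (1 + norm x) / e) \<le> (\<bar>ln e\<bar> + C) * (1 + norm x) + (1 + norm a) / e * (1 + norm x)"
      using C(1) by (simp add: algebra_simps)
    finally show ?thesis by (simp add: algebra_simps)
  qed
  from integrable_linear_weight[OF _ this] show ?thesis by (simp add: mult.commute)
qed

definition balance :: "real \<Rightarrow> R4 \<Rightarrow> complex" where
  "balance e a = (LINT x|lborel. \<psi> x * of_real (kern e a x)) / of_real (e ^ 4)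
      + (LINT x|lborel. f x * of_real (glog e a x))"

text \<open>This is the weak equation for the test function \<open>g\<^sub>e - g\<^sub>R\<close>.\<close>

lemma balance_eq:
  assumes "0 < e" "e < R"
  shows "balance e a = balance R a"
proof -
  let ?\<eta> = "\<lambda>x. complex_of_real (glog e a x - glog R a x)"
  have R: "R > 0" using assms by simp
  have t: "test_function ?\<eta>"
    and l: "laplacian (laplacian ?\<eta>) x = of_real (kern e a x / e ^ 4 - kern R a x / R ^ 4)" for x
    using test_function_log_difference[OF assms, of a] unfolding glog_def kern_def by blast+
  have 1: "(LINT x|lborel. \<psi> x * laplacian (laplacian ?\<eta>) x)
      = (LINT x|lborel. \<psi> x * of_real (kern e a x)) / of_real (e ^ 4)
       - (LINT x|lborel. \<psi> x * of_real (kern R a x)) / of_real (R ^ 4)"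
  proof -
    have "(LINT x|lborel. \<psi> x * laplacian (laplacian ?\<eta>) x)
      = (LINT x|lborel. \<psi> x * of_real (kern e a x) / of_real (e ^ 4) - \<psi> x * of_real (kern R a x) / of_real (R ^ 4))"
      unfolding l by (intro Bochner_Integration.integral_cong refl) (simp add: algebra_simps)
    also have "\<dots> = (LINT x|lborel. \<psi> x * of_real (kern e a x) / of_real (e ^ 4))
        - (LINT x|lborel. \<psi> x * of_real (kern R a x) / of_real (R ^ 4))"
      by (intro Bochner_Integration.integral_diff integrable_divide_zero integrable_\<psi>_kern assms R)
    finally show ?thesis by (simp only: integral_divide_zero)
  qed
  have 2: "(LINT x|lborel. f x * ?\<eta> x)
      = (LINT x|lborel. f x * of_real (glog e a x)) - (LINT x|lborel. f x * of_real (glog R a x))"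
    using Bochner_Integration.integral_diff[OF integrable_f_glog[OF assms(1), of a] integrable_f_glog[OF R, of a]]
    by (simp add: right_diff_distrib)
  have l': "laplacian (laplacian ?\<eta>) = (\<lambda>x. of_real (kern e a x / e ^ 4 - kern R a x / R ^ 4))"
    by (rule ext) (rule l)
  have "?\<eta> \<in> borel_measurable borel" "laplacian (laplacian ?\<eta>) \<in> borel_measurable borel"
    unfolding l' by measurable
  then show ?thesis
    using weak[OF t] unfolding 1 2 balance_def by (simp add: algebra_simps)
qed

text \<open>The kernel at scale \<open>R\<close> has mass \<open>- 8 \<pi>\<^sup>2 R\<^sup>4\<close>, which accounts for the constant \<open>c\<close>. The remainder
  \<open>\<psi> - c\<close> is \<open>\<delta>\<close> plus an integrable function: the first part contributes a multiple of \<open>\<delta>\<close>, the second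
  is divided by \<open>R\<^sup>4\<close>.\<close>

lemma large_scale_mean:
  "(\<lambda>n. (LINT x|lborel. \<psi> x * of_real (kern (real (Suc n)) a x)) / of_real (real (Suc n) ^ 4))
     \<longlonglongrightarrow> of_real (- 8 * pi\<^sup>2) * c"
proof -
  obtain M where M: "M > 0" "\<And>e a x. e > 0 \<Longrightarrow> \<bar>kern e a x\<bar> \<le> M * indicator (cball a e) x"
    by (rule kern_le) (rule that)
  have bound: "norm ((LINT x|lborel. \<psi> x * of_real (kern R a x)) / of_real (R ^ 4) - of_real (- 8 * pi\<^sup>2) * c)
      \<le> M * \<delta> * (pi\<^sup>2 / 2) + M * (LINT x|lborel. N x) / R"
    if R: "R \<ge> 1" and "\<delta> > 0" and N: "integrable lborel N" "\<And>x. 0 \<le> N x"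
      "AE x in lborel. norm (\<psi> x - c) \<le> \<delta> + N x" for R \<delta> N
  proof -
    have R0: "R > 0" using R by simp
    have ik: "integrable lborel (\<lambda>x. c * of_real (kern R a x))"
      by (intro integrable_mult_right integrable_of_real integrable_kern R0)
    have id: "integrable lborel (\<lambda>x. \<psi> x * of_real (kern R a x) - c * of_real (kern R a x))"
      by (rule Bochner_Integration.integrable_diff[OF integrable_\<psi>_kern[OF R0] ik])
    have "(LINT x|lborel. complex_of_real (kern R a x)) = of_real (- 8 * pi\<^sup>2 * R ^ 4)"
      using integral_bilap_log[OF R0, of a] by (simp only: integral_complex_of_real kern_def)
    then have d: "(LINT x|lborel. \<psi> x * of_real (kern R a x) - c * of_real (kern R a x))
        = (LINT x|lborel. \<psi> x * of_real (kern R a x)) - c * of_real (- 8 * pi\<^sup>2 * R ^ 4)"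
      by (simp only: Bochner_Integration.integral_diff[OF integrable_\<psi>_kern[OF R0] ik] integral_mult_right_zero)
    have cancel: "c * of_real (p * r) / of_real r = of_real p * c" if "r \<noteq> 0" for p r :: real
      using that by simp
    have eq: "(LINT x|lborel. \<psi> x * of_real (kern R a x)) / of_real (R ^ 4) - of_real (- 8 * pi\<^sup>2) * c
      = (LINT x|lborel. \<psi> x * of_real (kern R a x) - c * of_real (kern R a x)) / of_real (R ^ 4)"
      unfolding d diff_divide_distrib using R0 by (subst cancel) auto
    have diff_le: "norm (LINT x|lborel. \<psi> x * of_real (kern R a x) - c * of_real (kern R a x))
      \<le> M * \<delta> * (pi\<^sup>2 / 2 * R ^ 4) + M * (LINT x|lborel. N x)"
    proof -
      have g: "integrable lborel (\<lambda>x. M * \<delta> * indicator (cball a R) x + M * N x)"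
        by (intro Bochner_Integration.integrable_add integrable_cball integrable_mult_right N(1))
      have "norm (LINT x|lborel. \<psi> x * of_real (kern R a x) - c * of_real (kern R a x))
         \<le> (LINT x|lborel. norm (\<psi> x * of_real (kern R a x) - c * of_real (kern R a x)))"
        by (rule integral_norm_bound)
      also have "\<dots> \<le> (LINT x|lborel. M * \<delta> * indicator (cball a R) x + M * N x)"
      proof (rule integral_mono_AE[OF integrable_norm[OF id] g])
        show "AE x in lborel. norm (\<psi> x * of_real (kern R a x) - c * of_real (kern R a x))
            \<le> M * \<delta> * indicator (cball a R) x + M * N x"
          using N(3)
        proof eventually_elim
          case (elim x)
          have "norm (\<psi> x * of_real (kern R a x) - c * of_real (kern R a x)) = norm (\<psi> x - c) * \<bar>kern R a x\<bar>"
            by (simp only: left_diff_distrib[symmetric] norm_mult norm_of_real)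
          also have "\<dots> \<le> (\<delta> + N x) * (M * indicator (cball a R) x)"
            using elim \<open>\<delta> > 0\<close> N(2)[of x] by (intro mult_mono M(2)[OF R0]) auto
          also have "\<dots> \<le> M * \<delta> * indicator (cball a R) x + M * N x"
            using M(1) N(2)[of x] by (cases "x \<in> cball a R") (simp_all only: indicator_simps, simp_all add: algebra_simps)
          finally show ?case .
        qed
      qed
      also have "\<dots> = M * \<delta> * (pi\<^sup>2 / 2 * R ^ 4) + M * (LINT x|lborel. N x)"
      proof -
        have "(LINT x|lborel. M * N x) = M * (LINT x|lborel. N x)" by (rule integral_mult_right_zero)
        then show ?thesis
          by (simp only: Bochner_Integration.integral_add[OF integrable_cball integrable_mult_right[OF N(1)]]
              integral_cball[OF less_imp_le[OF R0]])
      qed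
      finally show ?thesis .
    qed
    have nR: "norm (complex_of_real (R ^ 4)) = R ^ 4" using R0 by (simp add: norm_power)
    have "norm ((LINT x|lborel. \<psi> x * of_real (kern R a x)) / of_real (R ^ 4) - of_real (- 8 * pi\<^sup>2) * c)
      \<le> (M * \<delta> * (pi\<^sup>2 / 2 * R ^ 4) + M * (LINT x|lborel. N x)) / R ^ 4"
      unfolding eq norm_divide nR by (rule divide_right_mono[OF diff_le]) (use R0 in simp)
    also have "\<dots> = M * \<delta> * (pi\<^sup>2 / 2) + M * (LINT x|lborel. N x) / R ^ 4"
      using R0 by (simp add: add_divide_distrib)
    also have "\<dots> \<le> M * \<delta> * (pi\<^sup>2 / 2) + M * (LINT x|lborel. N x) / R"
    proof -
      have "R ^ 1 \<le> R ^ 4" using R by (intro power_increasing) auto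
      then show ?thesis using R0 M(1) N(2)
        by (intro add_left_mono divide_left_mono mult_nonneg_nonneg integral_nonneg) auto
    qed
    finally show ?thesis .
  qed
  show ?thesis
  proof (rule LIMSEQ_I)
    fix \<epsilon> :: real assume \<epsilon>: "\<epsilon> > 0"
    \<comment> \<open>With this choice the first term of \<open>bound\<close> is half of \<open>\<epsilon>\<close>.\<close>
    define \<delta> where "\<delta> = \<epsilon> / (M * pi\<^sup>2)"
    have \<delta>: "\<delta> > 0" "M * \<delta> * (pi\<^sup>2 / 2) = \<epsilon> / 2" using \<epsilon> M(1) by (auto simp: \<delta>_def)
    obtain N where N: "integrable lborel N" "\<And>x. 0 \<le> N x" "AE x in lborel. norm (\<psi> x - c) \<le> \<delta> + N x"
      using near_c[OF \<delta>(1)] by auto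
    have "(\<lambda>n. M * (LINT x|lborel. N x) * inverse (real (Suc n))) \<longlonglongrightarrow> 0"
      using tendsto_mult_right_zero[OF LIMSEQ_inverse_real_of_nat] by blast
    then have "\<forall>\<^sub>F n in sequentially. M * (LINT x|lborel. N x) * inverse (real (Suc n)) < \<epsilon> / 2"
      using \<epsilon> by (intro order_tendstoD(2)) auto
    then obtain n0 where n0: "\<And>n. n \<ge> n0 \<Longrightarrow> M * (LINT x|lborel. N x) * inverse (real (Suc n)) < \<epsilon> / 2"
      unfolding eventually_sequentially by blast
    show "\<exists>n0. \<forall>n\<ge>n0. norm ((LINT x|lborel. \<psi> x * of_real (kern (real (Suc n)) a x)) / of_real (real (Suc n) ^ 4)
        - of_real (- 8 * pi\<^sup>2) * c) < \<epsilon>"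
    proof (intro exI[of _ n0] allI impI)
      fix n assume "n \<ge> n0"
      have "norm ((LINT x|lborel. \<psi> x * of_real (kern (real (Suc n)) a x)) / of_real (real (Suc n) ^ 4)
          - of_real (- 8 * pi\<^sup>2) * c) \<le> M * \<delta> * (pi\<^sup>2 / 2) + M * (LINT x|lborel. N x) / real (Suc n)"
        by (rule bound[OF _ \<delta>(1) N]) simp
      also have "\<dots> < \<epsilon>"
        using n0[OF \<open>n \<ge> n0\<close>] unfolding \<delta>(2) divide_inverse[of _ "real (Suc n)"] by linarith
      finally show "norm ((LINT x|lborel. \<psi> x * of_real (kern (real (Suc n)) a x)) / of_real (real (Suc n) ^ 4)
        - of_real (- 8 * pi\<^sup>2) * c) < \<epsilon>" .
    qed
  qed
qed

lemma large_scale_potential: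
  "(\<lambda>n. (LINT x|lborel. f x * of_real (reg_log ((norm (x - a))\<^sup>2 / (real (Suc n))\<^sup>2))))
     \<longlonglongrightarrow> of_real (reg_log 0) * (LINT x|lborel. f x)"
proof -
  obtain C where C: "C > 0" "\<And>s. s \<ge> 0 \<Longrightarrow> \<bar>reg_log s\<bar> \<le> C + sqrt s" by (rule reg_log_bounds) (rule that)
  have "(\<lambda>n. (LINT x|lborel. f x * of_real (reg_log ((norm (x - a))\<^sup>2 / (real (Suc n))\<^sup>2))))
     \<longlonglongrightarrow> (LINT x|lborel. f x * of_real (reg_log 0))"
  proof (rule integral_dominated_convergence)
    show "integrable lborel (\<lambda>x. (C + 1 + norm a) * ((1 + norm x) * norm (f x)))"
      by (rule integrable_mult_right[OF moment])
    show "AE x in lborel. (\<lambda>n. f x * of_real (reg_log ((norm (x - a))\<^sup>2 / (real (Suc n))\<^sup>2)))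
       \<longlonglongrightarrow> f x * of_real (reg_log 0)"
    proof (intro AE_I2 tendsto_mult tendsto_const tendsto_of_real reg_log_tendsto_0)
      fix x
      have "(\<lambda>n. (norm (x - a))\<^sup>2 * (inverse (real (Suc n)) * inverse (real (Suc n)))) \<longlonglongrightarrow> (norm (x - a))\<^sup>2 * (0 * 0)"
        by (intro tendsto_intros LIMSEQ_inverse_real_of_nat)
      then show "(\<lambda>n. (norm (x - a))\<^sup>2 / (real (Suc n))\<^sup>2) \<longlonglongrightarrow> 0"
        by (simp add: power2_eq_square divide_inverse)
    qed
    show "AE x in lborel. norm (f x * of_real (reg_log ((norm (x - a))\<^sup>2 / (real (Suc n))\<^sup>2)))
        \<le> (C + 1 + norm a) * ((1 + norm x) * norm (f x))" for n
    proof (rule AE_I2)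
      fix x
      have "\<bar>reg_log ((norm (x - a))\<^sup>2 / (real (Suc n))\<^sup>2)\<bar> \<le> C + sqrt ((norm (x - a))\<^sup>2 / (real (Suc n))\<^sup>2)"
        by (rule C(2)) simp
      moreover have "sqrt ((norm (x - a))\<^sup>2 / (real (Suc n))\<^sup>2) = norm (x - a) / real (Suc n)"
        by (simp only: real_sqrt_divide real_sqrt_abs abs_norm_cancel abs_of_nat)
      moreover have "norm (x - a) / real (Suc n) \<le> norm (x - a)"
        using divide_left_mono[of 1 "real (Suc n)" "norm (x - a)"] by simp
      moreover have "norm (x - a) \<le> norm x + norm a" by (rule norm_triangle_ineq4)
      moreover have "C + (norm x + norm a) \<le> (C + 1 + norm a) * (1 + norm x)"
        using C(1) by (simp add: algebra_simps add_increasing add_increasing2)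
      ultimately have "\<bar>reg_log ((norm (x - a))\<^sup>2 / (real (Suc n))\<^sup>2)\<bar> \<le> (C + 1 + norm a) * (1 + norm x)"
        by linarith
      from mult_right_mono[OF this, of "norm (f x)"]
      show "norm (f x * of_real (reg_log ((norm (x - a))\<^sup>2 / (real (Suc n))\<^sup>2)))
        \<le> (C + 1 + norm a) * ((1 + norm x) * norm (f x))"
        by (simp only: norm_mult norm_of_real mult.assoc mult.commute[of "norm (f x)"] norm_ge_zero simp_thms)
    qed
  qed measurable
  then show ?thesis by (simp add: mult.commute)
qed

lemma integral_f_glog:
  assumes "e > 0"
  shows "(LINT x|lborel. f x * of_real (glog e a x))
    = of_real (ln e) * (LINT x|lborel. f x) + (LINT x|lborel. f x * of_real (reg_log ((norm (x - a))\<^sup>2 / e\<^sup>2)))"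
proof -
  have 1: "integrable lborel (\<lambda>x. of_real (ln e) * f x)"
    by (rule integrable_mult_right[OF integrable_source])
  have "f x * of_real (reg_log ((norm (x - a))\<^sup>2 / e\<^sup>2)) = f x * of_real (glog e a x) - of_real (ln e) * f x" for x
    by (simp add: glog_def algebra_simps)
  then show ?thesis
    using Bochner_Integration.integral_diff[OF integrable_f_glog[OF assms, of a] 1]
    by (simp only: integral_mult_right_zero) simp
qed

text \<open>In the balance at scale \<open>R\<close> all terms except \<open>ln R \<integral> f\<close> converge as \<open>R\<close> grows, and the balance
  itself is constant.\<close>

lemma source_neutral: "(LINT x|lborel. f x) = 0"
proof (rule tendsto_ln_multiple_imp_0)
  let ?A = "\<lambda>n. (LINT x|lborel. \<psi> x * of_real (kern (real (Suc n)) 0 x)) / of_real (real (Suc n) ^ 4)"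
  let ?B = "\<lambda>n. (LINT x|lborel. f x * of_real (reg_log ((norm (x - 0))\<^sup>2 / (real (Suc n))\<^sup>2)))"
  \<comment> \<open>The reference scale \<open>1/2\<close> is smaller than every scale \<open>n + 1\<close>.\<close>
  let ?L = "balance (1 / 2) 0 - of_real (- 8 * pi\<^sup>2) * c - of_real (reg_log 0) * (LINT x|lborel. f x)"
  have "(\<lambda>n. balance (1 / 2) 0 - ?A n - ?B n) \<longlonglongrightarrow> ?L"
    by (intro tendsto_diff tendsto_const large_scale_mean large_scale_potential)
  moreover have "balance (1 / 2) 0 - ?A n - ?B n = of_real (ln (real (Suc n))) * (LINT x|lborel. f x)" for n
  proof -
    have "balance (1 / 2) 0 = balance (real (Suc n)) 0" by (rule balance_eq) auto
    then show ?thesis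
      using integral_f_glog[of "real (Suc n)" 0] unfolding balance_def[of "real (Suc n)"]
      by (simp del: of_nat_Suc)
  qed
  ultimately show "(\<lambda>n. of_real (ln (real (Suc n))) * (LINT x|lborel. f x)) \<longlonglongrightarrow> ?L"
    by (simp only:)
qed

lemma balance_value:
  assumes e: "e > 0"
  shows "balance e a = of_real (- 8 * pi\<^sup>2) * c"
proof -
  let ?A = "\<lambda>n. (LINT x|lborel. \<psi> x * of_real (kern (real (Suc n)) a x)) / of_real (real (Suc n) ^ 4)"
  let ?B = "\<lambda>n. (LINT x|lborel. f x * of_real (reg_log ((norm (x - a))\<^sup>2 / (real (Suc n))\<^sup>2)))"
  have AB: "balance (real (Suc n)) a = ?A n + ?B n" for n
    using integral_f_glog[of "real (Suc n)" a] unfolding balance_def source_neutral by simp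
  have "(\<lambda>n. ?A n + ?B n) \<longlonglongrightarrow> of_real (- 8 * pi\<^sup>2) * c + of_real (reg_log 0) * (LINT x|lborel. f x)"
    by (intro tendsto_add large_scale_mean large_scale_potential)
  then have "(\<lambda>n. balance (real (Suc n)) a) \<longlonglongrightarrow> of_real (- 8 * pi\<^sup>2) * c"
    unfolding AB source_neutral by simp
  moreover have ev: "\<forall>\<^sub>F n in sequentially. balance (real (Suc n)) a = balance e a"
  proof -
    obtain n0 :: nat where "e < real n0" using reals_Archimedean2 by blast
    then have "balance (real (Suc n)) a = balance e a" if "n \<ge> n0" for n
      using that by (intro balance_eq[symmetric] e) auto
    then show ?thesis unfolding eventually_sequentially by blast
  qed
  ultimately show ?thesis
    using LIMSEQ_unique[OF tendsto_eventually[OF ev]] by blast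
qed

text \<open>The truncated and the true logarithm differ only inside the ball of radius \<open>e\<close>, by at most
  \<open>C e / |x - a|\<close>. The estimate is uniform in \<open>a\<close>, as \<open>mollification_determines\<close> requires.\<close>

lemma small_scale_potential:
  obtains C where "C > 0" "\<And>e a. e > 0 \<Longrightarrow> norm (log_pot a - (LINT x|lborel. f x * of_real (glog e a x))) \<le> C * e\<^sup>2"
proof -
  obtain C where C: "C > 0" "\<And>s. s > 0 \<Longrightarrow> s \<le> 1 \<Longrightarrow> \<bar>reg_log s - ln s / 2\<bar> \<le> C * inverse (sqrt s)"
    by (rule reg_log_bounds) (rule that)
  show thesis
  proof (rule that[of "C * near_const + 1"])
    show "C * near_const + 1 > 0" using C(1) consts_nonneg by (simp add: add_nonneg_pos)
    fix e :: real and a assume e: "e > 0"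
    let ?n = "\<lambda>x. inverse (norm (x - a)) * indicator (cball a e) x * norm (f x)"
    let ?h = "\<lambda>x. of_real (ln (norm (a - x))) * f x - f x * of_real (glog e a x)"
    note near = near_singularity[OF f_meas square e, of a]
    have int: "integrable lborel ?h"
      by (intro Bochner_Integration.integrable_diff integrable_log integrable_f_glog e)
    have "log_pot a - (LINT x|lborel. f x * of_real (glog e a x)) = (LINT x|lborel. ?h x)"
      unfolding log_pot_def by (rule Bochner_Integration.integral_diff[symmetric, OF integrable_log integrable_f_glog[OF e]])
    then have "norm (log_pot a - (LINT x|lborel. f x * of_real (glog e a x))) \<le> (LINT x|lborel. norm (?h x))"
      by (simp only: integral_norm_bound)
    also have "\<dots> \<le> (LINT x|lborel. C * e * ?n x)"
    proof (rule integral_mono_AE[OF integrable_norm[OF int] integrable_mult_right[OF near(1)]])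
      have "AE x in lborel. x \<noteq> a" by (rule AE_lborel_singleton)
      then show "AE x in lborel. norm (?h x) \<le> C * e * ?n x"
      proof eventually_elim
        case (elim x)
        define s where "s = (norm (x - a))\<^sup>2 / e\<^sup>2"
        have s: "s > 0" "sqrt s = norm (x - a) / e"
          using elim e by (simp_all add: s_def real_sqrt_divide)
        have ls: "ln (norm (a - x)) = ln e + ln s / 2"
          using elim e by (simp add: s_def ln_div ln_realpow norm_minus_commute diff_divide_distrib)
        have "norm (?h x) = norm (f x) * \<bar>ln (norm (a - x)) - glog e a x\<bar>"
        proof -
          have "?h x = f x * of_real (ln (norm (a - x)) - glog e a x)" by (simp add: algebra_simps)
          then show ?thesis by (simp only: norm_mult norm_of_real)
        qed
        also have "ln (norm (a - x)) - glog e a x = - (reg_log s - ln s / 2)"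
          unfolding ls glog_def s_def by simp
        finally have hx: "norm (?h x) = norm (f x) * \<bar>reg_log s - ln s / 2\<bar>" by (simp only: abs_minus)
        show ?case
        proof (cases "s \<le> 1")
          case True
          then have "norm (x - a) \<le> e" using s e by (simp add: s_def divide_le_eq)
          then have "x \<in> cball a e" by (simp add: dist_norm norm_minus_commute)
          moreover have "\<bar>reg_log s - ln s / 2\<bar> \<le> C * (e * inverse (norm (x - a)))"
          proof -
            have "inverse (sqrt s) = e * inverse (norm (x - a))"
              unfolding s(2) inverse_divide by (rule divide_inverse)
            then show ?thesis using C(2)[OF s(1) True] by (simp only:)
          qed
          then have "norm (f x) * \<bar>reg_log s - ln s / 2\<bar> \<le> norm (f x) * (C * (e * inverse (norm (x - a))))"
            by (rule mult_left_mono) simp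
          ultimately show ?thesis unfolding hx by (simp add: mult_ac)
        next
          case False
          then show ?thesis unfolding hx using C(1) e by (simp add: reg_log_eq)
        qed
      qed
    qed
    also have "\<dots> = C * e * (LINT x|lborel. ?n x)" by (simp only: integral_mult_right_zero)
    also have "\<dots> \<le> C * e * (e * near_const)"
      using near(2) C(1) e by (intro mult_left_mono) (auto simp: near_const_def)
    also have "\<dots> \<le> (C * near_const + 1) * e\<^sup>2"
      by (simp add: power2_eq_square algebra_simps)
    finally show "norm (log_pot a - (LINT x|lborel. f x * of_real (glog e a x))) \<le> (C * near_const + 1) * e\<^sup>2" .
  qed
qed

lemma representation: "AE a in lborel. \<psi> a = c + log_pot a / of_real (8 * pi\<^sup>2)"
proof -
  obtain C where C: "C > 0" "\<And>e a. e > 0 \<Longrightarrow> norm (log_pot a - (LINT x|lborel. f x * of_real (glog e a x))) \<le> C * e\<^sup>2"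
    by (rule small_scale_potential) (rule that)
  obtain M where M: "M > 0" "\<And>s. s \<ge> 0 \<Longrightarrow> \<bar>bilap_log s\<bar> \<le> M" by (rule bilap_log_bounded) (rule that)
  let ?\<Theta> = "\<lambda>a. c + log_pot a / of_real (8 * pi\<^sup>2)"
  show ?thesis
  proof (rule mollification_determines[where K = bilap_log and \<kappa> = "- 8 * pi\<^sup>2" and M = M and C = C])
    show "integrable lborel (\<lambda>x. indicator (cball 0 r) x *\<^sub>R \<psi> x)" for r by (rule \<psi>_loc)
    show "integrable lborel (\<lambda>x. indicator (cball 0 r) x *\<^sub>R ?\<Theta> x)" for r
    proof (rule integrable_dominated[OF integrable_cball])
      have "indicat_real (cball 0 r) \<in> borel_measurable (borel :: R4 measure)" by (rule borel_measurable_indicator) simp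
      then show "(\<lambda>x. indicator (cball 0 r) x *\<^sub>R ?\<Theta> x) \<in> borel_measurable lborel" by simp
      fix x :: R4
      let ?K = "norm c + (near_const + moment_const) * (1 + r) / (8 * pi\<^sup>2)"
      show "norm (indicator (cball 0 r) x *\<^sub>R ?\<Theta> x) \<le> ?K * indicator (cball 0 r) x"
      proof (cases "x \<in> cball 0 r")
        case True
        have "norm (log_pot x) \<le> (near_const + moment_const) * (1 + r)"
          using True consts_nonneg by (intro order_trans[OF norm_log_pot_le mult_left_mono]) auto
        then have "norm (log_pot x / of_real (8 * pi\<^sup>2)) \<le> (near_const + moment_const) * (1 + r) / (8 * pi\<^sup>2)"
        proof -
          have n: "norm (complex_of_real (8 * pi\<^sup>2)) = 8 * pi\<^sup>2" by (simp add: norm_mult norm_power)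
          show ?thesis
            unfolding norm_divide n by (rule divide_right_mono[OF \<open>norm (log_pot x) \<le> _\<close>]) simp
        qed
        then have "norm (?\<Theta> x) \<le> ?K" by (intro order_trans[OF norm_triangle_ineq] add_left_mono)
        then show ?thesis using True by simp
      qed simp
    qed
    show "(LINT x|lborel. bilap_log ((norm (x - a :: R4))\<^sup>2 / e\<^sup>2)) = - 8 * pi\<^sup>2 * e ^ 4" if "e > 0" for a e
      by (rule integral_bilap_log[OF that])
    show "norm ((LINT x|lborel. \<psi> x * of_real (bilap_log ((norm (x - a))\<^sup>2 / e\<^sup>2))) / of_real (e ^ 4)
        - of_real (- 8 * pi\<^sup>2) * ?\<Theta> a) \<le> C * e" if e: "0 < e" "e \<le> 1" for a e
    proof -
      have "(LINT x|lborel. \<psi> x * of_real (bilap_log ((norm (x - a))\<^sup>2 / e\<^sup>2))) / of_real (e ^ 4)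
          = of_real (- 8 * pi\<^sup>2) * c - (LINT x|lborel. f x * of_real (glog e a x))"
        using balance_value[OF e(1), of a] unfolding balance_def kern_def by (simp add: algebra_simps)
      moreover have "of_real (- 8 * pi\<^sup>2) * ?\<Theta> a = of_real (- 8 * pi\<^sup>2) * c - log_pot a"
        by (simp add: distrib_left)
      ultimately have "norm ((LINT x|lborel. \<psi> x * of_real (bilap_log ((norm (x - a))\<^sup>2 / e\<^sup>2))) / of_real (e ^ 4)
        - of_real (- 8 * pi\<^sup>2) * ?\<Theta> a) = norm (log_pot a - (LINT x|lborel. f x * of_real (glog e a x)))"
        by simp
      also have "\<dots> \<le> C * e\<^sup>2" by (rule C(2)[OF e(1)])
      also have "\<dots> \<le> C * e" using e C(1) by (intro mult_left_mono) (auto simp: power2_eq_square mult_left_le)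
      finally show ?thesis .
    qed
  qed (use M bilap_log_eq_0 in auto)
qed

end

end

section \<open>The operators of the perturbation theory\<close>

text \<open>Integrals with parameters are handled for Borel functions, which remain jointly measurable under
  products and composition; Lebesgue measurable functions enter through Borel representatives.\<close>

lemma ex_borel_representative:
  fixes f :: "R4 \<Rightarrow> complex"
  assumes [measurable]: "f \<in> borel_measurable lebesgue"
  obtains g where "g \<in> borel_measurable borel" "AE x in lebesgue. f x = g x"
proof -
  have "(\<lambda>x. Re (f x)) \<in> borel_measurable lebesgue" "(\<lambda>x. Im (f x)) \<in> borel_measurable lebesgue"
    by measurable
  then obtain r i where r: "r \<in> borel_measurable lborel" "AE x in lborel. Re (f x) = r x"
    and i: "i \<in> borel_measurable lborel" "AE x in lborel. Im (f x) = i x"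
    using completion_ex_borel_measurable_real[of "\<lambda>x. Re (f x)" lborel]
      completion_ex_borel_measurable_real[of "\<lambda>x. Im (f x)" lborel] by blast
  show thesis
  proof (rule that)
    show "(\<lambda>x. Complex (r x) (i x)) \<in> borel_measurable borel"
      using r(1) i(1) unfolding Complex_eq by simp
    show "AE x in lebesgue. f x = Complex (r x) (i x)"
      using AE_completion[OF r(2)] AE_completion[OF i(2)]
      by eventually_elim (simp add: complex_eq_iff)
  qed
qed

lemma lebesgue_integral_representative:
  fixes f g :: "R4 \<Rightarrow> 'b::{banach, second_countable_topology}"
  assumes f: "f \<in> borel_measurable lebesgue" and g: "g \<in> borel_measurable borel"
    and eq: "AE x in lebesgue. f x = g x"
  shows "integral\<^sup>L lebesgue f = integral\<^sup>L lborel g"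
    and "integrable lebesgue f \<longleftrightarrow> integrable lborel g"
proof -
  have g': "g \<in> borel_measurable lborel" using g by simp
  then have g'': "g \<in> borel_measurable lebesgue" by (rule measurable_completion)
  show "integral\<^sup>L lebesgue f = integral\<^sup>L lborel g"
    unfolding integral_cong_AE[OF f g'' eq] by (rule integral_completion[OF g'])
  show "integrable lebesgue f \<longleftrightarrow> integrable lborel g"
    unfolding integrable_cong_AE[OF f g'' eq] by (rule integrable_completion[OF g'])
qed

lemma borel_imp_lebesgue: "f \<in> borel_measurable borel \<Longrightarrow> f \<in> borel_measurable (lebesgue :: R4 measure)"
  by (rule measurable_completion) simp

lemma borel_measurable_complex_of_real:
  "w \<in> borel_measurable M \<Longrightarrow> (\<lambda>x. complex_of_real (w x)) \<in> borel_measurable M"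
  by measurable

lemma borel_measurable_norm_compose:
  fixes f :: "'a \<Rightarrow> complex"
  shows "f \<in> borel_measurable M \<Longrightarrow> (\<lambda>x. norm (f x)) \<in> borel_measurable M"
  by measurable

lemma L2_iff: "f \<in> L2 \<longleftrightarrow> f \<in> borel_measurable lebesgue \<and> integrable lebesgue (\<lambda>x. (norm (f x))\<^sup>2)"
proof -
  have "norm (f x) powr 2 = (norm (f x))\<^sup>2" for x
    by (cases "f x = 0") (simp_all add: powr_numeral)
  then show ?thesis by (simp add: L2_def mem_Lp_def)
qed

lemma L2_diff:
  assumes "f \<in> L2" "g \<in> L2"
  shows "(\<lambda>x. f x - g x) \<in> L2"
proof -
  have g: "integrable lebesgue (\<lambda>x. 2 * (norm (f x))\<^sup>2 + 2 * (norm (g x))\<^sup>2)"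
    using assms by (simp add: L2_iff)
  have m: "f \<in> borel_measurable lebesgue" "g \<in> borel_measurable lebesgue" using assms by (simp_all add: L2_iff)
  have "norm ((norm (f x - g x))\<^sup>2) \<le> 2 * (norm (f x))\<^sup>2 + 2 * (norm (g x))\<^sup>2" for x
  proof -
    have "(norm (f x - g x))\<^sup>2 \<le> (norm (f x) + norm (g x))\<^sup>2"
      by (intro power_mono norm_triangle_ineq4) auto
    also have "\<dots> \<le> 2 * (norm (f x))\<^sup>2 + 2 * (norm (g x))\<^sup>2"
      using sum_squares_bound[of "norm (f x)" "norm (g x)"] by (simp add: power2_sum)
    finally show ?thesis by simp
  qed
  then show ?thesis
    using m unfolding L2_iff by (intro conjI integrable_dominated[OF g]) auto
qed

text \<open>The two weights that the decay rate \<open>\<langle>x\<rangle>\<^sup>-\<^sup>3\<^sup>-\<close> affords: a bounded cubic weight, and a linear weight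
  in \<open>L\<^sup>2\<close>. The second needs the extra \<open>\<epsilon>\<close>, since \<open>\<langle>x\<rangle>\<^sup>-\<^sup>4\<close> just fails to be integrable on \<open>\<real>\<^sup>4\<close>.\<close>

lemma decay_bounds:
  assumes "decays_faster 3 w"
  obtains C \<epsilon> where "C > 0" "\<epsilon> > 0" "\<And>x. (1 + norm x) ^ 3 * \<bar>w x\<bar> \<le> C"
    "\<And>x. ((1 + norm x) * w x)\<^sup>2 \<le> C * (1 + (norm x)\<^sup>2) powr (- (2 + \<epsilon>))"
proof -
  obtain C \<epsilon> where C: "C > 0" "\<epsilon> > 0" and w: "\<And>x. \<bar>w x\<bar> \<le> C * jbracket x powr (- 3 - \<epsilon>)"
    using assms unfolding decays_faster_def by blast
  have jb: "jbracket x \<ge> 1" "1 + norm x \<le> 2 * jbracket x" "(jbracket x)\<^sup>2 = 1 + (norm x)\<^sup>2" for x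
  proof -
    show 1: "jbracket x \<ge> 1" by (simp add: jbracket_def)
    have "norm x \<le> jbracket x" unfolding jbracket_def by (rule real_le_rsqrt) simp
    then show "1 + norm x \<le> 2 * jbracket x" using 1 by linarith
    show "(jbracket x)\<^sup>2 = 1 + (norm x)\<^sup>2" by (simp add: jbracket_def add_nonneg_nonneg)
  qed
  show thesis
  proof (rule that[of "8 * C + 4 * C\<^sup>2" \<epsilon>])
    show "8 * C + 4 * C\<^sup>2 > 0" using C by (simp add: add_pos_pos)
    fix x
    let ?j = "jbracket x"
    have j0: "?j > 0" using jb(1)[of x] by linarith
    have "(1 + norm x) ^ 3 * \<bar>w x\<bar> \<le> (2 * ?j) ^ 3 * (C * ?j powr (- 3 - \<epsilon>))"
      using jb(2)[of x] w[of x] j0 by (intro mult_mono power_mono) auto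
    also have "\<dots> = 8 * C * (?j powr 3 * ?j powr (- 3 - \<epsilon>))"
      using j0 by (simp add: powr_numeral power_mult_distrib)
    also have "?j powr 3 * ?j powr (- 3 - \<epsilon>) = ?j powr (- \<epsilon>)"
      by (simp add: powr_add[symmetric])
    also have "8 * C * ?j powr (- \<epsilon>) \<le> 8 * C * 1"
      using C jb(1)[of x] by (intro mult_left_mono) (auto intro: powr_le1 simp: powr_minus inverse_le_1_iff ge_one_powr_ge_zero)
    also have "\<dots> \<le> 8 * C + 4 * C\<^sup>2" by simp
    finally show "(1 + norm x) ^ 3 * \<bar>w x\<bar> \<le> 8 * C + 4 * C\<^sup>2" .
    have "\<bar>(1 + norm x) * w x\<bar> \<le> 2 * ?j * (C * ?j powr (- 3 - \<epsilon>))"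
      using jb(2)[of x] w[of x] j0 by (simp add: abs_mult) (intro mult_mono, auto)
    then have "((1 + norm x) * w x)\<^sup>2 \<le> (2 * ?j * (C * ?j powr (- 3 - \<epsilon>)))\<^sup>2"
      by (metis abs_ge_zero power2_abs power_mono)
    also have "\<dots> = 4 * C\<^sup>2 * (?j\<^sup>2 * (?j powr (- 3 - \<epsilon>) * ?j powr (- 3 - \<epsilon>)))"
      by (simp add: power2_eq_square)
    also have "?j\<^sup>2 * (?j powr (- 3 - \<epsilon>) * ?j powr (- 3 - \<epsilon>)) = ?j powr (2 * (- (2 + \<epsilon>)))"
    proof -
      have "?j\<^sup>2 = ?j powr 2" using j0 by (simp add: powr_numeral)
      then have "?j\<^sup>2 * (?j powr (- 3 - \<epsilon>) * ?j powr (- 3 - \<epsilon>)) = ?j powr (2 + ((- 3 - \<epsilon>) + (- 3 - \<epsilon>)))"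
        by (simp only: powr_add)
      moreover have "2 + ((- 3 - \<epsilon>) + (- 3 - \<epsilon>)) = 2 * (- (2 + \<epsilon>))" by simp
      ultimately show ?thesis by (simp only:)
    qed
    also have "?j powr (2 * (- (2 + \<epsilon>))) = (1 + (norm x)\<^sup>2) powr (- (2 + \<epsilon>))"
    proof -
      have "?j powr (2 * (- (2 + \<epsilon>))) = (?j powr 2) powr (- (2 + \<epsilon>))" by (simp only: powr_powr)
      also have "?j powr 2 = 1 + (norm x)\<^sup>2" using j0 jb(3)[of x] by (simp add: powr_numeral)
      finally show ?thesis .
    qed
    also have "4 * C\<^sup>2 * (1 + (norm x)\<^sup>2) powr (- (2 + \<epsilon>)) \<le> (8 * C + 4 * C\<^sup>2) * (1 + (norm x)\<^sup>2) powr (- (2 + \<epsilon>))"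
      using C by (intro mult_right_mono) auto
    finally show "((1 + norm x) * w x)\<^sup>2 \<le> (8 * C + 4 * C\<^sup>2) * (1 + (norm x)\<^sup>2) powr (- (2 + \<epsilon>))" .
  qed (use C in auto)
qed

lemma G1_representative:
  assumes f: "f \<in> borel_measurable lebesgue" and eq: "AE x in lebesgue. f x = F x" and F: "log_source F"
  shows "G1 f x = - (log_source.log_pot F x / of_real (8 * pi\<^sup>2))"
    and "integrable lebesgue (\<lambda>y. of_real (ln (norm (x - y))) * f y)"
proof -
  interpret log_source F by fact
  have ln: "(\<lambda>y. complex_of_real (ln (norm (x - y)))) \<in> borel_measurable borel" by measurable
  have m: "(\<lambda>y. complex_of_real (ln (norm (x - y))) * f y) \<in> borel_measurable lebesgue"
    by (intro borel_measurable_times borel_imp_lebesgue ln f)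
  have m': "(\<lambda>y. complex_of_real (ln (norm (x - y))) * F y) \<in> borel_measurable borel" by measurable
  have ae: "AE y in lebesgue. complex_of_real (ln (norm (x - y))) * f y = of_real (ln (norm (x - y))) * F y"
    using eq by eventually_elim simp
  note rep = lebesgue_integral_representative[OF m m' ae]
  show "integrable lebesgue (\<lambda>y. of_real (ln (norm (x - y))) * f y)"
    unfolding rep(2) by (rule integrable_log)
  show "G1 f x = - (log_pot x / of_real (8 * pi\<^sup>2))"
    unfolding G1_def rep(1) log_pot_def[symmetric] by simp
qed

locale decaying_potential =
  fixes V :: "R4 \<Rightarrow> real"
  assumes V_meas: "V \<in> borel_measurable lebesgue"
    and V_nonzero: "\<not> (AE x in lebesgue. V x = 0)"
    and v_decay: "decays_faster 3 (v_of V)"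
begin

abbreviation v :: "R4 \<Rightarrow> real" where "v \<equiv> v_of V"

lemma v_meas: "v \<in> borel_measurable lebesgue"
  using V_meas unfolding v_of_def[abs_def] by measurable

lemma U_meas: "U_of V \<in> borel_measurable lebesgue"
proof -
  have "U_of V = (\<lambda>x. if V x \<ge> 0 then 1 else -1)" by (simp add: U_of_def fun_eq_iff)
  then show ?thesis using V_meas by simp
qed

lemma U_sq: "U_of V x * U_of V x = 1" "\<bar>U_of V x\<bar> = 1"
  by (auto simp: U_of_def)

lemma v_sq: "v x * v x = \<bar>V x\<bar>" "U_of V x * (v x * v x) = V x" "v x \<ge> 0"
  by (auto simp: v_of_def U_of_def)

lemma v_bounded: obtains C where "C > 0" "\<And>x. (1 + norm x) ^ 3 * v x \<le> C" "\<And>x. v x \<le> C"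
proof -
  obtain C \<epsilon> where C: "C > 0" "\<And>x. (1 + norm x) ^ 3 * \<bar>v x\<bar> \<le> C"
    by (rule decay_bounds[OF v_decay]) (rule that)
  have "v x \<le> C" for x
  proof -
    have "1 * v x \<le> (1 + norm x) ^ 3 * \<bar>v x\<bar>" using v_sq(3)[of x] by (intro mult_mono) auto
    then show ?thesis using C(2)[of x] by simp
  qed
  then show thesis using that[of C] C v_sq(3) by simp
qed

lemma integrable_weighted_v: "integrable lebesgue (\<lambda>x. ((1 + norm x) * v x)\<^sup>2)"
proof -
  obtain C \<epsilon> where C: "C > 0" "\<epsilon> > 0"
    "\<And>x. ((1 + norm x) * v x)\<^sup>2 \<le> C * (1 + (norm x)\<^sup>2) powr (- (2 + \<epsilon>))"
    by (rule decay_bounds[OF v_decay]) (rule that)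
  have m: "(\<lambda>x::R4. (1 + (norm x)\<^sup>2) powr (- (2 + \<epsilon>))) \<in> borel_measurable lborel" by measurable
  have "integrable lebesgue (\<lambda>x::R4. (1 + (norm x)\<^sup>2) powr (- (2 + \<epsilon>)))"
    unfolding integrable_completion[OF m] by (rule integrable_bracket_powr) (use C(2) in simp)
  then have g: "integrable lebesgue (\<lambda>x::R4. C * (1 + (norm x)\<^sup>2) powr (- (2 + \<epsilon>)))"
    by (rule integrable_mult_right)
  have "(\<lambda>x::R4. 1 + norm x) \<in> borel_measurable lebesgue" by (rule borel_imp_lebesgue) measurable
  then have "(\<lambda>x. ((1 + norm x) * v x)\<^sup>2) \<in> borel_measurable lebesgue"
    by (intro borel_measurable_power borel_measurable_times v_meas)
  then show ?thesis by (rule integrable_dominated[OF g]) (use C(3) in simp)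
qed

lemma integrable_v_weight: "integrable lebesgue (\<lambda>x. (1 + norm x) * (v x * v x))"
proof (rule integrable_dominated[OF integrable_weighted_v])
  have "(\<lambda>x::R4. 1 + norm x) \<in> borel_measurable lebesgue" by (rule borel_imp_lebesgue) measurable
  then show "(\<lambda>x. (1 + norm x) * (v x * v x)) \<in> borel_measurable lebesgue"
    by (intro borel_measurable_times v_meas)
  show "norm ((1 + norm x) * (v x * v x)) \<le> ((1 + norm x) * v x)\<^sup>2" for x
  proof -
    have "1 * ((1 + norm x) * (v x * v x)) \<le> (1 + norm x) * ((1 + norm x) * (v x * v x))"
      using v_sq(3) by (intro mult_right_mono) auto
    then show ?thesis using v_sq(3)[of x] by (simp add: power2_eq_square mult_ac)
  qed
qed

lemma integrable_v_sq: "integrable lebesgue (\<lambda>x. v x * v x)"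
proof (rule integrable_dominated[OF integrable_v_weight])
  show "(\<lambda>x. v x * v x) \<in> borel_measurable lebesgue" by (intro borel_measurable_times v_meas)
  show "norm (v x * v x) \<le> (1 + norm x) * (v x * v x)" for x
    using mult_right_mono[of 1 "1 + norm x" "v x * v x"] by simp
qed

definition v_mass :: real where "v_mass = (LINT x|lebesgue. v x * v x)"

lemma v_mass_nonzero: "v_mass \<noteq> 0" and v_mass_L1: "v_mass = L1_norm V"
proof -
  show "v_mass \<noteq> 0"
  proof
    assume "v_mass = 0"
    then have "AE x in lebesgue. v x * v x = 0"
      unfolding v_mass_def by (subst (asm) integral_nonneg_eq_0_iff_AE[OF integrable_v_sq]) auto
    then have "AE x in lebesgue. V x = 0" by eventually_elim (simp add: v_sq)
    then show False using V_nonzero by simp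
  qed
  show "v_mass = L1_norm V" by (simp add: v_mass_def L1_norm_def v_sq)
qed

text \<open>The source \<open>v g\<close> is integrable with a linear weight as a product of two \<open>L\<^sup>2\<close> functions, and it
  inherits the cubic weight of \<open>v\<close> in \<open>L\<^sup>2\<close>. Hence the potential of \<open>v g\<close> converges at every point and
  \<open>T\<close> is linear on \<open>L\<^sup>2\<close> pointwise.\<close>

lemma v_mult_L2:
  assumes g: "g \<in> L2"
  shows "integrable lebesgue (\<lambda>x. of_real (v x) * g x)"
    and "(\<lambda>x. of_real (v x) * g x) \<in> borel_measurable lebesgue"
    and "\<And>F. \<lbrakk>F \<in> borel_measurable borel; AE x in lebesgue. of_real (v x) * g x = F x\<rbrakk> \<Longrightarrow>
      log_source F \<and> integrable lborel (\<lambda>x. (norm ((1 + norm x) ^ 3 *\<^sub>R F x))\<^sup>2)"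
proof -
  let ?f = "\<lambda>x. of_real (v x) * g x"
  have gm: "g \<in> borel_measurable lebesgue" and g2: "integrable lebesgue (\<lambda>x. (norm (g x))\<^sup>2)"
    using g by (simp_all add: L2_iff)
  show fm: "?f \<in> borel_measurable lebesgue"
    by (intro borel_measurable_times borel_measurable_complex_of_real v_meas gm)
  have wm: "(\<lambda>x::R4. 1 + norm x) \<in> borel_measurable borel" by measurable
  have mom: "integrable lebesgue (\<lambda>x. (1 + norm x) * norm (?f x))"
  proof (rule integrable_dominated)
    show "integrable lebesgue (\<lambda>x. ((1 + norm x) * v x)\<^sup>2 + (norm (g x))\<^sup>2)"
      by (intro Bochner_Integration.integrable_add integrable_weighted_v g2)
    show "(\<lambda>x. (1 + norm x) * norm (?f x)) \<in> borel_measurable lebesgue"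
      by (intro borel_measurable_times borel_imp_lebesgue[OF wm] borel_measurable_norm_compose fm)
    show "norm ((1 + norm x) * norm (?f x)) \<le> ((1 + norm x) * v x)\<^sup>2 + (norm (g x))\<^sup>2" for x
    proof -
      have young: "p * q \<le> p\<^sup>2 + q\<^sup>2" for p q :: real
        using sum_squares_bound[of p q] zero_le_power2[of p] zero_le_power2[of q] by linarith
      have "norm ((1 + norm x) * norm (?f x)) = ((1 + norm x) * v x) * norm (g x)"
        using v_sq(3)[of x] by (simp add: norm_mult mult.assoc)
      also have "\<dots> \<le> ((1 + norm x) * v x)\<^sup>2 + (norm (g x))\<^sup>2" by (rule young)
      finally show ?thesis .
    qed
  qed
  show "integrable lebesgue ?f"
  proof (rule integrable_dominated[OF mom fm])
    show "norm (?f x) \<le> (1 + norm x) * norm (?f x)" for x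
      using mult_right_mono[of 1 "1 + norm x" "norm (?f x)"] by simp
  qed
  obtain C where C: "C > 0" "\<And>x. (1 + norm x) ^ 3 * v x \<le> C" "\<And>x. v x \<le> C"
    by (rule v_bounded) (rule that)
  have Cg: "integrable lebesgue (\<lambda>x. C\<^sup>2 * (norm (g x))\<^sup>2)" by (rule integrable_mult_right[OF g2])
  have sq: "integrable lebesgue (\<lambda>x. (norm (?f x))\<^sup>2)"
  proof (rule integrable_dominated[OF Cg])
    show "(\<lambda>x. (norm (?f x))\<^sup>2) \<in> borel_measurable lebesgue"
      by (intro borel_measurable_power borel_measurable_norm_compose fm)
    show "norm ((norm (?f x))\<^sup>2) \<le> C\<^sup>2 * (norm (g x))\<^sup>2" for x
      using power_mono[OF C(3) v_sq(3), of x 2] by (simp add: norm_mult power_mult_distrib mult_right_mono)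
  qed
  have cub: "integrable lebesgue (\<lambda>x. (norm ((1 + norm x) ^ 3 *\<^sub>R ?f x))\<^sup>2)"
  proof (rule integrable_dominated[OF Cg])
    show "(\<lambda>x. (norm ((1 + norm x) ^ 3 *\<^sub>R ?f x))\<^sup>2) \<in> borel_measurable lebesgue"
      by (intro borel_measurable_power borel_measurable_norm_compose borel_measurable_scaleR fm borel_imp_lebesgue[OF wm])
    show "norm ((norm ((1 + norm x) ^ 3 *\<^sub>R ?f x))\<^sup>2) \<le> C\<^sup>2 * (norm (g x))\<^sup>2" for x
    proof -
      have eq: "norm ((1 + norm x) ^ 3 *\<^sub>R ?f x) = ((1 + norm x) ^ 3 * v x) * norm (g x)"
        using v_sq(3)[of x] by (simp add: norm_mult mult.assoc)
      have "((1 + norm x) ^ 3 * v x)\<^sup>2 \<le> C\<^sup>2"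
        using C(2)[of x] v_sq(3)[of x] by (intro power_mono) auto
      then have "((1 + norm x) ^ 3 * v x)\<^sup>2 * (norm (g x))\<^sup>2 \<le> C\<^sup>2 * (norm (g x))\<^sup>2"
        by (rule mult_right_mono) simp
      then show ?thesis
        by (simp only: eq real_norm_def abs_mult abs_power2 power_mult_distrib[of _ "norm (g x)"])
    qed
  qed
  fix F assume F: "F \<in> borel_measurable borel" and ae: "AE x in lebesgue. ?f x = F x"
  have "integrable lborel (\<lambda>x. (1 + norm x) * norm (F x))"
  proof (subst lebesgue_integral_representative(2)[symmetric])
    show "(\<lambda>x. (1 + norm x) * norm (F x)) \<in> borel_measurable borel" using F by simp
    show "AE x in lebesgue. (1 + norm x) * norm (?f x) = (1 + norm x) * norm (F x)"
      using ae by eventually_elim simp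
  qed (use mom in \<open>auto intro: borel_measurable_integrable\<close>)
  moreover have "integrable lborel (\<lambda>x. (norm (F x))\<^sup>2)"
  proof (subst lebesgue_integral_representative(2)[symmetric])
    show "(\<lambda>x. (norm (F x))\<^sup>2) \<in> borel_measurable borel" using F by simp
    show "AE x in lebesgue. (norm (?f x))\<^sup>2 = (norm (F x))\<^sup>2"
      using ae by eventually_elim simp
  qed (use sq in \<open>auto intro: borel_measurable_integrable\<close>)
  moreover have "integrable lborel (\<lambda>x. (norm ((1 + norm x) ^ 3 *\<^sub>R F x))\<^sup>2)"
  proof (subst lebesgue_integral_representative(2)[symmetric])
    show "(\<lambda>x. (norm ((1 + norm x) ^ 3 *\<^sub>R F x))\<^sup>2) \<in> borel_measurable borel" using F by simp
    show "AE x in lebesgue. (norm ((1 + norm x) ^ 3 *\<^sub>R ?f x))\<^sup>2 = (norm ((1 + norm x) ^ 3 *\<^sub>R F x))\<^sup>2"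
      using ae by eventually_elim simp
  qed (use cub in \<open>auto intro: borel_measurable_integrable\<close>)
  ultimately show "log_source F \<and> integrable lborel (\<lambda>x. (norm ((1 + norm x) ^ 3 *\<^sub>R F x))\<^sup>2)"
    using F by (simp add: log_source_def)
qed

abbreviation pot :: "(R4 \<Rightarrow> complex) \<Rightarrow> R4 \<Rightarrow> complex" where
  "pot g \<equiv> G1 (\<lambda>y. of_real (v y) * g y)"

lemma pot_L2:
  assumes g: "g \<in> L2"
  shows "pot g \<in> borel_measurable borel"
    and "\<exists>C. \<forall>x. norm (pot g x) \<le> C * (1 + norm x)"
    and "integrable lebesgue (\<lambda>y. of_real (ln (norm (x - y))) * (of_real (v y) * g y))"
proof -
  obtain F where F: "F \<in> borel_measurable borel" "AE x in lebesgue. of_real (v x) * g x = F x"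
    using ex_borel_representative[OF v_mult_L2(2)[OF g]] by blast
  have src: "log_source F" using v_mult_L2(3)[OF g F] by simp
  interpret log_source F by (rule src)
  have G: "pot g x = - (log_pot x / of_real (8 * pi\<^sup>2))" for x
    by (rule G1_representative(1)[OF v_mult_L2(2)[OF g] F(2) src])
  show "pot g \<in> borel_measurable borel"
    unfolding G[abs_def] by measurable
  have "norm (pot g x) \<le> (near_const + moment_const) / (8 * pi\<^sup>2) * (1 + norm x)" for x
  proof -
    have "norm (pot g x) = norm (log_pot x) / (8 * pi\<^sup>2)"
      unfolding G by (simp add: norm_divide norm_mult norm_power)
    also have "\<dots> \<le> (near_const + moment_const) * (1 + norm x) / (8 * pi\<^sup>2)"
      by (intro divide_right_mono norm_log_pot_le) simp
    finally show ?thesis by simp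
  qed
  then show "\<exists>C. \<forall>x. norm (pot g x) \<le> C * (1 + norm x)" by blast
  show "integrable lebesgue (\<lambda>y. of_real (ln (norm (x - y))) * (of_real (v y) * g y))"
    by (rule G1_representative(2)[OF v_mult_L2(2)[OF g] F(2) src])
qed

lemma T_op_diff:
  assumes "f \<in> L2" "g \<in> L2"
  shows "T_op V (\<lambda>x. f x - g x) x = T_op V f x - T_op V g x"
proof -
  have "pot (\<lambda>x. f x - g x) x = pot f x - pot g x"
    using Bochner_Integration.integral_diff[OF pot_L2(3)[OF assms(1), of x] pot_L2(3)[OF assms(2), of x]]
    by (simp add: G1_def right_diff_distrib)
  moreover have "u * (p - q) + w * (a - b) = (u * p + w * a) - (u * q + w * b)" for u w p q a b :: complex
    by (simp add: algebra_simps)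
  ultimately show ?thesis unfolding T_op_def by (simp only:)
qed

lemma T_op_L2:
  assumes g: "g \<in> L2"
  shows "T_op V g \<in> borel_measurable lebesgue"
    and "integrable lebesgue (\<lambda>x. of_real (v x) * T_op V g x)"
proof -
  have gm: "g \<in> borel_measurable lebesgue" using g by (simp add: L2_iff)
  have pm: "pot g \<in> borel_measurable lebesgue" by (rule borel_imp_lebesgue[OF pot_L2(1)[OF g]])
  show "T_op V g \<in> borel_measurable lebesgue"
    unfolding T_op_def[abs_def]
    by (intro borel_measurable_add borel_measurable_times borel_measurable_complex_of_real U_meas v_meas gm pm)
  obtain C where C: "\<And>x. norm (pot g x) \<le> C * (1 + norm x)" using pot_L2(2)[OF g] by blast
  have "integrable lebesgue (\<lambda>x. of_real (U_of V x) * (of_real (v x) * g x))"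
  proof (rule integrable_dominated[OF integrable_norm[OF v_mult_L2(1)[OF g]]])
    show "(\<lambda>x. of_real (U_of V x) * (of_real (v x) * g x)) \<in> borel_measurable lebesgue"
      by (intro borel_measurable_times borel_measurable_complex_of_real U_meas v_meas gm)
  qed (simp add: norm_mult U_sq)
  moreover have "integrable lebesgue (\<lambda>x. of_real (v x * v x) * pot g x)"
  proof (rule integrable_dominated[OF integrable_mult_right[OF integrable_v_weight, of C]])
    show "(\<lambda>x. of_real (v x * v x) * pot g x) \<in> borel_measurable lebesgue"
      by (intro borel_measurable_times borel_measurable_complex_of_real v_meas pm)
    show "norm (of_real (v x * v x) * pot g x) \<le> C * ((1 + norm x) * (v x * v x))" for x
    proof -
      have "norm (of_real (v x * v x) * pot g x) = (v x * v x) * norm (pot g x)"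
      proof -
        have "\<bar>v x * v x\<bar> = v x * v x" by simp
        then show ?thesis by (simp only: norm_mult[of "of_real (v x * v x)"] norm_of_real)
      qed
      also have "\<dots> \<le> (v x * v x) * (C * (1 + norm x))" by (intro mult_left_mono C) simp
      finally show ?thesis by (simp only: mult_ac)
    qed
  qed
  ultimately have "integrable lebesgue (\<lambda>x. of_real (U_of V x) * (of_real (v x) * g x) + of_real (v x * v x) * pot g x)"
    by (rule Bochner_Integration.integrable_add)
  then show "integrable lebesgue (\<lambda>x. of_real (v x) * T_op V g x)"
    by (simp add: T_op_def algebra_simps)
qed

text \<open>Since \<open>v\<close> is not a null function, the coefficient of \<open>v\<close> is determined, and the chosen projection is
  an identity of functions rather than an identity almost everywhere. Integrability of \<open>v f\<close> suffices,
  so that the formula applies to \<open>T g\<close> as well as to elements of \<open>L\<^sup>2\<close>.\<close>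

lemma P_op_eq:
  assumes f: "integrable lebesgue (\<lambda>x. of_real (v x) * f x)"
  shows "P_op V f = (\<lambda>x. (LINT x|lebesgue. of_real (v x) * f x) / of_real v_mass * of_real (v x))"
proof -
  let ?I = "LINT x|lebesgue. of_real (v x) * f x"
  have inner: "L2_inner (\<lambda>x. b * of_real (v x)) (\<lambda>x. f x - a * of_real (v x)) = cnj b * (?I - a * of_real v_mass)" for a b
  proof -
    have iv: "integrable lebesgue (\<lambda>x. a * complex_of_real (v x * v x))"
      by (intro integrable_mult_right integrable_of_real integrable_v_sq)
    have "L2_inner (\<lambda>x. b * of_real (v x)) (\<lambda>x. f x - a * of_real (v x))
        = (LINT x|lebesgue. cnj b * (of_real (v x) * f x - a * of_real (v x * v x)))"
      unfolding L2_inner_def by (intro Bochner_Integration.integral_cong refl) (simp add: algebra_simps)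
    also have "\<dots> = cnj b * ((LINT x|lebesgue. of_real (v x) * f x) - (LINT x|lebesgue. a * complex_of_real (v x * v x)))"
      by (simp only: integral_mult_right_zero[of _ "cnj b"] Bochner_Integration.integral_diff[OF f iv])
    also have "(LINT x|lebesgue. a * complex_of_real (v x * v x)) = a * of_real v_mass"
      by (simp only: integral_mult_right_zero integral_complex_of_real v_mass_def)
    finally show ?thesis .
  qed
  have m: "complex_of_real v_mass \<noteq> 0" using v_mass_nonzero by simp
  show ?thesis
    unfolding P_op_def orth_proj_def
  proof (rule some_equality)
    show "(\<lambda>x. ?I / of_real v_mass * of_real (v x)) \<in> range (\<lambda>a x. a * of_real (v x)) \<and>
      (\<forall>h\<in>range (\<lambda>a x. a * of_real (v x)). L2_inner h (\<lambda>x. f x - ?I / of_real v_mass * of_real (v x)) = 0)"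
    proof (intro conjI ballI)
      show "(\<lambda>x. ?I / of_real v_mass * of_real (v x)) \<in> range (\<lambda>a x. a * complex_of_real (v x))"
        by (rule range_eqI) (rule refl)
      fix h assume "h \<in> range (\<lambda>a x. a * complex_of_real (v x))"
      then obtain b where h: "h = (\<lambda>x. b * of_real (v x))" by blast
      show "L2_inner h (\<lambda>x. f x - ?I / of_real v_mass * of_real (v x)) = 0"
        unfolding h inner using m by simp
    qed
    fix g assume g: "g \<in> range (\<lambda>a x. a * complex_of_real (v x)) \<and>
      (\<forall>h\<in>range (\<lambda>a x. a * of_real (v x)). L2_inner h (\<lambda>x. f x - g x) = 0)"
    then obtain a where a: "g = (\<lambda>x. a * of_real (v x))" by blast
    have "L2_inner (\<lambda>x. 1 * of_real (v x)) (\<lambda>x. f x - a * of_real (v x)) = 0"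
      using g unfolding a by blast
    then have "a = ?I / of_real v_mass" unfolding inner using m by (simp add: field_simps)
    then show "g = (\<lambda>x. ?I / of_real v_mass * of_real (v x))" unfolding a by simp
  qed
qed

lemma integral_v_multiple:
  fixes h :: "R4 \<Rightarrow> complex" and \<beta> :: complex
  assumes "integrable lebesgue (\<lambda>x. of_real (v x) * h x)" "AE x in lebesgue. h x = \<beta> * of_real (v x)"
  shows "(LINT x|lebesgue. of_real (v x) * h x) = \<beta> * of_real v_mass"
proof -
  have "(LINT x|lebesgue. of_real (v x) * h x) = (LINT x|lebesgue. \<beta> * complex_of_real (v x * v x))"
  proof (rule integral_cong_AE)
    show "(\<lambda>x. of_real (v x) * h x) \<in> borel_measurable lebesgue"
      by (rule borel_measurable_integrable[OF assms(1)])
    show "(\<lambda>x. \<beta> * complex_of_real (v x * v x)) \<in> borel_measurable lebesgue"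
      by (intro borel_measurable_times borel_measurable_complex_of_real v_meas borel_measurable_const)
    show "AE x in lebesgue. of_real (v x) * h x = \<beta> * complex_of_real (v x * v x)"
      using assms(2) by eventually_elim simp
  qed
  also have "\<dots> = \<beta> * of_real v_mass"
    by (simp only: integral_mult_right_zero integral_complex_of_real v_mass_def)
  finally show ?thesis .
qed

lemma v_L2: "(\<lambda>x. a * of_real (v x)) \<in> L2"
proof -
  have "(\<lambda>x. a * complex_of_real (v x)) \<in> borel_measurable lebesgue"
    by (intro borel_measurable_times borel_measurable_complex_of_real v_meas borel_measurable_const)
  moreover have "integrable lebesgue (\<lambda>x. (norm a)\<^sup>2 * (v x * v x))"
    by (rule integrable_mult_right[OF integrable_v_sq])
  ultimately show ?thesis
    by (simp add: L2_iff norm_mult power_mult_distrib) (simp add: power2_eq_square)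
qed

text \<open>A function is fixed by \<open>Q\<close> when it is orthogonal to \<open>v\<close>, and killed by \<open>Q\<close> when it is a multiple of
  \<open>v\<close>. The resulting description is visibly linear in \<open>f\<close>.\<close>

lemma ker_QTQ_iff:
  "f \<in> ker_QTQ V \<longleftrightarrow> f \<in> L2 \<and> (LINT x|lebesgue. of_real (v x) * f x) = 0 \<and>
     (\<exists>\<beta>. AE x in lebesgue. T_op V f x = \<beta> * of_real (v x))"
proof
  have Q0: "Q_op V f = f" if "f \<in> L2" "(LINT x|lebesgue. of_real (v x) * f x) = 0" for f
    using P_op_eq[OF v_mult_L2(1)[OF that(1)]] that(2) by (simp add: Q_op_def)
  {
    assume f: "f \<in> ker_QTQ V"
    then obtain f0 where f0: "f0 \<in> L2" "f = Q_op V f0" by (auto simp: ker_QTQ_def)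
    define a where "a = (LINT x|lebesgue. of_real (v x) * f0 x) / of_real v_mass"
    have fa: "f = (\<lambda>x. f0 x - a * of_real (v x))"
      unfolding f0(2) Q_op_def P_op_eq[OF v_mult_L2(1)[OF f0(1)]] a_def ..
    have fL2: "f \<in> L2" unfolding fa by (rule L2_diff[OF f0(1) v_L2])
    have "(LINT x|lebesgue. of_real (v x) * f x)
        = (LINT x|lebesgue. of_real (v x) * f0 x) - (LINT x|lebesgue. of_real (v x) * (a * of_real (v x)))"
      using Bochner_Integration.integral_diff[OF v_mult_L2(1)[OF f0(1)] v_mult_L2(1)[OF v_L2[of a]]]
      unfolding fa by (simp add: right_diff_distrib)
    also have "(LINT x|lebesgue. of_real (v x) * (a * of_real (v x))) = (LINT x|lebesgue. a * complex_of_real (v x * v x))"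
      by (intro Bochner_Integration.integral_cong) simp_all
    also have "\<dots> = a * of_real v_mass"
      by (simp only: integral_mult_right_zero integral_complex_of_real v_mass_def)
    finally have f_orth: "(LINT x|lebesgue. of_real (v x) * f x) = 0"
      using v_mass_nonzero by (simp add: a_def)
    have "AE x in lebesgue. Q_op V (T_op V f) x = 0"
      using f Q0[OF fL2 f_orth] by (simp add: ker_QTQ_def)
    then have "AE x in lebesgue. T_op V f x =
        (LINT x|lebesgue. of_real (v x) * T_op V f x) / of_real v_mass * of_real (v x)"
      unfolding Q_op_def P_op_eq[OF T_op_L2(2)[OF fL2]] by eventually_elim simp
    then have "\<exists>\<beta>. AE x in lebesgue. T_op V f x = \<beta> * of_real (v x)"
      by (rule exI)
    then show "f \<in> L2 \<and> (LINT x|lebesgue. of_real (v x) * f x) = 0 \<and>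
      (\<exists>\<beta>. AE x in lebesgue. T_op V f x = \<beta> * of_real (v x))"
      using fL2 f_orth by blast
  next
    assume f: "f \<in> L2 \<and> (LINT x|lebesgue. of_real (v x) * f x) = 0 \<and>
      (\<exists>\<beta>. AE x in lebesgue. T_op V f x = \<beta> * of_real (v x))"
    then obtain \<beta> where \<beta>: "AE x in lebesgue. T_op V f x = \<beta> * of_real (v x)" by blast
    have Q: "Q_op V f = f" using f by (intro Q0) auto
    have "(LINT x|lebesgue. of_real (v x) * T_op V f x) = \<beta> * of_real v_mass"
      using f by (intro integral_v_multiple T_op_L2(2) \<beta>) blast
    then have "P_op V (T_op V f) = (\<lambda>x. \<beta> * of_real (v x))"
      using f v_mass_nonzero by (subst P_op_eq[OF T_op_L2(2)]) auto
    then have "AE x in lebesgue. Q_op V (T_op V (Q_op V f)) x = 0"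
      using \<beta> unfolding Q by (simp add: Q_op_def)
    moreover have "f \<in> Q_op V ` L2" using f Q by (metis imageI)
    ultimately show "f \<in> ker_QTQ V" by (simp add: ker_QTQ_def)
  }
qed

lemma ker_QTQ_diff:
  assumes "f \<in> ker_QTQ V" "g \<in> ker_QTQ V"
  shows "(\<lambda>x. f x - g x) \<in> ker_QTQ V"
proof -
  obtain \<beta> \<gamma> where f: "f \<in> L2" "(LINT x|lebesgue. of_real (v x) * f x) = 0" "AE x in lebesgue. T_op V f x = \<beta> * of_real (v x)"
    and g: "g \<in> L2" "(LINT x|lebesgue. of_real (v x) * g x) = 0" "AE x in lebesgue. T_op V g x = \<gamma> * of_real (v x)"
    using assms unfolding ker_QTQ_iff by blast
  have "(LINT x|lebesgue. of_real (v x) * (f x - g x)) = 0"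
    using Bochner_Integration.integral_diff[OF v_mult_L2(1)[OF f(1)] v_mult_L2(1)[OF g(1)]] f(2) g(2)
    by (simp add: right_diff_distrib)
  moreover have "AE x in lebesgue. T_op V (\<lambda>x. f x - g x) x = (\<beta> - \<gamma>) * of_real (v x)"
    using f(3) g(3) by eventually_elim (simp add: T_op_diff[OF f(1) g(1)] left_diff_distrib)
  ultimately show ?thesis
    unfolding ker_QTQ_iff using L2_diff[OF f(1) g(1)] by blast
qed

text \<open>An element \<open>\<phi>\<close> of the kernel is a candidate for its own projection, so some projection \<open>g\<close> exists.
  The difference \<open>\<phi> - g\<close> lies in the kernel and is orthogonal to it, hence to itself.\<close>

lemma ker_QTQ_subset_S1_L2:
  assumes \<phi>: "\<phi> \<in> ker_QTQ V"
  shows "\<phi> \<in> S1_L2 V"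
proof -
  define g where "g = S1 V \<phi>"
  have "g \<in> ker_QTQ V \<and> (\<forall>h\<in>ker_QTQ V. L2_inner h (\<lambda>x. \<phi> x - g x) = 0)"
    unfolding g_def S1_def orth_proj_def
    by (rule someI[where x = \<phi>]) (use \<phi> in \<open>simp add: L2_inner_def\<close>)
  then have g: "g \<in> ker_QTQ V" "\<And>h. h \<in> ker_QTQ V \<Longrightarrow> L2_inner h (\<lambda>x. \<phi> x - g x) = 0" by auto
  let ?h = "\<lambda>x. \<phi> x - g x"
  have h: "?h \<in> ker_QTQ V" by (rule ker_QTQ_diff[OF \<phi> g(1)])
  then have h2: "integrable lebesgue (\<lambda>x. (norm (?h x))\<^sup>2)"
    unfolding ker_QTQ_iff L2_iff by blast
  have "0 = (LINT x|lebesgue. complex_of_real ((norm (?h x))\<^sup>2))"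
    using g(2)[OF h] unfolding L2_inner_def
    by (simp only: complex_norm_square mult.commute[of "cnj _"])
  then have "(LINT x|lebesgue. (norm (?h x))\<^sup>2) = 0"
    by (simp only: integral_complex_of_real of_real_eq_0_iff) simp
  then have "AE x in lebesgue. (norm (?h x))\<^sup>2 = 0"
    by (subst (asm) integral_nonneg_eq_0_iff_AE[OF h2]) auto
  then have "AE x in lebesgue. \<phi> x = S1 V \<phi> x"
    unfolding g_def by eventually_elim simp
  moreover have "\<phi> \<in> L2" using \<phi> unfolding ker_QTQ_iff by blast
  ultimately show ?thesis unfolding S1_L2_def by blast
qed

end

section \<open>Lebesgue spaces and the theorem\<close>

lemma le_add_powr:
  fixes t d p :: real
  assumes "t \<ge> 0" "d > 0" "p \<ge> 1"
  shows "t \<le> d + d powr (1 - p) * t powr p"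
proof (cases "t \<le> d")
  case True
  then show ?thesis using assms by (simp add: add_increasing2)
next
  case False
  then have t: "t > 0" "d \<le> t" using assms by auto
  have "t = d powr (1 - p) * (t * d powr (p - 1))"
    using assms by (simp add: mult.left_commute powr_add[symmetric])
  also have "\<dots> \<le> d powr (1 - p) * (t * t powr (p - 1))"
    using t assms by (intro mult_left_mono powr_mono2) auto
  also have "t * t powr (p - 1) = t powr p"
    using t by (simp add: powr_mult_base)
  finally show ?thesis using assms by linarith
qed

lemma square_le_add_powr:
  fixes t p :: real
  assumes "t \<ge> 0" "p \<ge> 2"
  shows "t\<^sup>2 \<le> 1 + t powr p"
proof (cases "t \<le> 1")
  case True
  then have "t\<^sup>2 \<le> 1" using assms by (simp add: power_le_one)
  then show ?thesis by (simp add: add_increasing2)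
next
  case False
  then have "t powr 2 \<le> t powr p" using assms by (intro powr_mono) auto
  then show ?thesis using False by (simp add: powr_numeral)
qed

lemma numeral_less_enn2real:
  assumes "numeral n < p" "p < \<infinity>"
  shows "numeral n < enn2real p"
  using assms
  by (cases p) (auto simp: ennreal_numeral[symmetric] ennreal_less_iff simp del: ennreal_numeral)

lemma L2_bounded:
  assumes f: "f \<in> L2" and g: "g \<in> borel_measurable lebesgue" and "AE x in lebesgue. norm (g x) \<le> norm (f x)"
  shows "g \<in> L2"
proof -
  have f2: "integrable lebesgue (\<lambda>x. (norm (f x))\<^sup>2)" using f by (simp add: L2_iff)
  have "integrable lebesgue (\<lambda>x. (norm (g x))\<^sup>2)"
  proof (rule Bochner_Integration.integrable_bound[OF f2])
    show "(\<lambda>x. (norm (g x))\<^sup>2) \<in> borel_measurable lebesgue"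
      by (intro borel_measurable_power borel_measurable_norm_compose g)
    show "AE x in lebesgue. norm ((norm (g x))\<^sup>2) \<le> norm ((norm (f x))\<^sup>2)"
      using assms(3) by eventually_elim (simp add: power_mono)
  qed
  then show ?thesis using g by (simp add: L2_iff)
qed

lemma L2_add:
  assumes "f \<in> L2" "g \<in> L2"
  shows "(\<lambda>x. f x + g x) \<in> L2"
proof -
  have "(\<lambda>x. - g x) \<in> L2"
    by (rule L2_bounded[OF assms(2)]) (use assms(2) in \<open>simp_all add: L2_iff\<close>)
  from L2_diff[OF assms(1) this] show ?thesis by simp
qed

text \<open>For \<open>p \<ge> 1\<close> the pointwise inequality \<open>t \<le> d + d\<^sup>1\<^sup>-\<^sup>p t\<^sup>p\<close> splits an \<open>L\<^sup>p\<close> function into a small bounded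
  part and an integrable part.\<close>

lemma Lp_small_plus_integrable:
  assumes \<Lambda>: "mem_Lp p \<Lambda>" and p: "p \<noteq> \<infinity>" "enn2real p \<ge> 1" and d: "d > 0"
    and L: "L \<in> borel_measurable borel" "AE x in lebesgue. \<Lambda> x = L x"
  shows "\<exists>N. integrable lborel N \<and> (\<forall>x. 0 \<le> N x) \<and> (\<forall>x. norm (L x) \<le> d + (N x :: real))"
proof (intro exI conjI allI)
  let ?r = "enn2real p"
  let ?N = "\<lambda>x. d powr (1 - ?r) * norm (L x) powr ?r"
  have \<Lambda>m: "\<Lambda> \<in> borel_measurable lebesgue" and \<Lambda>i: "integrable lebesgue (\<lambda>x. norm (\<Lambda> x) powr ?r)"
    using \<Lambda> p(1) by (simp_all add: mem_Lp_def)
  have m: "(\<lambda>x. norm (\<Lambda> x) powr ?r) \<in> borel_measurable lebesgue"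
    by (rule borel_measurable_integrable[OF \<Lambda>i])
  have m': "(\<lambda>x. norm (L x) powr ?r) \<in> borel_measurable borel"
    using L(1) by simp
  have "AE x in lebesgue. norm (\<Lambda> x) powr ?r = norm (L x) powr ?r"
    using L(2) by eventually_elim simp
  from lebesgue_integral_representative(2)[OF m m' this] \<Lambda>i
  have "integrable lborel (\<lambda>x. norm (L x) powr ?r)" by simp
  then show "integrable lborel ?N" by (rule integrable_mult_right)
  show "0 \<le> ?N x" "norm (L x) \<le> d + ?N x" for x
    using le_add_powr[OF norm_ge_zero d p(2), of "L x"] by simp_all
qed

text \<open>For \<open>p \<ge> 2\<close> one has \<open>|\<Lambda>|\<^sup>2 \<le> 1 + |\<Lambda>|\<^sup>p\<close>, and \<open>v\<close> is both bounded and square integrable.\<close>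

lemma (in decaying_potential) v_mult_Lp:
  assumes \<Lambda>: "mem_Lp p \<Lambda>" and p: "p \<noteq> \<infinity>" "enn2real p \<ge> 2"
  shows "(\<lambda>x. of_real (v x) * \<Lambda> x) \<in> L2"
proof -
  have \<Lambda>m: "\<Lambda> \<in> borel_measurable lebesgue" and \<Lambda>i: "integrable lebesgue (\<lambda>x. norm (\<Lambda> x) powr enn2real p)"
    using \<Lambda> p(1) by (simp_all add: mem_Lp_def)
  obtain C where C: "C > 0" "\<And>x. v x \<le> C" by (rule v_bounded) (rule that)
  have m: "(\<lambda>x. of_real (v x) * \<Lambda> x) \<in> borel_measurable lebesgue"
    by (intro borel_measurable_times borel_measurable_complex_of_real v_meas \<Lambda>m)
  have "integrable lebesgue (\<lambda>x. (norm (of_real (v x) * \<Lambda> x))\<^sup>2)"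
  proof (rule integrable_dominated)
    show "integrable lebesgue (\<lambda>x. v x * v x + C\<^sup>2 * norm (\<Lambda> x) powr enn2real p)"
      by (intro Bochner_Integration.integrable_add integrable_v_sq integrable_mult_right \<Lambda>i)
    show "(\<lambda>x. (norm (of_real (v x) * \<Lambda> x))\<^sup>2) \<in> borel_measurable lebesgue"
      by (intro borel_measurable_power borel_measurable_norm_compose m)
    fix x
    have "norm ((norm (of_real (v x) * \<Lambda> x))\<^sup>2) = (v x)\<^sup>2 * (norm (\<Lambda> x))\<^sup>2"
      by (simp add: norm_mult power_mult_distrib)
    also have "\<dots> \<le> (v x)\<^sup>2 * (1 + norm (\<Lambda> x) powr enn2real p)"
      by (intro mult_left_mono square_le_add_powr p(2)) auto
    also have "\<dots> = v x * v x + (v x)\<^sup>2 * norm (\<Lambda> x) powr enn2real p"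
      by (simp add: algebra_simps power2_eq_square)
    also have "\<dots> \<le> v x * v x + C\<^sup>2 * norm (\<Lambda> x) powr enn2real p"
      using C(2) v_sq(3) by (intro add_left_mono mult_right_mono power_mono) auto
    finally show "norm ((norm (of_real (v x) * \<Lambda> x))\<^sup>2) \<le> v x * v x + C\<^sup>2 * norm (\<Lambda> x) powr enn2real p" .
  qed
  then show ?thesis using m by (simp add: L2_iff)
qed

lemma mem_Lp_if_decay:
  assumes m: "h \<in> borel_measurable lebesgue" and C: "C > 0"
    and le: "AE x in lebesgue. norm (h x) \<le> C / (1 + norm x)" and p: "4 < p"
  shows "mem_Lp p h"
proof (cases "p = \<infinity>")
  case True
  have "AE x in lebesgue. norm (h x) \<le> C"
    using le
  proof eventually_elim
    case (elim x)
    have "C / (1 + norm x) \<le> C / 1" using C by (intro divide_left_mono) (auto simp: add_pos_nonneg)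
    then show ?case using elim by simp
  qed
  then show ?thesis using True m by (auto simp: mem_Lp_def)
next
  case False
  define r where "r = enn2real p"
  have r: "r > 4" unfolding r_def using numeral_less_enn2real[OF p] False by (simp add: less_top)
  have g: "integrable lebesgue (\<lambda>x::R4. C powr r * (1 + (norm x)\<^sup>2) powr (- (r / 2)))"
  proof (rule integrable_mult_right)
    have "(\<lambda>x::R4. (1 + (norm x)\<^sup>2) powr (- (r / 2))) \<in> borel_measurable lborel" by measurable
    from integrable_completion[OF this]
    show "integrable lebesgue (\<lambda>x::R4. (1 + (norm x)\<^sup>2) powr (- (r / 2)))"
      using integrable_bracket_powr[of "r / 2"] r by simp
  qed
  have "integrable lebesgue (\<lambda>x. norm (h x) powr r)"
  proof (rule Bochner_Integration.integrable_bound[OF g])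
    have "(\<lambda>x. norm (h x)) \<in> borel_measurable lebesgue" by (rule borel_measurable_norm_compose[OF m])
    then show "(\<lambda>x. norm (h x) powr r) \<in> borel_measurable lebesgue" by measurable
    show "AE x in lebesgue. norm (norm (h x) powr r) \<le> norm (C powr r * (1 + (norm x)\<^sup>2) powr (- (r / 2)))"
      using le
    proof eventually_elim
      case (elim x)
      have "norm (h x) powr r \<le> (C / (1 + norm x)) powr r"
        using elim r by (intro powr_mono2) auto
      also have "\<dots> = C powr r * (1 + norm x) powr (- r)"
        using C by (simp add: powr_divide powr_minus_divide)
      also have "(1 + norm x) powr (- r) = ((1 + norm x)\<^sup>2) powr (- (r / 2))"
      proof -
        have "(1 + norm x)\<^sup>2 = (1 + norm x) powr 2" by (simp add: powr_numeral)
        then have "((1 + norm x)\<^sup>2) powr (- (r / 2)) = (1 + norm x) powr (2 * (- (r / 2)))"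
          by (simp only: powr_powr)
        then show ?thesis by simp
      qed
      also have "C powr r * ((1 + norm x)\<^sup>2) powr (- (r / 2)) \<le> C powr r * (1 + (norm x)\<^sup>2) powr (- (r / 2))"
      proof (rule mult_left_mono)
        show "((1 + norm x)\<^sup>2) powr (- (r / 2)) \<le> (1 + (norm x)\<^sup>2) powr (- (r / 2))"
          using r by (intro powr_mono2') (auto simp: power2_sum add_pos_nonneg)
      qed simp
      finally show ?case by simp
    qed
  qed
  then show ?thesis using False m by (simp add: mem_Lp_def r_def)
qed

theorem lemma7p4:
  fixes V :: "R4 \<Rightarrow> real"
    and \<psi> \<phi> \<Lambda>1 \<Lambda>2 \<Lambda>3 :: "R4 \<Rightarrow> complex"
    and c :: complex
    and p1 p2 :: ennreal
  assumes V_meas: "V \<in> borel_measurable lebesgue"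
    and V_nonzero: "\<not> (AE x in lebesgue. V x = 0)"
    and v_decay: "decays_faster 3 (v_of V)"
    and p1: "4 < p1" "p1 < \<infinity>"
    and p2: "2 < p2" "p2 \<le> 4"
    and \<Lambda>1: "mem_Lp p1 \<Lambda>1"
    and \<Lambda>2: "mem_Lp p2 \<Lambda>2"
    and \<Lambda>3: "mem_Lp 2 \<Lambda>3"
    and \<psi>_decomp: "AE x in lebesgue. \<psi> x = c + \<Lambda>1 x + \<Lambda>2 x + \<Lambda>3 x"
    and \<psi>_sol: "H_distr_zero V \<psi>"
    and \<phi>_eq: "\<phi> = (\<lambda>x. of_real (U_of V x) * of_real (v_of V x) * \<psi> x)"
  shows "\<phi> \<in> S1_L2 V
    \<and> (AE x in lebesgue. \<psi> x = c - G1 (\<lambda>y. of_real (v_of V y) * \<phi> y) x)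
    \<and> c = 1 / of_real (L1_norm V) * L2_inner (\<lambda>x. of_real (v_of V x)) (T_op V \<phi>)
    \<and> c = 1 / of_real (L1_norm V) * (LINT x|lebesgue. of_real (v_of V x) * T_op V \<phi> x)
    \<and> (\<forall>p::ennreal. 4 < p \<longrightarrow> mem_Lp p (\<lambda>x. \<psi> x - c))"
proof -
  interpret decaying_potential V by unfold_locales (rule V_meas V_nonzero v_decay)+
  have r1: "p1 \<noteq> \<infinity>" "enn2real p1 > 4" using p1 numeral_less_enn2real[OF p1] by auto
  have r2: "p2 \<noteq> \<infinity>" "enn2real p2 > 2"
  proof -
    have "p2 < \<infinity>" using p2(2) by (rule le_less_trans) (simp add: ennreal_numeral_less_top)
    then show "p2 \<noteq> \<infinity>" "enn2real p2 > 2" using numeral_less_enn2real[OF p2(1)] by auto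
  qed
  have r3: "(2::ennreal) \<noteq> \<infinity>" "enn2real 2 = 2" by simp_all
  have meas: "\<Lambda>1 \<in> borel_measurable lebesgue" "\<Lambda>2 \<in> borel_measurable lebesgue" "\<Lambda>3 \<in> borel_measurable lebesgue"
    using \<Lambda>1 \<Lambda>2 \<Lambda>3 by (simp_all add: mem_Lp_def)
  have "(\<lambda>x. c + \<Lambda>1 x + \<Lambda>2 x + \<Lambda>3 x) \<in> borel_measurable lebesgue"
    using meas by measurable
  moreover have "AE x in lebesgue. c + \<Lambda>1 x + \<Lambda>2 x + \<Lambda>3 x = \<psi> x"
    using \<psi>_decomp by eventually_elim simp
  ultimately have \<psi>m: "\<psi> \<in> borel_measurable lebesgue" by (rule borel_measurable_AE)
  have \<phi>m: "\<phi> \<in> borel_measurable lebesgue"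
    unfolding \<phi>_eq by (intro borel_measurable_times borel_measurable_complex_of_real U_meas v_meas \<psi>m)

  have "(\<lambda>x. ((c * of_real (v x) + of_real (v x) * \<Lambda>1 x) + of_real (v x) * \<Lambda>2 x) + of_real (v x) * \<Lambda>3 x) \<in> L2"
    using r1 r2 r3 by (intro L2_add v_L2 v_mult_Lp[OF \<Lambda>1] v_mult_Lp[OF \<Lambda>2] v_mult_Lp[OF \<Lambda>3]) auto
  then have \<phi>L2: "\<phi> \<in> L2"
  proof (rule L2_bounded[OF _ \<phi>m])
    show "AE x in lebesgue. norm (\<phi> x) \<le>
        norm (((c * of_real (v x) + of_real (v x) * \<Lambda>1 x) + of_real (v x) * \<Lambda>2 x) + of_real (v x) * \<Lambda>3 x)"
      using \<psi>_decomp
    proof eventually_elim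
      case (elim x)
      have "((c * of_real (v x) + of_real (v x) * \<Lambda>1 x) + of_real (v x) * \<Lambda>2 x) + of_real (v x) * \<Lambda>3 x
          = of_real (v x) * \<psi> x"
        unfolding elim by (simp add: algebra_simps)
      moreover have "norm (\<phi> x) = norm (of_real (v x) * \<psi> x)"
        unfolding \<phi>_eq by (simp add: norm_mult U_sq)
      ultimately show ?case by simp
    qed
  qed

  let ?f = "\<lambda>x. of_real (v x) * \<phi> x"
  have f_eq: "?f x = of_real (V x) * \<psi> x" for x
  proof -
    have "?f x = of_real (U_of V x * (v x * v x)) * \<psi> x" unfolding \<phi>_eq by simp
    then show ?thesis by (simp only: v_sq(2))
  qed
  have fm: "?f \<in> borel_measurable lebesgue" by (rule v_mult_L2(2)[OF \<phi>L2])
  obtain F where F: "F \<in> borel_measurable borel" "AE x in lebesgue. ?f x = F x"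
    using ex_borel_representative[OF fm] by blast
  have src: "log_source F" and cubic: "integrable lborel (\<lambda>x. (norm ((1 + norm x) ^ 3 *\<^sub>R F x))\<^sup>2)"
    using v_mult_L2(3)[OF \<phi>L2 F] by simp_all
  obtain L1 where L1: "L1 \<in> borel_measurable borel" "AE x in lebesgue. \<Lambda>1 x = L1 x"
    using ex_borel_representative[OF meas(1)] by blast
  obtain L2' where L2': "L2' \<in> borel_measurable borel" "AE x in lebesgue. \<Lambda>2 x = L2' x"
    using ex_borel_representative[OF meas(2)] by blast
  obtain L3 where L3: "L3 \<in> borel_measurable borel" "AE x in lebesgue. \<Lambda>3 x = L3 x"
    using ex_borel_representative[OF meas(3)] by blast
  define \<psi>' where "\<psi>' x = c + L1 x + L2' x + L3 x" for x
  have \<psi>'m: "\<psi>' \<in> borel_measurable borel"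
    unfolding \<psi>'_def[abs_def] using L1(1) L2'(1) L3(1) by measurable
  have \<psi>': "AE x in lebesgue. \<psi> x = \<psi>' x"
    using \<psi>_decomp L1(2) L2'(2) L3(2) by eventually_elim (simp add: \<psi>'_def)

  have near: "\<exists>N. integrable lborel N \<and> (\<forall>x. 0 \<le> N x) \<and> (AE x in lborel. norm (\<psi>' x - c) \<le> \<delta> + (N x :: real))"
    if "\<delta> > 0" for \<delta>
  proof -
    have d: "\<delta> / 3 > 0" using that by simp
    obtain N1 where N1: "integrable lborel N1" "\<And>x. 0 \<le> N1 x" "\<And>x. norm (L1 x) \<le> \<delta> / 3 + N1 x"
      using Lp_small_plus_integrable[OF \<Lambda>1 r1(1) _ d L1] r1(2) by auto
    obtain N2 where N2: "integrable lborel N2" "\<And>x. 0 \<le> N2 x" "\<And>x. norm (L2' x) \<le> \<delta> / 3 + N2 x"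
      using Lp_small_plus_integrable[OF \<Lambda>2 r2(1) _ d L2'] r2(2) by auto
    obtain N3 where N3: "integrable lborel N3" "\<And>x. 0 \<le> N3 x" "\<And>x. norm (L3 x) \<le> \<delta> / 3 + N3 x"
      using Lp_small_plus_integrable[OF \<Lambda>3 r3(1) _ d L3] r3(2) by auto
    have "norm (\<psi>' x - c) \<le> \<delta> + (N1 x + N2 x + N3 x)" for x
    proof -
      have "norm (\<psi>' x - c) = norm (L1 x + L2' x + L3 x)" by (simp add: \<psi>'_def add.assoc)
      also have "\<dots> \<le> norm (L1 x) + norm (L2' x) + norm (L3 x)"
        by (intro order_trans[OF norm_triangle_ineq] add_right_mono norm_triangle_ineq)
      finally show ?thesis using N1(3)[of x] N2(3)[of x] N3(3)[of x] by linarith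
    qed
    then show ?thesis
      using N1(1,2) N2(1,2) N3(1,2)
      by (intro exI[of _ "\<lambda>x. N1 x + N2 x + N3 x"] conjI allI AE_I2) (auto intro!: add_nonneg_nonneg)
  qed
  have weak: "(LINT x|lborel. \<psi>' x * laplacian (laplacian \<eta>) x) + (LINT x|lborel. F x * \<eta> x) = 0"
    if \<eta>: "test_function \<eta>" "\<eta> \<in> borel_measurable borel" "laplacian (laplacian \<eta>) \<in> borel_measurable borel" for \<eta>
  proof -
    have "(LINT x|lebesgue. \<psi> x * laplacian (laplacian \<eta>) x) = (LINT x|lborel. \<psi>' x * laplacian (laplacian \<eta>) x)"
    proof (rule lebesgue_integral_representative(1))
      show "(\<lambda>x. \<psi> x * laplacian (laplacian \<eta>) x) \<in> borel_measurable lebesgue"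
        by (intro borel_measurable_times \<psi>m borel_imp_lebesgue[OF \<eta>(3)])
      show "AE x in lebesgue. \<psi> x * laplacian (laplacian \<eta>) x = \<psi>' x * laplacian (laplacian \<eta>) x"
        using \<psi>' by eventually_elim simp
    qed (intro borel_measurable_times \<psi>'m \<eta>(3))
    moreover have "(LINT x|lebesgue. ?f x * \<eta> x) = (LINT x|lborel. F x * \<eta> x)"
    proof (rule lebesgue_integral_representative(1))
      show "(\<lambda>x. ?f x * \<eta> x) \<in> borel_measurable lebesgue"
        by (intro borel_measurable_times[OF fm] borel_imp_lebesgue[OF \<eta>(2)])
      show "AE x in lebesgue. ?f x * \<eta> x = F x * \<eta> x"
        using F(2) by eventually_elim simp
    qed (intro borel_measurable_times F(1) \<eta>(2))
    moreover have "(LINT x|lebesgue. \<psi> x * laplacian (laplacian \<eta>) x)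
        + (LINT x|lebesgue. of_real (V x) * \<psi> x * \<eta> x) = 0"
      using \<psi>_sol \<eta>(1) unfolding H_distr_zero_def by blast
    ultimately show ?thesis unfolding f_eq by simp
  qed

  interpret src: log_source F by (rule src)
  have neutral: "(LINT x|lborel. F x) = 0"
    by (rule src.source_neutral[OF \<psi>'m near weak])
  have rep: "AE x in lborel. \<psi>' x = c + src.log_pot x / of_real (8 * pi\<^sup>2)"
    by (rule src.representation[OF \<psi>'m near weak])
  have \<psi>_pot: "AE x in lebesgue. \<psi> x = c + src.log_pot x / of_real (8 * pi\<^sup>2)"
    using \<psi>' AE_completion[OF rep] by eventually_elim simp
  have G1: "pot \<phi> x = - (src.log_pot x / of_real (8 * pi\<^sup>2))" for x
    by (rule G1_representative(1)[OF fm F(2) src])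
  have \<psi>_G1: "AE x in lebesgue. \<psi> x = c - pot \<phi> x"
    using \<psi>_pot by eventually_elim (simp only: G1 diff_minus_eq_add)
  have T: "AE x in lebesgue. T_op V \<phi> x = c * of_real (v x)"
    using \<psi>_G1
  proof eventually_elim
    case (elim x)
    have "of_real (U_of V x) * \<phi> x = of_real (U_of V x * U_of V x) * (of_real (v x) * \<psi> x)"
      unfolding \<phi>_eq by simp
    then have "T_op V \<phi> x = of_real (v x) * \<psi> x + of_real (v x) * pot \<phi> x"
      unfolding T_op_def by (simp add: U_sq)
    then show ?case unfolding elim by (simp add: algebra_simps)
  qed
  have "(LINT x|lebesgue. ?f x) = 0"
    using lebesgue_integral_representative(1)[OF fm F] neutral by simp
  then have "\<phi> \<in> S1_L2 V"
    using \<phi>L2 T by (intro ker_QTQ_subset_S1_L2) (auto simp: ker_QTQ_iff)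
  moreover have vT: "(LINT x|lebesgue. of_real (v x) * T_op V \<phi> x) = c * of_real (L1_norm V)"
    using integral_v_multiple[OF T_op_L2(2)[OF \<phi>L2] T] by (simp only: v_mass_L1)
  then have "c = 1 / of_real (L1_norm V) * (LINT x|lebesgue. of_real (v x) * T_op V \<phi> x)"
    using v_mass_nonzero unfolding v_mass_L1 by simp
  moreover from this have "c = 1 / of_real (L1_norm V) * L2_inner (\<lambda>x. of_real (v x)) (T_op V \<phi>)"
    by (simp add: L2_inner_def)
  moreover have "mem_Lp p (\<lambda>x. \<psi> x - c)" if "4 < p" for p
  proof -
    obtain C where C: "C > 0" "\<And>a. norm (src.log_pot a) \<le> C / (1 + norm a)"
      by (rule src.log_pot_decay[OF cubic neutral]) (rule that)
    show ?thesis
    proof (rule mem_Lp_if_decay[OF _ _ _ that])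
      show "(\<lambda>x. \<psi> x - c) \<in> borel_measurable lebesgue" using \<psi>m by simp
      show "C / (8 * pi\<^sup>2) > 0" using C(1) by simp
      show "AE x in lebesgue. norm (\<psi> x - c) \<le> C / (8 * pi\<^sup>2) / (1 + norm x)"
        using \<psi>_pot
      proof eventually_elim
        case (elim x)
        have "norm (\<psi> x - c) = norm (src.log_pot x) / (8 * pi\<^sup>2)"
          unfolding elim by (simp add: norm_divide norm_mult norm_power)
        also have "\<dots> \<le> C / (1 + norm x) / (8 * pi\<^sup>2)"
          by (intro divide_right_mono C(2)) simp
        finally show ?case by (simp add: mult.commute)
      qed
    qed
  qed
  ultimately show ?thesis using \<psi>_G1 by blast
qed

end
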